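(* Let $n>3$ and let $M$ be an $n$-dimensional generalized graph manifold. The integer $c'(M,(z,f))$, i.e. the corank (number of variables minus rank) of the homogeneous linear system $LS_2(M)$ written in a Waldhausen basis $(z,f)$ of $M$, does not depend on the choice of the Waldhausen basis $(z,f)$.
   Context: Generalized graph manifolds. Let $n\ge 3$. A generalized graph manifold is a compact $n$-dimensional manifold $M=\bigcup_{v\in V}M_v$ consisting of finitely many blocks such that: (1) each block $M_v$ is homeomorphic to $T^{n-2}\times S_v$, where $T^{n-2}$ is the $(n-2)$-torus and $S_v$ is a compact connected oriented surface with boundary and with negative Euler characteristic; (2) $M$ is glued from its blocks by diffeomorphisms between their boundary $(n-1)$-tori; (3) the gluing diffeomorphisms do not identify the homotopy classes of the fiber $(n-2)$-tori. A block may be glued to itself, and some boundary tori may remain unglued (forming $\partial M$). Notation. $\partial v$ is the index set of the boundary tori of $M_v$: $\partial M_v=\bigcup_{w\in\partial v}T_w$. $W$ is the set of $w\in\bigcup_v\partial v$ with $T_w\not\subset\partial M$ (gluing tori). For $w\in W$, $T_w$ is glued to $T_{-w}$ by $\psi_w:T_w\to T_{-w}$, where $w\mapsto -w$ is an involution of $W$ without fixed points and $\psi_{-w}=\psi_w^{-1}$. Put $L_w=H_1(T_w,\mathbb{Z})\simeq\mathbb{Z}^{n-1}$, let $F_v\simeq\mathbb{Z}^{n-2}$ be the first homology group of the fiber torus of $M_v$, and for $w\in\partial v$ let $\iota_v^w:F_v\to L_w$ be the map induced by inclusion. Waldhausen bases. A set $\{z_w\in L_w\mid w\in\partial v\}$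 represents a boundary if $\sum_{w\in\partial v}(\iota_w)_*z_w=0$ in $H_1(M_v,\mathbb{Z})$, where $\iota_w:T_w\to M_v$ is the inclusion. A Waldhausen basis of $M_v$ is given by a basis $(f_v^1,\dots,f_v^{n-2})$ of $F_v$ and a set $\{z_w\}_{w\in\partial v}$ representing a boundary such that for each $w\in\partial v$ the tuple $(z_w,f_w)=(z_w,\iota_v^wf_v^1,\dots,\iota_v^wf_v^{n-2})$ is a basis of $L_w$. A Waldhausen basis $(z,f)$ of $M$ is a choice of a Waldhausen basis in every block. For $w\in W$ the gluing matrix $\Psi_w\in GL_{n-1}(\mathbb{Z})$ is defined by $(z_{-w},f_{-w})=(z_w,f_w)\Psi_w$, where $L_w$ and $L_{-w}$ are identified by $(\psi_w)_*$. Write $$\Psi_w=\begin{pmatrix}a_w&b_w\\c_w&d_w\end{pmatrix}$$ with $a_w$ a number, $b_w$ a row of length $n-2$, $c_w$ a column of length $n-2$, $d_w$ an $(n-2)\times(n-2)$ matrix. By condition (3), $b_w\ne0$. The system $LS_2(M)$ ($n>3$). For each $w\in W$ let $P_w$ be an $(n-2)\times(n-3)$ matrix of rank $n-3$ with $b_wP_w=0$ (the system below is, up to equivalence, independent of the choice of $P_w$). The variables are the (independent) entries of a real symmetric $(n-2)\times(n-2)$ matrix $G_v$ for each $v\in V$. The equations are $$P_w^T\,(G_{v'}-d_w^TG_vd_w)\,P_w=0,\qquad w\in W,$$ where $v,v'\in V$ are the blocks with $w\in\partial v$, $-w\in\partial v'$. *)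

theory Defs
  imports
    "HOL-Homology.Homology"
    "HOL-Analysis.Abstract_Topological_Spaces"
    "HOL-Analysis.Sum_Topology"
    "HOL-Library.Countable_Set"
    "Jordan_Normal_Form.DL_Rank"
begin

section \<open>Topological and smooth manifolds with boundary\<close>

definition half_space :: "nat \<Rightarrow> (nat \<Rightarrow> real) topology" where
  "half_space n = subtopology (Euclidean_space n) {x. 0 \<le> x 0}"

type_synonym 'a chart = "'a set \<times> ('a \<Rightarrow> nat \<Rightarrow> real)"

definition is_chart :: "nat \<Rightarrow> 'a topology \<Rightarrow> 'a chart \<Rightarrow> bool" where
  "is_chart n X = (\<lambda>(U, c).
     openin X U \<and> openin (half_space n) (c ` U) \<and>
     homeomorphic_map (subtopology X U) (subtopology (half_space n) (c ` U)) c)"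

definition manifold_with_boundary :: "nat \<Rightarrow> 'a topology \<Rightarrow> bool" where
  "manifold_with_boundary n X \<longleftrightarrow>
     Hausdorff_space X \<and> second_countable X \<and>
     (\<forall>x\<in>topspace X. \<exists>U c. x \<in> U \<and> is_chart n X (U, c))"

definition manifold_boundary :: "nat \<Rightarrow> 'a topology \<Rightarrow> 'a set" where
  "manifold_boundary n X = {x. \<exists>U c. x \<in> U \<and> is_chart n X (U, c) \<and> c x 0 = 0}"

text \<open>A real function on an open subset of $R^n$ is smooth if all its iterated partial
  derivatives exist and are continuous; \<open>D \<alpha>\<close> is the iterated derivative along the
  word \<open>\<alpha>\<close> in the coordinates.\<close>

definition smooth_fun :: "nat \<Rightarrow> (nat \<Rightarrow> real) set \<Rightarrow> ((nat \<Rightarrow> real) \<Rightarrow> real) \<Rightarrow> bool" where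
  "smooth_fun n U g \<longleftrightarrow>
     (\<exists>D :: nat list \<Rightarrow> (nat \<Rightarrow> real) \<Rightarrow> real.
        (\<forall>x\<in>U. D [] x = g x) \<and>
        (\<forall>\<alpha>. set \<alpha> \<subseteq> {..<n} \<longrightarrow>
           continuous_map (subtopology (Euclidean_space n) U) euclideanreal (D \<alpha>) \<and>
           (\<forall>x\<in>U. \<forall>i<n.
              ((\<lambda>t. D \<alpha> (x(i := t))) has_real_derivative D (i # \<alpha>) x) (at (x i)))))"

text \<open>On an arbitrary subset of $R^n$, smooth means locally extendable to a smooth map on an
  open subset of $R^n$.\<close>

definition smooth_map_on ::
  "nat \<Rightarrow> (nat \<Rightarrow> real) set \<Rightarrow> ((nat \<Rightarrow> real) \<Rightarrow> nat \<Rightarrow> real) \<Rightarrow> bool" where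
  "smooth_map_on n A f \<longleftrightarrow>
     (\<forall>x\<in>A. \<exists>U g. openin (Euclidean_space n) U \<and> x \<in> U \<and>
        (\<forall>i<n. smooth_fun n U (\<lambda>y. g y i)) \<and>
        (\<forall>y\<in>A \<inter> U. \<forall>i<n. g y i = f y i))"

definition smooth_atlas :: "nat \<Rightarrow> 'a topology \<Rightarrow> 'a chart set \<Rightarrow> bool" where
  "smooth_atlas n X \<A> \<longleftrightarrow>
     (\<forall>C\<in>\<A>. is_chart n X C) \<and> (\<Union>(U, c)\<in>\<A>. U) = topspace X \<and>
     (\<forall>(U, c)\<in>\<A>. \<forall>(U', c')\<in>\<A>. smooth_map_on n (c ` (U \<inter> U')) (c' \<circ> inv_into U c))"

definition smooth_in_atlas ::
  "nat \<Rightarrow> 'a chart set \<Rightarrow> 'b chart set \<Rightarrow> 'a set \<Rightarrow> ('a \<Rightarrow> 'b) \<Rightarrow> bool" where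
  "smooth_in_atlas n \<A> \<B> T g \<longleftrightarrow>
     (\<forall>(U, c)\<in>\<A>. \<forall>(U', c')\<in>\<B>.
        smooth_map_on n (c ` {x \<in> U \<inter> T. g x \<in> U'}) (c' \<circ> g \<circ> inv_into U c))"

definition diffeo_between ::
  "nat \<Rightarrow> 'a topology \<Rightarrow> 'a chart set \<Rightarrow> 'a set \<Rightarrow>
   'b topology \<Rightarrow> 'b chart set \<Rightarrow> 'b set \<Rightarrow> ('a \<Rightarrow> 'b) \<Rightarrow> bool" where
  "diffeo_between n X \<A> T Y \<B> T' g \<longleftrightarrow>
     homeomorphic_map (subtopology X T) (subtopology Y T') g \<and>
     smooth_in_atlas n \<A> \<B> T g \<and> smooth_in_atlas n \<B> \<A> T' (inv_into T g)"

text \<open>An orientation is a continuous choice of a generator of the local homology group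
  $H_n(X, X \setminus x)$ at the interior points.\<close>

definition is_orientation :: "nat \<Rightarrow> 'a topology \<Rightarrow> ('a \<Rightarrow> 'a chain set) \<Rightarrow> bool" where
  "is_orientation n X ori \<longleftrightarrow>
     (\<forall>x \<in> topspace X - manifold_boundary n X.
        (let H = relative_homology_group (int n) X (topspace X - {x}) in
           ori x \<in> carrier H \<and> (\<forall>y\<in>carrier H. \<exists>k::int. y = ori x [^]\<^bsub>H\<^esub> k)) \<and>
        (\<exists>U \<mu>. openin X U \<and> x \<in> U \<and> U \<subseteq> topspace X - manifold_boundary n X \<and>
           \<mu> \<in> carrier (relative_homology_group (int n) X (topspace X - U)) \<and>
           (\<forall>y\<in>U. ori y =
              hom_induced (int n) X (topspace X - U) X (topspace X - {y}) id \<mu>)))"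

section \<open>Abelian groups and the Euler characteristic\<close>

definition int_independent :: "('a, 'b) monoid_scheme \<Rightarrow> 'a set \<Rightarrow> bool" where
  "int_independent G S \<longleftrightarrow> finite S \<and> S \<subseteq> carrier G \<and>
     (\<forall>c :: 'a \<Rightarrow> int. (\<Otimes>\<^bsub>G\<^esub>x\<in>S. x [^]\<^bsub>G\<^esub> c x) = \<one>\<^bsub>G\<^esub> \<longrightarrow> (\<forall>x\<in>S. c x = 0))"

definition betti :: "nat \<Rightarrow> 'a topology \<Rightarrow> nat" where
  "betti p X = Sup (card ` {S. int_independent (homology_group (int p) X) S})"

definition euler_characteristic :: "'a topology \<Rightarrow> int" where
  "euler_characteristic X = (\<Sum>p | betti p X \<noteq> 0. (-1) ^ p * int (betti p X))"

text \<open>\<open>(b 0, \<dots>, b (m - 1))\<close> is a basis of the (multiplicatively written) abelian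
  group \<open>G\<close> as a free abelian group.\<close>

definition int_basis :: "('a, 'b) monoid_scheme \<Rightarrow> nat \<Rightarrow> (nat \<Rightarrow> 'a) \<Rightarrow> bool" where
  "int_basis G m b \<longleftrightarrow> (\<forall>i<m. b i \<in> carrier G) \<and>
     (\<forall>x\<in>carrier G. \<exists>!c. c \<in> ({..<m} \<rightarrow>\<^sub>E (UNIV :: int set)) \<and>
        x = (\<Otimes>\<^bsub>G\<^esub>i\<in>{..<m}. b i [^]\<^bsub>G\<^esub> c i))"

section \<open>Generalized graph manifolds\<close>

definition torus :: "nat \<Rightarrow> (nat \<Rightarrow> nat \<Rightarrow> real) topology" where
  "torus k = product_topology (\<lambda>_. nsphere 1) {..<k}"

text \<open>The data of a graph manifold. \<open>tori\<close> indexes the boundary tori of all blocks and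
  \<open>block_of w\<close> is the block \<open>v\<close> with $w \in \partial v$. The torus $T_w$ corresponds to
  the boundary circle \<open>circ w\<close> of the surface. \<open>triv v\<close> is the homeomorphism from
  $T^{n-2} \times S_v$ to \<open>block v\<close>, and \<open>proj v\<close> is the canonical map from
  \<open>block v\<close> to the glued manifold \<open>total\<close>.\<close>

record ('v, 'w, 's, 'x, 'm) graph_mfd =
  verts :: "'v set"
  tori :: "'w set"
  block_of :: "'w \<Rightarrow> 'v"
  surf :: "'v \<Rightarrow> 's topology"
  surf_ori :: "'v \<Rightarrow> 's \<Rightarrow> 's chain set"
  circ :: "'w \<Rightarrow> 's set"
  block :: "'v \<Rightarrow> 'x topology"
  atlas :: "'v \<Rightarrow> 'x chart set"
  triv :: "'v \<Rightarrow> (nat \<Rightarrow> nat \<Rightarrow> real) \<times> 's \<Rightarrow> 'x"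
  total :: "'m topology"
  proj :: "'v \<Rightarrow> 'x \<Rightarrow> 'm"
  neg :: "'w \<Rightarrow> 'w"
  glue :: "'w \<Rightarrow> 'x \<Rightarrow> 'x"

definition bd :: "('v, 'w, 's, 'x, 'm) graph_mfd \<Rightarrow> 'v \<Rightarrow> 'w set" where
  "bd M v = {w \<in> tori M. block_of M w = v}"

definition bd_torus :: "nat \<Rightarrow> ('v, 'w, 's, 'x, 'm) graph_mfd \<Rightarrow> 'w \<Rightarrow> 'x set" where
  "bd_torus n M w = triv M (block_of M w) ` (topspace (torus (n - 2)) \<times> circ M w)"

definition bd_top :: "nat \<Rightarrow> ('v, 'w, 's, 'x, 'm) graph_mfd \<Rightarrow> 'w \<Rightarrow> 'x topology" where
  "bd_top n M w = subtopology (block M (block_of M w)) (bd_torus n M w)"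

definition glue_set :: "nat \<Rightarrow> ('v, 'w, 's, 'x, 'm) graph_mfd \<Rightarrow> 'w set" where
  "glue_set n M =
     {w \<in> tori M. \<not> proj M (block_of M w) ` bd_torus n M w \<subseteq> manifold_boundary n (total M)}"

text \<open>The inclusion of a fiber torus into $T_w$; all the choices of the base point in
  the circle give homotopic maps.\<close>

definition fiber_incl ::
  "('v, 'w, 's, 'x, 'm) graph_mfd \<Rightarrow> 'w \<Rightarrow> (nat \<Rightarrow> nat \<Rightarrow> real) \<Rightarrow> 'x" where
  "fiber_incl M w t = triv M (block_of M w) (t, SOME p. p \<in> circ M w)"

text \<open>The last clause says that the image under \<open>glue w\<close> of the fiber torus is not
  homotopic to the fiber torus on the other side, the homotopy class of an embedded torus being
  taken up to reparametrization.\<close>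

definition generalized_graph_manifold ::
  "nat \<Rightarrow> ('v, 'w, 's, 'x, 'm) graph_mfd \<Rightarrow> bool" where
  "generalized_graph_manifold n M \<longleftrightarrow>
     3 \<le> n \<and> finite (verts M) \<and> finite (tori M) \<and> block_of M ` tori M \<subseteq> verts M \<and>
     (\<forall>v\<in>verts M.
        manifold_with_boundary 2 (surf M v) \<and> compact_space (surf M v) \<and>
        connected_space (surf M v) \<and> is_orientation 2 (surf M v) (surf_ori M v) \<and>
        manifold_boundary 2 (surf M v) \<noteq> {} \<and> euler_characteristic (surf M v) < 0 \<and>
        bij_betw (circ M) (bd M v)
          (connected_components_of
             (subtopology (surf M v) (manifold_boundary 2 (surf M v)))) \<and>
        (\<forall>w\<in>bd M v. subtopology (surf M v) (circ M w) homeomorphic_space nsphere 1) \<and>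
        smooth_atlas n (block M v) (atlas M v) \<and>
        homeomorphic_map (prod_topology (torus (n - 2)) (surf M v)) (block M v) (triv M v)) \<and>
     manifold_with_boundary n (total M) \<and> compact_space (total M) \<and>
     quotient_map (sum_topology (block M) (verts M)) (total M) (\<lambda>(v, x). proj M v x) \<and>
     (\<forall>v\<in>verts M. \<forall>v'\<in>verts M. \<forall>x\<in>topspace (block M v). \<forall>x'\<in>topspace (block M v').
        proj M v x = proj M v' x' \<longleftrightarrow>
          (v, x) = (v', x') \<or>
          (\<exists>w\<in>glue_set n M. block_of M w = v \<and> x \<in> bd_torus n M w \<and>
             block_of M (neg M w) = v' \<and> x' = glue M w x)) \<and>
     (\<forall>w\<in>glue_set n M.
        neg M w \<in> glue_set n M \<and> neg M (neg M w) = w \<and> neg M w \<noteq> w \<and>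
        diffeo_between n
          (block M (block_of M w)) (atlas M (block_of M w)) (bd_torus n M w)
          (block M (block_of M (neg M w))) (atlas M (block_of M (neg M w)))
          (bd_torus n M (neg M w)) (glue M w) \<and>
        (\<forall>x\<in>bd_torus n M w. glue M (neg M w) (glue M w x) = x) \<and>
        \<not> (\<exists>h. homeomorphic_map (torus (n - 2)) (torus (n - 2)) h \<and>
              homotopic_with (\<lambda>_. True) (torus (n - 2)) (bd_top n M (neg M w))
                (glue M w \<circ> fiber_incl M w) (fiber_incl M (neg M w) \<circ> h)))"

section \<open>Waldhausen bases and gluing matrices\<close>

definition fiber_hom :: "nat \<Rightarrow> (nat \<Rightarrow> nat \<Rightarrow> real) chain set monoid" where
  "fiber_hom n = homology_group 1 (torus (n - 2))"

definition bd_hom :: "nat \<Rightarrow> ('v, 'w, 's, 'x, 'm) graph_mfd \<Rightarrow> 'w \<Rightarrow> 'x chain set monoid" where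
  "bd_hom n M w = homology_group 1 (bd_top n M w)"

definition fiber_to_bd ::
  "nat \<Rightarrow> ('v, 'w, 's, 'x, 'm) graph_mfd \<Rightarrow> 'w \<Rightarrow> (nat \<Rightarrow> nat \<Rightarrow> real) chain set \<Rightarrow> 'x chain set" where
  "fiber_to_bd n M w = hom_induced 1 (torus (n - 2)) {} (bd_top n M w) {} (fiber_incl M w)"

definition bd_to_block ::
  "nat \<Rightarrow> ('v, 'w, 's, 'x, 'm) graph_mfd \<Rightarrow> 'w \<Rightarrow> 'x chain set \<Rightarrow> 'x chain set" where
  "bd_to_block n M w = hom_induced 1 (bd_top n M w) {} (block M (block_of M w)) {} id"

definition glue_hom ::
  "nat \<Rightarrow> ('v, 'w, 's, 'x, 'm) graph_mfd \<Rightarrow> 'w \<Rightarrow> 'x chain set \<Rightarrow> 'x chain set" where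
  "glue_hom n M w = hom_induced 1 (bd_top n M w) {} (bd_top n M (neg M w)) {} (glue M w)"

definition represents_boundary ::
  "nat \<Rightarrow> ('v, 'w, 's, 'x, 'm) graph_mfd \<Rightarrow> 'v \<Rightarrow> ('w \<Rightarrow> 'x chain set) \<Rightarrow> bool" where
  "represents_boundary n M v z \<longleftrightarrow>
     (\<forall>w\<in>bd M v. z w \<in> carrier (bd_hom n M w)) \<and>
     (\<Otimes>\<^bsub>homology_group 1 (block M v)\<^esub>w\<in>bd M v. bd_to_block n M w (z w))
       = \<one>\<^bsub>homology_group 1 (block M v)\<^esub>"

text \<open>The tuple $(z_w, f_w)$, numbered from 0; \<open>f v i\<close> with \<open>i < n - 2\<close> is the element
  $f_v^{i+1}$.\<close>

definition bd_tuple ::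
  "nat \<Rightarrow> ('v, 'w, 's, 'x, 'm) graph_mfd \<Rightarrow> ('w \<Rightarrow> 'x chain set) \<Rightarrow>
   ('v \<Rightarrow> nat \<Rightarrow> (nat \<Rightarrow> nat \<Rightarrow> real) chain set) \<Rightarrow> 'w \<Rightarrow> nat \<Rightarrow> 'x chain set" where
  "bd_tuple n M z f w i =
     (case i of 0 \<Rightarrow> z w | Suc k \<Rightarrow> fiber_to_bd n M w (f (block_of M w) k))"

definition waldhausen_basis ::
  "nat \<Rightarrow> ('v, 'w, 's, 'x, 'm) graph_mfd \<Rightarrow> ('w \<Rightarrow> 'x chain set) \<Rightarrow>
   ('v \<Rightarrow> nat \<Rightarrow> (nat \<Rightarrow> nat \<Rightarrow> real) chain set) \<Rightarrow> bool" where
  "waldhausen_basis n M z f \<longleftrightarrow>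
     (\<forall>v\<in>verts M.
        int_basis (fiber_hom n) (n - 2) (f v) \<and> represents_boundary n M v z \<and>
        (\<forall>w\<in>bd M v. int_basis (bd_hom n M w) (n - 1) (bd_tuple n M z f w)))"

definition gluing_matrix ::
  "nat \<Rightarrow> ('v, 'w, 's, 'x, 'm) graph_mfd \<Rightarrow> ('w \<Rightarrow> 'x chain set) \<Rightarrow>
   ('v \<Rightarrow> nat \<Rightarrow> (nat \<Rightarrow> nat \<Rightarrow> real) chain set) \<Rightarrow> 'w \<Rightarrow> int mat" where
  "gluing_matrix n M z f w =
     (THE A. A \<in> carrier_mat (n - 1) (n - 1) \<and>
        (\<forall>j<n - 1. bd_tuple n M z f (neg M w) j =
           (\<Otimes>\<^bsub>bd_hom n M (neg M w)\<^esub>i\<in>{..<n - 1}.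
              glue_hom n M w (bd_tuple n M z f w i) [^]\<^bsub>bd_hom n M (neg M w)\<^esub> (A $$ (i, j)))))"

definition b_row ::
  "nat \<Rightarrow> ('v, 'w, 's, 'x, 'm) graph_mfd \<Rightarrow> ('w \<Rightarrow> 'x chain set) \<Rightarrow>
   ('v \<Rightarrow> nat \<Rightarrow> (nat \<Rightarrow> nat \<Rightarrow> real) chain set) \<Rightarrow> 'w \<Rightarrow> real mat" where
  "b_row n M z f w = mat 1 (n - 2) (\<lambda>(i, j). real_of_int (gluing_matrix n M z f w $$ (0, Suc j)))"

definition d_mat ::
  "nat \<Rightarrow> ('v, 'w, 's, 'x, 'm) graph_mfd \<Rightarrow> ('w \<Rightarrow> 'x chain set) \<Rightarrow>
   ('v \<Rightarrow> nat \<Rightarrow> (nat \<Rightarrow> nat \<Rightarrow> real) chain set) \<Rightarrow> 'w \<Rightarrow> real mat" where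
  "d_mat n M z f w =
     mat (n - 2) (n - 2) (\<lambda>(i, j). real_of_int (gluing_matrix n M z f w $$ (Suc i, Suc j)))"

section \<open>The linear system\<close>

definition admissible_P ::
  "nat \<Rightarrow> ('v, 'w, 's, 'x, 'm) graph_mfd \<Rightarrow> ('w \<Rightarrow> 'x chain set) \<Rightarrow>
   ('v \<Rightarrow> nat \<Rightarrow> (nat \<Rightarrow> nat \<Rightarrow> real) chain set) \<Rightarrow> ('w \<Rightarrow> real mat) \<Rightarrow> bool" where
  "admissible_P n M z f P \<longleftrightarrow>
     (\<forall>w\<in>glue_set n M. P w \<in> carrier_mat (n - 2) (n - 3) \<and>
        vec_space.rank (n - 2) (P w) = n - 3 \<and>
        b_row n M z f w * P w = 0\<^sub>m 1 (n - 3))"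

definition LS2_lhs ::
  "nat \<Rightarrow> ('v, 'w, 's, 'x, 'm) graph_mfd \<Rightarrow> ('w \<Rightarrow> 'x chain set) \<Rightarrow>
   ('v \<Rightarrow> nat \<Rightarrow> (nat \<Rightarrow> nat \<Rightarrow> real) chain set) \<Rightarrow> ('w \<Rightarrow> real mat) \<Rightarrow>
   ('v \<Rightarrow> real mat) \<Rightarrow> 'w \<Rightarrow> real mat" where
  "LS2_lhs n M z f P G w =
     transpose_mat (P w) *
       (G (block_of M (neg M w)) -
        transpose_mat (d_mat n M z f w) * G (block_of M w) * d_mat n M z f w) * P w"

definition LS2_vars :: "nat \<Rightarrow> ('v, 'w, 's, 'x, 'm) graph_mfd \<Rightarrow> ('v \<times> nat \<times> nat) set" where
  "LS2_vars n M = {(v, i, j). v \<in> verts M \<and> i \<le> j \<and> j < n - 2}"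

definition LS2_eqs :: "nat \<Rightarrow> ('v, 'w, 's, 'x, 'm) graph_mfd \<Rightarrow> ('w \<times> nat \<times> nat) set" where
  "LS2_eqs n M = glue_set n M \<times> {..<n - 3} \<times> {..<n - 3}"

text \<open>The family of symmetric matrices in which one variable is 1 and the others are 0;
  evaluating the left-hand sides on it gives the coefficients at this variable.\<close>

definition unit_family :: "nat \<Rightarrow> 'v \<times> nat \<times> nat \<Rightarrow> 'v \<Rightarrow> real mat" where
  "unit_family n = (\<lambda>(v, i, j) u. mat (n - 2) (n - 2)
     (\<lambda>(k, l). if u = v \<and> ((k, l) = (i, j) \<or> (k, l) = (j, i)) then 1 else 0))"

definition LS2_coeff ::
  "nat \<Rightarrow> ('v, 'w, 's, 'x, 'm) graph_mfd \<Rightarrow> ('w \<Rightarrow> 'x chain set) \<Rightarrow>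
   ('v \<Rightarrow> nat \<Rightarrow> (nat \<Rightarrow> nat \<Rightarrow> real) chain set) \<Rightarrow> ('w \<Rightarrow> real mat) \<Rightarrow>
   'w \<times> nat \<times> nat \<Rightarrow> 'v \<times> nat \<times> nat \<Rightarrow> real" where
  "LS2_coeff n M z f P = (\<lambda>(w, a, b) x. LS2_lhs n M z f P (unit_family n x) w $$ (a, b))"

text \<open>On a finite set \<open>S\<close>, \<open>from_nat_into S\<close> is an enumeration by
  \<open>{..<card S}\<close>; the rank does not depend on it.\<close>

definition LS2_matrix ::
  "nat \<Rightarrow> ('v, 'w, 's, 'x, 'm) graph_mfd \<Rightarrow> ('w \<Rightarrow> 'x chain set) \<Rightarrow>
   ('v \<Rightarrow> nat \<Rightarrow> (nat \<Rightarrow> nat \<Rightarrow> real) chain set) \<Rightarrow> ('w \<Rightarrow> real mat) \<Rightarrow> real mat" where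
  "LS2_matrix n M z f P =
     mat (card (LS2_eqs n M)) (card (LS2_vars n M))
       (\<lambda>(r, s). LS2_coeff n M z f P
          (from_nat_into (LS2_eqs n M) r) (from_nat_into (LS2_vars n M) s))"

text \<open>The number $c'(M, (z, f))$, computed with the matrices $P_w$ given by \<open>P\<close>.\<close>

definition LS2_corank ::
  "nat \<Rightarrow> ('v, 'w, 's, 'x, 'm) graph_mfd \<Rightarrow> ('w \<Rightarrow> 'x chain set) \<Rightarrow>
   ('v \<Rightarrow> nat \<Rightarrow> (nat \<Rightarrow> nat \<Rightarrow> real) chain set) \<Rightarrow> ('w \<Rightarrow> real mat) \<Rightarrow> int" where
  "LS2_corank n M z f P =
     int (card (LS2_vars n M)) - int (vec_space.rank (card (LS2_eqs n M)) (LS2_matrix n M z f P))"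

end

theory Submission
  imports Defs "HOL-Analysis.Bounded_Continuous_Function" "HOL-Analysis.Further_Topology"
begin

text \<open>Let two Waldhausen bases be related by $f'_v = f_v S_v$ and $z'_w = \epsilon_w z_w + f_w r_w$ with
  $S_v \in GL_{n-2}(Z)$. Comparing gluing matrices gives $\epsilon_w b'_w = b_w S_{v'}$ and
  $S_v d'_w = d_w S_{v'} - r_w b'_w$. Since $b_w \neq 0$, the columns of $P_w$ span the kernel of $b_w$,
  so $S_{v'} P'_w = P_w Q_w$ for some $Q_w$, and the substitution $G_v \mapsto (S_v^{-1})^T G_v S_v^{-1}$
  turns the left-hand side $X_w$ of the first system into $Q_w^T X_w Q_w$, the left-hand side of the
  second. Hence the second coefficient matrix is the first one multiplied from both sides,
  its rank is not larger, and by symmetry the ranks agree.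

  The topological input is $b_w \neq 0$. A map from a torus to the circle is determined up to homotopy
  by its effect on $H_1$, because it is a monomial in the coordinates times the exponential of
  a real function. So a gluing with $b_w = 0$ would identify the homotopy classes of the fiber tori.\<close>

section \<open>Ranks of real matrices\<close>

text \<open>Condition (3) speaks of homotopy classes, while b_w is a homological quantity, and most
  of the work bridges the two. Maps from a torus to T_w have to be homotopic as soon as they agree
  on H_1; since T_w is a product of circles, this can be checked for one circle-valued component at
  a time. Condition (3) also allows a reparametrization of the fiber torus, so an integral matrix
  between fiber classes must be realized by an actual homeomorphism, the monomial map with these
  exponents. In the algebra only an inequality of ranks is proved, for two bases in either order. It
  asks for the existence of Q_w and not for its invertibility, and it treats P_w and P'_w as
  unrelated choices, so that independence of P_w is the case of equal bases. For b_w = 0 the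
  argument would break down: the columns of P_w would span only a hyperplane in the kernel of b_w,
  and S_{v'} P'_w might not factor through P_w.\<close>

lemma mult_unit_vec:
  fixes A :: "'a :: semiring_1 mat"
  assumes "A \<in> carrier_mat n nc" "j < nc"
  shows "A *\<^sub>v unit_vec nc j = col A j"
  using assms by (intro eq_vecI) auto

text \<open>Forwards, \<open>X\<close> selects \<open>r\<close> independent columns of
  \<open>A\<close>; backwards, the \<open>r\<close> columns of \<open>A * X\<close> are independent
  inside the column space of \<open>A\<close>. The rank is defined through the set of columns, in
  which repetitions are lost; injectivity on vectors avoids this and reduces facts about products to
  associativity.\<close>

lemma rank_ge_iff:
  fixes A :: "'a :: field mat"
  assumes A: "A \<in> carrier_mat n nc"
  shows "r \<le> vec_space.rank n A \<longleftrightarrow>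
    (\<exists>X \<in> carrier_mat nc r. \<forall>v \<in> carrier_vec r. A * X *\<^sub>v v = 0\<^sub>v n \<longrightarrow> v = 0\<^sub>v r)"
    (is "?lhs \<longleftrightarrow> ?rhs")
proof -
  interpret vec_space "TYPE('a)" n .
  show ?thesis
  proof
    assume r: ?lhs
    obtain S where S: "maximal S (\<lambda>T. T \<subseteq> set (cols A) \<and> lin_indpt T)"
      using maximal_exists[of "(\<lambda>T. T \<subseteq> set (cols A) \<and> lin_indpt T)" "card (set (cols A))" "{}"]
      by (meson List.finite_set card_mono empty_iff empty_subsetI finite_lin_indpt2 rev_finite_subset)
    have Ssub: "S \<subseteq> set (cols A)" and Sli: "lin_indpt S"
      using S by (auto simp: maximal_def)
    have "r \<le> card S" using r rank_card_indpt[OF A S] by simp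
    then obtain T where T: "T \<subseteq> S" "card T = r" "finite T"
      by (meson obtain_subset_with_card_n)
    obtain us where us: "set us = T" "distinct us"
      using finite_distinct_list[OF T(3)] by blast
    have len: "length us = r" using us T(2) distinct_card by fastforce
    have "\<forall>j<r. \<exists>i<nc. us ! j = col A i"
    proof (intro allI impI)
      fix j assume "j < r"
      then have "us ! j \<in> set (cols A)" using us(1) T(1) Ssub len by (metis nth_mem subsetD)
      then show "\<exists>i<nc. us ! j = col A i"
        using A by (metis carrier_matD(2) cols_length cols_nth in_set_conv_nth)
    qed
    then obtain i where i: "\<And>j. j < r \<Longrightarrow> i j < nc \<and> us ! j = col A (i j)"
      by metis
    define X :: "'a mat" where "X = mat nc r (\<lambda>(a, j). if a = i j then 1 else 0)"
    have X: "X \<in> carrier_mat nc r" by (simp add: X_def)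
    have AX: "A * X \<in> carrier_mat n r" using A X by auto
    have colX: "col X j = unit_vec nc (i j)" if "j < r" for j
      using that by (intro eq_vecI) (auto simp: X_def unit_vec_def)
    have colAX: "col (A * X) j = us ! j" if "j < r" for j
    proof -
      have "col (A * X) j = A *\<^sub>v col X j" using A X that by (metis carrier_matD(2) col_mult2)
      also have "\<dots> = col A (i j)"
        using mult_unit_vec[OF A] i[OF that] colX[OF that] by simp
      finally show ?thesis using i[OF that] by simp
    qed
    have cols: "cols (A * X) = us"
      by (intro nth_equalityI) (use AX len colAX in auto)
    have li: "lin_indpt (set (cols (A * X)))"
      unfolding cols us(1) using Sli T(1) subset_li_is_li by blast
    show ?rhs
    proof (intro bexI[OF _ X] ballI impI)
      fix v assume v: "v \<in> carrier_vec r" "A * X *\<^sub>v v = 0\<^sub>v n"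
      show "v = 0\<^sub>v r"
      proof (rule ccontr)
        assume "v \<noteq> 0\<^sub>v r"
        from lin_depI[OF AX v(1) this v(2)] cols us(2) li show False by simp
      qed
    qed
  next
    assume ?rhs
    then obtain X where X: "X \<in> carrier_mat nc r"
      and inj: "\<And>v. v \<in> carrier_vec r \<Longrightarrow> A * X *\<^sub>v v = 0\<^sub>v n \<Longrightarrow> v = 0\<^sub>v r" by blast
    have AX: "A * X \<in> carrier_mat n r" using A X by auto
    \<comment> \<open>Independence of the set of columns does not see a repeated column, so
      repetitions are excluded separately: two equal columns would put a difference of unit vectors
      into the kernel.\<close>
    have dist: "distinct (cols (A * X))"
    proof (rule ccontr)
      assume "\<not> distinct (cols (A * X))"
      then obtain i j where ij: "i < r" "j < r" "i \<noteq> j" "col (A * X) i = col (A * X) j"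
        using AX by (auto simp: distinct_conv_nth)
      let ?v = "unit_vec r i - unit_vec r j :: 'a vec"
      have "A * X *\<^sub>v ?v = A * X *\<^sub>v unit_vec r i - A * X *\<^sub>v unit_vec r j"
        using AX by (intro mult_minus_distrib_mat_vec) auto
      also have "\<dots> = col (A * X) i - col (A * X) j"
        using mult_unit_vec[OF AX] ij by simp
      also have "\<dots> = 0\<^sub>v n" using ij AX by auto
      finally have "?v = 0\<^sub>v r" by (intro inj) auto
      then have "?v $ i = 0" using ij(1) by simp
      then show False using ij by (simp add: unit_vec_def)
    qed
    have li: "lin_indpt (set (cols (A * X)))"
      using lin_depE[OF AX _ dist] inj by metis
    have sub: "set (cols (A * X)) \<subseteq> span (set (cols A))"
    proof
      fix x assume "x \<in> set (cols (A * X))"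
      then obtain j where j: "j < r" "x = col (A * X) j"
        using AX by (metis carrier_matD(2) cols_length cols_nth in_set_conv_nth)
      have "x = A *\<^sub>v col X j" using A X j by (metis carrier_matD(2) col_mult2)
      moreover have "col X j \<in> carrier_vec nc" using X by auto
      ultimately show "x \<in> span (set (cols A))"
        using col_space_eq[OF A] A by (auto simp: col_space_def)
    qed
    have cA: "set (cols A) \<subseteq> carrier_vec n" and cAX: "set (cols (A * X)) \<subseteq> carrier_vec n"
      using A AX cols_dim by blast+
    have "span (set (cols (A * X))) \<subseteq> span (set (cols A))"
      using sub cA span_is_subset[of "set (cols (A * X))" "span (set (cols A))"] span_is_submodule by auto
    then have subsp: "subspace class_ring (span (set (cols (A * X)))) (vs (span (set (cols A))))"
      using cA cAX
      by (metis nested_subspaces span_is_subspace)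
    have "rank (A * X) \<le> rank A"
      unfolding rank_def
      using vectorspace.subspace_dim[OF subspace_is_vs[OF span_is_subspace[OF cA]] subsp]
        fin_dim_span_cols[OF A] fin_dim_span_cols[OF AX] by simp
    moreover have "rank (A * X) = r" using lin_indpt_full_rank[OF AX dist li] .
    ultimately show ?lhs by simp
  qed
qed

text \<open>If \<open>X\<close> is a witness for the rank of \<open>B * A * C\<close> in the sense
  of \<open>rank_ge_iff\<close>, then \<open>C * X\<close> is one for \<open>A\<close>, because a
  vector killed by \<open>A * (C * X)\<close> is killed after multiplication by \<open>B\<close> as
  well.\<close>

lemma rank_mult_mult_le:
  fixes A :: "'a :: field mat"
  assumes A: "A \<in> carrier_mat n nc" and B: "B \<in> carrier_mat n' n" and C: "C \<in> carrier_mat nc nc'"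
  shows "vec_space.rank n' (B * A * C) \<le> vec_space.rank n A"
proof -
  let ?r = "vec_space.rank n' (B * A * C)"
  have BAC: "B * A * C \<in> carrier_mat n' nc'" using assms by auto
  obtain X where X: "X \<in> carrier_mat nc' ?r"
    and inj: "\<And>v. v \<in> carrier_vec ?r \<Longrightarrow> B * A * C * X *\<^sub>v v = 0\<^sub>v n' \<Longrightarrow> v = 0\<^sub>v ?r"
    using rank_ge_iff[OF BAC, of ?r] by auto
  have CX: "C * X \<in> carrier_mat nc ?r" using C X by auto
  have "\<forall>v \<in> carrier_vec ?r. A * (C * X) *\<^sub>v v = 0\<^sub>v n \<longrightarrow> v = 0\<^sub>v ?r"
  proof (intro ballI impI)
    fix v assume v: "v \<in> carrier_vec ?r" "A * (C * X) *\<^sub>v v = 0\<^sub>v n"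
    have "B * A * C * X = B * (A * (C * X))"
      using A B C X by (smt (verit) assoc_mult_mat mult_carrier_mat)
    then have "B * A * C * X *\<^sub>v v = B *\<^sub>v (A * (C * X) *\<^sub>v v)"
      using assoc_mult_mat_vec[OF B _ v(1), of "A * (C * X)"] A CX by simp
    also have "\<dots> = 0\<^sub>v n'" using B v(2) by auto
    finally show "v = 0\<^sub>v ?r" using inj v(1) by blast
  qed
  with CX show ?thesis using rank_ge_iff[OF A, of ?r] by blast
qed

text \<open>The witness \<open>X\<close> of \<open>rank_ge_iff\<close> is square here, and
  injectivity of \<open>A * X\<close> makes it invertible, so injectivity passes to
  \<open>A\<close>.\<close>

lemma full_rank_inj:
  fixes A :: "'a :: field mat"
  assumes A: "A \<in> carrier_mat n nc" and "vec_space.rank n A = nc"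
    and v: "v \<in> carrier_vec nc" "A *\<^sub>v v = 0\<^sub>v n"
  shows "v = 0\<^sub>v nc"
proof -
  obtain X where X: "X \<in> carrier_mat nc nc"
    and inj: "\<And>v. v \<in> carrier_vec nc \<Longrightarrow> A * X *\<^sub>v v = 0\<^sub>v n \<Longrightarrow> v = 0\<^sub>v nc"
    using rank_ge_iff[OF A, of nc] assms(2) by auto
  have "det X \<noteq> 0"
  proof
    assume "det X = 0"
    then obtain u where u: "u \<in> carrier_vec nc" "u \<noteq> 0\<^sub>v nc" "X *\<^sub>v u = 0\<^sub>v nc"
      using det_0_iff_vec_prod_zero_field[OF X] by blast
    have "A * X *\<^sub>v u = 0\<^sub>v n" using assoc_mult_mat_vec[OF A X u(1)] u(3) A by auto
    with inj u show False by blast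
  qed
  then obtain Y where Y: "Y \<in> carrier_mat nc nc" "X * Y = 1\<^sub>m nc"
    using det_non_zero_imp_unit[OF X, of "()"] by (auto simp: Units_def ring_mat_def)
  have Yv: "Y *\<^sub>v v \<in> carrier_vec nc" using Y v by auto
  have XYv: "X *\<^sub>v (Y *\<^sub>v v) = v"
    using assoc_mult_mat_vec[OF X Y(1) v(1)] Y(2) v(1) by auto
  have "A * X *\<^sub>v (Y *\<^sub>v v) = 0\<^sub>v n" using assoc_mult_mat_vec[OF A X Yv] XYv v by simp
  then have "Y *\<^sub>v v = 0\<^sub>v nc" using inj Yv by blast
  then show ?thesis using XYv X by auto
qed

text \<open>The kernel of \<open>b\<close> has dimension \<open>m\<close> and is therefore the
  column space of \<open>P\<close>. Instead of counting dimensions, a vector \<open>x\<close> of the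
  kernel is appended to \<open>P\<close> as a last column: \<open>b\<close> is then a nonzero left
  null vector of a square matrix, the determinant vanishes, and a linear dependence of the columns
  can be solved for \<open>x\<close>.\<close>

lemma hyperplane_factor:
  fixes b P R :: "'a :: field mat"
  assumes b: "b \<in> carrier_mat 1 (Suc m)" "b \<noteq> 0\<^sub>m 1 (Suc m)"
    and P: "P \<in> carrier_mat (Suc m) m" "vec_space.rank (Suc m) P = m" "b * P = 0\<^sub>m 1 m"
    and R: "R \<in> carrier_mat (Suc m) k" "b * R = 0\<^sub>m 1 k"
  shows "\<exists>Q \<in> carrier_mat m k. R = P * Q"
proof -
  have ex: "\<exists>q \<in> carrier_vec m. P *\<^sub>v q = x"
    if x: "x \<in> carrier_vec (Suc m)" "b *\<^sub>v x = 0\<^sub>v 1" for x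
  proof -
    define A where "A = mat (Suc m) (Suc m) (\<lambda>(i, j). if j < m then P $$ (i, j) else x $ i)"
    have A: "A \<in> carrier_mat (Suc m) (Suc m)" by (simp add: A_def)
    define u where "u = Matrix.row b 0"
    have u: "u \<in> carrier_vec (Suc m)" using b(1) row_carrier[of b 0] by (simp add: u_def)
    have u0: "u \<noteq> 0\<^sub>v (Suc m)"
    proof
      assume "u = 0\<^sub>v (Suc m)"
      then have "b = 0\<^sub>m 1 (Suc m)"
        using b by (intro eq_matI) (auto simp: u_def Matrix.row_def vec_eq_iff)
      with b show False by simp
    qed
    have "transpose_mat A *\<^sub>v u = 0\<^sub>v (Suc m)"
    proof (rule eq_vecI)
      fix j assume "j < dim_vec (0\<^sub>v (Suc m) :: 'a vec)"
      then have j: "j < Suc m" by simp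
      have "(transpose_mat A *\<^sub>v u) $ j = (\<Sum>i<Suc m. A $$ (i, j) * b $$ (0, i))"
        using j A b u by (simp add: scalar_prod_def u_def atLeast0LessThan)
      also have "\<dots> = 0"
      proof (cases "j < m")
        case True
        have "0 = (b * P) $$ (0, j)" using P(3) True by simp
        also have "\<dots> = (\<Sum>i<Suc m. b $$ (0, i) * P $$ (i, j))"
          using True b P(1) by (simp add: scalar_prod_def atLeast0LessThan)
        finally show ?thesis using True by (simp add: A_def mult.commute)
      next
        case False
        then have "j = m" using j by simp
        have "0 = (b *\<^sub>v x) $ 0" using x by simp
        also have "\<dots> = (\<Sum>i<Suc m. b $$ (0, i) * x $ i)"
          using b x(1) by (simp add: scalar_prod_def atLeast0LessThan)
        finally show ?thesis using \<open>j = m\<close> by (simp add: A_def mult.commute)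
      qed
      finally show "(transpose_mat A *\<^sub>v u) $ j = 0\<^sub>v (Suc m) $ j" using j by simp
    qed (use A in auto)
    then have "det A = 0"
      using det_0_iff_vec_prod_zero_field[of "transpose_mat A" "Suc m"] A u u0 det_transpose[OF A] by auto
    then obtain y where y: "y \<in> carrier_vec (Suc m)" "y \<noteq> 0\<^sub>v (Suc m)" "A *\<^sub>v y = 0\<^sub>v (Suc m)"
      using det_0_iff_vec_prod_zero_field[OF A] by blast
    define q where "q = vec m (\<lambda>j. y $ j)"
    have q: "q \<in> carrier_vec m" by (simp add: q_def)
    have eq: "(P *\<^sub>v q) $ i + x $ i * y $ m = 0" if i: "i < Suc m" for i
    proof -
      have "0 = (A *\<^sub>v y) $ i" using i y by simp
      also have "\<dots> = (\<Sum>j<Suc m. A $$ (i, j) * y $ j)"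
        using i A y(1) by (simp add: scalar_prod_def atLeast0LessThan)
      also have "\<dots> = (\<Sum>j<m. P $$ (i, j) * y $ j) + x $ i * y $ m"
        using i by (simp add: A_def)
      also have "(\<Sum>j<m. P $$ (i, j) * y $ j) = (P *\<^sub>v q) $ i"
        using i P(1) by (simp add: scalar_prod_def atLeast0LessThan q_def)
      finally show ?thesis by simp
    qed
    \<comment> \<open>A dependence with coefficient 0 at \<open>x\<close> would be one among the
      columns of \<open>P\<close>, against its rank.\<close>
    have ym: "y $ m \<noteq> 0"
    proof
      assume 0: "y $ m = 0"
      have "P *\<^sub>v q = 0\<^sub>v (Suc m)"
        by (rule eq_vecI) (use eq 0 P(1) in auto)
      then have "q = 0\<^sub>v m" using full_rank_inj[OF P(1,2) q] by simp
      then have "y $ j = 0" if "j < Suc m" for j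
        using that 0 by (cases "j < m") (auto simp: q_def vec_eq_iff less_Suc_eq)
      then have "y = 0\<^sub>v (Suc m)" using y(1) by (intro eq_vecI) auto
      with y show False by simp
    qed
    show ?thesis
    proof (rule bexI[of _ "(- 1 / y $ m) \<cdot>\<^sub>v q"])
      have "P *\<^sub>v ((- 1 / y $ m) \<cdot>\<^sub>v q) = (- 1 / y $ m) \<cdot>\<^sub>v (P *\<^sub>v q)"
        using P(1) q by (metis mult_mat_vec)
      also have "\<dots> = x"
      proof (rule eq_vecI)
        fix i assume "i < dim_vec x"
        then have i: "i < Suc m" using x(1) by simp
        have "(P *\<^sub>v q) $ i = - (x $ i * y $ m)" using eq[OF i] by (simp add: eq_neg_iff_add_eq_0)
        then show "((- 1 / y $ m) \<cdot>\<^sub>v (P *\<^sub>v q)) $ i = x $ i"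
          using i P(1) ym by simp
      qed (use P(1) x in auto)
      finally show "P *\<^sub>v ((- 1 / y $ m) \<cdot>\<^sub>v q) = x" .
    qed (use q in auto)
  qed
  have "\<forall>j<k. \<exists>q. q \<in> carrier_vec m \<and> P *\<^sub>v q = col R j"
  proof (intro allI impI)
    fix j assume j: "j < k"
    have colR: "col R j \<in> carrier_vec (Suc m)" using R(1) by (intro carrier_vecI) auto
    have "b *\<^sub>v col R j = col (b * R) j" using j b R(1) by (metis carrier_matD(2) col_mult2)
    also have "\<dots> = 0\<^sub>v 1" using R(2) j by (intro eq_vecI) auto
    finally show "\<exists>q. q \<in> carrier_vec m \<and> P *\<^sub>v q = col R j" 
      using ex[of "col R j"] colR by auto
  qed
  then obtain q where q: "\<And>j. j < k \<Longrightarrow> q j \<in> carrier_vec m \<and> P *\<^sub>v q j = col R j"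
    by metis
  define Q where "Q = mat m k (\<lambda>(i, j). q j $ i)"
  have Q: "Q \<in> carrier_mat m k" by (simp add: Q_def)
  have colQ: "col Q j = q j" if "j < k" for j
    using that q[OF that] by (intro eq_vecI) (auto simp: Q_def)
  have "R = P * Q"
  proof (rule mat_col_eqI)
    fix j assume "j < dim_col (P * Q)"
    then have j: "j < k" using Q by simp
    have "col (P * Q) j = P *\<^sub>v col Q j" using j P(1) Q by (metis carrier_matD(2) col_mult2)
    then show "col R j = col (P * Q) j" using q[OF j] colQ[OF j] by simp
  qed (use R P Q in auto)
  with Q show ?thesis by blast
qed

text \<open>The hypothesis says L' = B L D for matrices indexed by arbitrary finite sets. The
  enumerations of equations and variables are dealt with here once, so that the comparison of the
  two systems can be indexed by triples.\<close>

lemma rank_family_le: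
  fixes L L' :: "'r \<Rightarrow> 'c \<Rightarrow> real"
  assumes R: "finite R" and C: "finite C"
    and L': "\<And>e x. e \<in> R \<Longrightarrow> x \<in> C \<Longrightarrow> L' e x = (\<Sum>e'\<in>R. \<Sum>y\<in>C. B e e' * L e' y * D y x)"
  defines "fam \<equiv> \<lambda>L :: 'r \<Rightarrow> 'c \<Rightarrow> real.
    mat (card R) (card C) (\<lambda>(r, s). L (from_nat_into R r) (from_nat_into C s))"
  shows "vec_space.rank (card R) (fam L') \<le> vec_space.rank (card R) (fam L)"
proof -
  let ?r = "from_nat_into R" and ?c = "from_nat_into C"
  define Bm where "Bm = mat (card R) (card R) (\<lambda>(i, j). B (?r i) (?r j))"
  define Dm where "Dm = mat (card C) (card C) (\<lambda>(i, j). D (?c i) (?c j))"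
  have sumR: "(\<Sum>i<card R. g (?r i)) = sum g R" and sumC: "(\<Sum>i<card C. g' (?c i)) = sum g' C"
    for g g' :: "_ \<Rightarrow> real"
    using sum.reindex_bij_betw[OF bij_betw_from_nat_into_finite[OF R]]
      sum.reindex_bij_betw[OF bij_betw_from_nat_into_finite[OF C]] by auto
  have inR: "?r i \<in> R" if "i < card R" for i
    using that by (intro from_nat_into) auto
  have inC: "?c i \<in> C" if "i < card C" for i
    using that by (intro from_nat_into) auto
  have "fam L' = Bm * fam L * Dm"
  proof (rule eq_matI)
    fix i j assume "i < dim_row (Bm * fam L * Dm)" "j < dim_col (Bm * fam L * Dm)"
    then have ij: "i < card R" "j < card C" by (auto simp: Bm_def Dm_def)
    have "(Bm * fam L * Dm) $$ (i, j) =
        (\<Sum>q<card C. (\<Sum>p<card R. B (?r i) (?r p) * L (?r p) (?c q)) * D (?c q) (?c j))"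
      using ij by (simp add: Bm_def Dm_def fam_def scalar_prod_def atLeast0LessThan)
    also have "\<dots> = (\<Sum>q<card C. \<Sum>p<card R. B (?r i) (?r p) * L (?r p) (?c q) * D (?c q) (?c j))"
      by (simp add: sum_distrib_right)
    also have "\<dots> = (\<Sum>y\<in>C. \<Sum>p<card R. B (?r i) (?r p) * L (?r p) y * D y (?c j))"
      by (rule sumC)
    also have "\<dots> = (\<Sum>y\<in>C. \<Sum>e'\<in>R. B (?r i) e' * L e' y * D y (?c j))"
      by (intro sum.cong refl sumR)
    also have "\<dots> = L' (?r i) (?c j)"
      unfolding L'[OF inR[OF ij(1)] inC[OF ij(2)]] by (rule sum.swap)
    finally show "fam L' $$ (i, j) = (Bm * fam L * Dm) $$ (i, j)" using ij by (simp add: fam_def)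
  qed (simp_all add: Bm_def Dm_def fam_def)
  then show ?thesis
    using rank_mult_mult_le[of "fam L" "card R" "card C" Bm "card R" Dm "card C"]
    by (simp add: Bm_def Dm_def fam_def)
qed

section \<open>Congruence of matrices, as an identity and entry by entry\<close>

lemma congruence_mult:
  fixes A X Y :: "'a :: comm_ring_1 mat"
  assumes "A \<in> carrier_mat k k" "X \<in> carrier_mat k l" "Y \<in> carrier_mat l p"
  shows "transpose_mat (X * Y) * A * (X * Y) = transpose_mat Y * (transpose_mat X * A * X) * Y"
proof -
  have XT: "transpose_mat X \<in> carrier_mat l k" and YT: "transpose_mat Y \<in> carrier_mat p l"
    using assms by auto
  have XA: "transpose_mat X * A \<in> carrier_mat l k" using XT assms(1) by auto
  have "transpose_mat (X * Y) * A * (X * Y) = transpose_mat Y * transpose_mat X * A * (X * Y)"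
    using transpose_mult[OF assms(2,3)] by simp
  also have "\<dots> = transpose_mat Y * (transpose_mat X * A) * (X * Y)"
    using assoc_mult_mat[OF YT XT assms(1)] by simp
  also have "\<dots> = transpose_mat Y * (transpose_mat X * A * (X * Y))"
    using YT XA assms by (intro assoc_mult_mat) auto
  also have "transpose_mat X * A * (X * Y) = transpose_mat X * A * X * Y"
    using XA assms by (intro assoc_mult_mat[symmetric]) auto
  also have "transpose_mat Y * (transpose_mat X * A * X * Y) = transpose_mat Y * (transpose_mat X * A * X) * Y"
    using YT XA assms by (intro assoc_mult_mat[symmetric]) auto
  finally show ?thesis .
qed

text \<open>Applied with \<open>X\<close> = P_w and \<open>D\<close> = d_w, this shows that the
  left-hand side of the system involves the gluing only through the products P_w and d_w P_w, and
  these two are what a change of basis controls.\<close>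

lemma congruence_diff:
  fixes A B D X :: "'a :: comm_ring_1 mat"
  assumes "A \<in> carrier_mat k k" "B \<in> carrier_mat k k" "D \<in> carrier_mat k k" "X \<in> carrier_mat k p"
  shows "transpose_mat X * (A - transpose_mat D * B * D) * X =
    transpose_mat X * A * X - transpose_mat (D * X) * B * (D * X)"
proof -
  have XT: "transpose_mat X \<in> carrier_mat p k" using assms by auto
  have DBD: "transpose_mat D * B * D \<in> carrier_mat k k" using assms by auto
  have "transpose_mat X * (A - transpose_mat D * B * D) * X =
      (transpose_mat X * A - transpose_mat X * (transpose_mat D * B * D)) * X"
    using mult_minus_distrib_mat[OF XT assms(1) DBD] by simp
  also have "\<dots> = transpose_mat X * A * X - transpose_mat X * (transpose_mat D * B * D) * X"
    using XT DBD assms by (intro minus_mult_distrib_mat) auto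
  finally show ?thesis using congruence_mult[OF assms(2,3,4)] by simp
qed

lemma index_mult_mat_sum:
  assumes "A \<in> carrier_mat p k" "B \<in> carrier_mat k q" "a < p" "b < q"
  shows "(A * B) $$ (a, b) = (\<Sum>j<k. A $$ (a, j) * B $$ (j, b))"
  using assms by (simp add: scalar_prod_def atLeast0LessThan)

lemma congruence_index:
  fixes A X :: "'a :: comm_ring_1 mat"
  assumes A: "A \<in> carrier_mat k k" and X: "X \<in> carrier_mat k p" and ab: "a < p" "b < p"
  shows "(transpose_mat X * A * X) $$ (a, b) = (\<Sum>i<k. \<Sum>j<k. X $$ (i, a) * A $$ (i, j) * X $$ (j, b))"
proof -
  have XT: "transpose_mat X \<in> carrier_mat p k" using X by simp
  have "(transpose_mat X * A * X) $$ (a, b) = (\<Sum>j<k. (transpose_mat X * A) $$ (a, j) * X $$ (j, b))"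
    using mult_carrier_mat[OF XT A] X ab by (rule index_mult_mat_sum)
  also have "\<dots> = (\<Sum>j<k. \<Sum>i<k. X $$ (i, a) * A $$ (i, j) * X $$ (j, b))"
  proof (rule sum.cong[OF refl])
    fix j assume "j \<in> {..<k}"
    then have "(transpose_mat X * A) $$ (a, j) = (\<Sum>i<k. transpose_mat X $$ (a, i) * A $$ (i, j))"
      using ab by (intro index_mult_mat_sum[OF XT A]) auto
    also have "\<dots> = (\<Sum>i<k. X $$ (i, a) * A $$ (i, j))"
      using X ab by (intro sum.cong) auto
    finally show "(transpose_mat X * A) $$ (a, j) * X $$ (j, b) = (\<Sum>i<k. X $$ (i, a) * A $$ (i, j) * X $$ (j, b))"
      by (simp only: sum_distrib_right)
  qed
  also have "\<dots> = (\<Sum>i<k. \<Sum>j<k. X $$ (i, a) * A $$ (i, j) * X $$ (j, b))" by (rule sum.swap)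
  finally show ?thesis .
qed

lemma mult_sum_mult:
  fixes a b :: real
  shows "a * (\<Sum>x\<in>X. c x * g x) * b = (\<Sum>x\<in>X. c x * (a * g x * b))"
  unfolding sum_distrib_left sum_distrib_right by (rule sum.cong) simp_all

text \<open>Over the reals a one-sided inverse of a square matrix is two-sided, and the entries of
  the product are the same integers there.\<close>

lemma int_mat_inverse_commute:
  fixes A B :: "nat \<Rightarrow> nat \<Rightarrow> int"
  assumes AB: "\<And>i j. i < m \<Longrightarrow> j < m \<Longrightarrow> (\<Sum>l<m. A i l * B l j) = (if i = j then 1 else 0)"
    and ij: "i < m" "j < m"
  shows "(\<Sum>l<m. B i l * A l j) = (if i = j then 1 else 0)"
proof -
  let ?M = "\<lambda>A :: nat \<Rightarrow> nat \<Rightarrow> int. mat m m (\<lambda>(i, j). real_of_int (A i j))"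
  have mult: "(?M A * ?M B) $$ (i, j) = of_int (\<Sum>l<m. A i l * B l j)" if "i < m" "j < m" for A B i j
    using that by (simp add: scalar_prod_def atLeast0LessThan)
  have "?M A * ?M B = 1\<^sub>m m"
  proof (rule eq_matI)
    fix i j assume "i < dim_row (1\<^sub>m m :: real mat)" "j < dim_col (1\<^sub>m m :: real mat)"
    then show "(?M A * ?M B) $$ (i, j) = 1\<^sub>m m $$ (i, j)" by (subst mult) (auto simp: AB)
  qed auto
  then have BA: "?M B * ?M A = 1\<^sub>m m" by (intro mat_mult_left_right_inverse[of "?M A" m "?M B"]) auto
  have "of_int (\<Sum>l<m. B i l * A l j) = (?M B * ?M A) $$ (i, j)" by (rule mult[OF ij, symmetric])
  also have "\<dots> = 1\<^sub>m m $$ (i, j)" by (simp only: BA)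
  also have "\<dots> = of_int (if i = j then 1 else 0)" using ij by simp
  finally show ?thesis by (simp only: of_int_eq_iff)
qed

section \<open>Integral bases of abelian groups\<close>

text \<open>The same product as in \<open>int_basis\<close>, but with arbitrary coefficient
  functions, of which only the values below \<open>m\<close> count. Extensional functions would have
  to be restricted again after every sum or matrix product of coefficients.\<close>

definition lin_comb :: "('a, 'b) monoid_scheme \<Rightarrow> (nat \<Rightarrow> 'a) \<Rightarrow> nat \<Rightarrow> (nat \<Rightarrow> int) \<Rightarrow> 'a" where
  "lin_comb G b m c = (\<Otimes>\<^bsub>G\<^esub>i\<in>{..<m}. b i [^]\<^bsub>G\<^esub> c i)"

lemma mat_inverse_apply:
  fixes U V :: "nat \<Rightarrow> nat \<Rightarrow> int"
  assumes "i < m"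
    and UV: "\<And>i j. i < m \<Longrightarrow> j < m \<Longrightarrow> (\<Sum>l<m. U i l * V l j) = (if i = j then 1 else 0)"
  shows "(\<Sum>l<m. U i l * (\<Sum>j<m. V l j * c j)) = c i"
proof -
  have "(\<Sum>l<m. U i l * (\<Sum>j<m. V l j * c j)) = (\<Sum>l<m. \<Sum>j<m. U i l * V l j * c j)"
    by (simp add: sum_distrib_left mult.assoc)
  also have "\<dots> = (\<Sum>j<m. \<Sum>l<m. U i l * V l j * c j)" by (rule sum.swap)
  also have "\<dots> = (\<Sum>j<m. (\<Sum>l<m. U i l * V l j) * c j)" by (simp add: sum_distrib_right)
  also have "\<dots> = (\<Sum>j<m. if i = j then c j else 0)"
    using UV \<open>i < m\<close> by (intro sum.cong) auto
  also have "\<dots> = c i" using \<open>i < m\<close> by simp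
  finally show ?thesis .
qed

context comm_group
begin

lemma lin_comb_closed [simp]: "(\<And>i. i < m \<Longrightarrow> b i \<in> carrier G) \<Longrightarrow> lin_comb G b m c \<in> carrier G"
  unfolding lin_comb_def by (rule finprod_closed) auto

lemma lin_comb_0 [simp]: "lin_comb G b 0 c = \<one>"
  by (simp add: lin_comb_def)

lemma lin_comb_Suc:
  assumes "\<And>i. i \<le> m \<Longrightarrow> b i \<in> carrier G"
  shows "lin_comb G b (Suc m) c = b m [^] c m \<otimes> lin_comb G b m c"
  using assms by (simp add: lin_comb_def lessThan_Suc finprod_insert Pi_iff)

lemma lin_comb_cong:
  assumes "\<And>i. i < m \<Longrightarrow> b i \<in> carrier G"
    and "\<And>i. i < m \<Longrightarrow> b i = b' i" "\<And>i. i < m \<Longrightarrow> c i = c' i"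
  shows "lin_comb G b m c = lin_comb G b' m c'"
  unfolding lin_comb_def using assms by (intro finprod_cong') (auto simp: Pi_iff)

lemma lin_comb_add:
  assumes "\<And>i. i < m \<Longrightarrow> b i \<in> carrier G"
  shows "lin_comb G b m (\<lambda>i. c i + c' i) = lin_comb G b m c \<otimes> lin_comb G b m c'"
proof -
  have "lin_comb G b m (\<lambda>i. c i + c' i) = (\<Otimes>i\<in>{..<m}. b i [^] c i \<otimes> b i [^] c' i)"
    unfolding lin_comb_def using assms
    by (intro finprod_cong') (auto simp: Pi_iff int_pow_mult)
  also have "\<dots> = lin_comb G b m c \<otimes> lin_comb G b m c'"
    unfolding lin_comb_def using assms by (intro finprod_multf) auto
  finally show ?thesis .
qed

lemma lin_comb_zero: "lin_comb G b m (\<lambda>i. 0) = \<one>"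
  by (simp add: lin_comb_def finprod_one_eqI)

lemma lin_comb_sum:
  fixes k :: nat
  assumes "\<And>i. i < m \<Longrightarrow> b i \<in> carrier G"
  shows "lin_comb G b m (\<lambda>i. \<Sum>j<k. c i j) = (\<Otimes>j\<in>{..<k}. lin_comb G b m (\<lambda>i. c i j))"
proof (induction k)
  case 0
  then show ?case by (simp add: lin_comb_zero)
next
  case (Suc k)
  have "(\<Otimes>j\<in>{..<Suc k}. lin_comb G b m (\<lambda>i. c i j)) =
      lin_comb G b m (\<lambda>i. c i k) \<otimes> (\<Otimes>j\<in>{..<k}. lin_comb G b m (\<lambda>i. c i j))"
    using assms by (simp add: lessThan_Suc finprod_insert Pi_iff)
  also have "\<dots> = lin_comb G b m (\<lambda>i. c i k + (\<Sum>j<k. c i j))"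
    using assms by (simp add: lin_comb_add Suc.IH)
  finally show ?case by (simp add: add.commute)
qed

lemma lin_comb_pow:
  assumes "\<And>i. i < m \<Longrightarrow> b i \<in> carrier G"
  shows "lin_comb G b m c [^] (n :: int) = lin_comb G b m (\<lambda>i. c i * n)"
  using assms
proof (induction m)
  case (Suc m)
  then show ?case
    by (simp add: lin_comb_Suc int_pow_distrib int_pow_pow)
qed auto

lemma lin_comb_lin_comb:
  assumes "\<And>i. i < m \<Longrightarrow> b i \<in> carrier G"
  shows "lin_comb G (\<lambda>j. lin_comb G b m (\<lambda>i. A i j)) k c = lin_comb G b m (\<lambda>i. \<Sum>j<k. A i j * c j)"
proof -
  have "lin_comb G (\<lambda>j. lin_comb G b m (\<lambda>i. A i j)) k c =
      (\<Otimes>j\<in>{..<k}. lin_comb G b m (\<lambda>i. A i j * c j))"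
    unfolding lin_comb_def[of G _ k] using assms by (simp add: lin_comb_pow)
  then show ?thesis using lin_comb_sum[OF assms] by simp
qed

lemma lin_comb_unit:
  assumes "\<And>i. i < m \<Longrightarrow> b i \<in> carrier G" "j < m"
  shows "lin_comb G b m (\<lambda>i. if i = j then 1 else 0) = b j"
proof -
  have "lin_comb G b m (\<lambda>i. if i = j then 1 else 0) = (\<Otimes>i\<in>{..<m}. if j = i then b i else \<one>)"
    unfolding lin_comb_def using assms by (intro finprod_cong') auto
  also have "\<dots> = b j" using assms by (intro finprod_singleton) auto
  finally show ?thesis .
qed

text \<open>This is the index shift of \<open>bd_tuple\<close>: place 0 belongs to z_w, so a
  combination of fiber classes is a combination of the whole tuple with a 0 put in front.\<close>

lemma lin_comb_reduce:
  assumes b: "\<And>i. i < Suc m \<Longrightarrow> b i \<in> carrier G"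
  shows "lin_comb G b (Suc m) (case_nat 0 c) = lin_comb G (\<lambda>i. b (Suc i)) m c"
  using b
proof (induction m)
  case 0
  then show ?case using lin_comb_Suc[of 0 b "case_nat 0 c"] by simp
next
  case (Suc m)
  have "lin_comb G b (Suc (Suc m)) (case_nat 0 c) = b (Suc m) [^] c m \<otimes> lin_comb G b (Suc m) (case_nat 0 c)"
    using Suc.prems by (subst lin_comb_Suc) auto
  also have "\<dots> = b (Suc m) [^] c m \<otimes> lin_comb G (\<lambda>i. b (Suc i)) m c"
    using Suc by simp
  also have "\<dots> = lin_comb G (\<lambda>i. b (Suc i)) (Suc m) c"
    using Suc.prems by (subst lin_comb_Suc) auto
  finally show ?case .
qed

lemma hom_lin_comb:
  assumes "h \<in> hom G H" "comm_group H" "\<And>i. i < m \<Longrightarrow> b i \<in> carrier G"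
  shows "h (lin_comb G b m c) = lin_comb H (\<lambda>i. h (b i)) m c"
proof -
  interpret H: comm_group H by fact
  interpret h: group_hom G H h
    using assms(1) by unfold_locales
  show ?thesis using assms(3)
  proof (induction m)
    case (Suc m)
    then show ?case by (simp add: lin_comb_Suc H.lin_comb_Suc h.hom_int_pow)
  qed simp
qed

text \<open>The operation of \<open>integer_group\<close> is addition, so a product of powers
  becomes a sum of multiples. The functionals meant here are periods of circle-valued maps.\<close>

lemma int_valued_lin_comb:
  fixes \<phi> :: "'a \<Rightarrow> int"
  assumes "\<And>x y. x \<in> carrier G \<Longrightarrow> y \<in> carrier G \<Longrightarrow> \<phi> (x \<otimes> y) = \<phi> x + \<phi> y"
    and "\<And>i. i < m \<Longrightarrow> b i \<in> carrier G"
  shows "\<phi> (lin_comb G b m c) = (\<Sum>i<m. \<phi> (b i) * c i)"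
proof -
  have "\<phi> \<in> hom G integer_group" using assms(1) by (simp add: hom_def)
  from hom_lin_comb[OF this abelian_integer_group assms(2)]
  have "\<phi> (lin_comb G b m c) = lin_comb integer_group (\<lambda>i. \<phi> (b i)) m c" by simp
  also have "\<dots> = (\<Sum>i<m. \<phi> (b i) * c i)"
  proof (induction m)
    case 0
    then show ?case using comm_group.lin_comb_0[OF abelian_integer_group] by simp
  next
    case (Suc m)
    then show ?case
      using comm_group.lin_comb_Suc[OF abelian_integer_group] by (simp add: mult.commute)
  qed
  finally show ?thesis .
qed

section \<open>Bases and their changes\<close>

lemma int_basis_closed: "int_basis G m b \<Longrightarrow> i < m \<Longrightarrow> b i \<in> carrier G"
  by (simp add: int_basis_def)

lemma int_basis_exists:
  assumes "int_basis G m b" "x \<in> carrier G"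
  obtains c where "x = lin_comb G b m c"
  using assms unfolding int_basis_def lin_comb_def by blast

lemma int_basis_unique:
  assumes B: "int_basis G m b" and eq: "lin_comb G b m c = lin_comb G b m c'" and "i < m"
  shows "c i = c' i"
proof -
  note b = int_basis_closed[OF B]
  have r: "lin_comb G b m d = (\<Otimes>i\<in>{..<m}. b i [^] restrict d {..<m} i)" for d
    unfolding lin_comb_def using b by (intro finprod_cong') auto
  have "lin_comb G b m c \<in> carrier G" using b by simp
  note ex1 = bspec[OF conjunct2[OF B[unfolded int_basis_def]] this]
  \<comment> \<open>Both coefficient functions, cut down to extensional ones, are the value of the
    same definite description.\<close>
  have "(THE d. d \<in> {..<m} \<rightarrow>\<^sub>E (UNIV :: int set) \<and>
      lin_comb G b m c = (\<Otimes>i\<in>{..<m}. b i [^] d i)) = restrict e {..<m}"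
    if "lin_comb G b m c = lin_comb G b m e" for e
    by (rule the1_equality[OF ex1 conjI]) (simp, rule trans[OF that r])
  from this[of c] this[OF eq]
  have "restrict c {..<m} = restrict c' {..<m}" by simp
  then show ?thesis using \<open>i < m\<close> by (metis lessThan_iff restrict_apply')
qed

lemma int_basisI:
  assumes b: "\<And>i. i < m \<Longrightarrow> b i \<in> carrier G"
    and ex: "\<And>x. x \<in> carrier G \<Longrightarrow> \<exists>c. x = lin_comb G b m c"
    and un: "\<And>c c' i. lin_comb G b m c = lin_comb G b m c' \<Longrightarrow> i < m \<Longrightarrow> c i = c' i"
  shows "int_basis G m b"
  unfolding int_basis_def
proof (intro conjI allI impI ballI)
  fix x assume "x \<in> carrier G"
  then obtain c where c: "x = lin_comb G b m c" using ex by blast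
  have r: "lin_comb G b m c = (\<Otimes>i\<in>{..<m}. b i [^] restrict c {..<m} i)"
    unfolding lin_comb_def using b by (intro finprod_cong') auto
  show "\<exists>!c. c \<in> {..<m} \<rightarrow>\<^sub>E (UNIV :: int set) \<and> x = (\<Otimes>i\<in>{..<m}. b i [^] c i)"
  proof (rule ex1I[of _ "restrict c {..<m}"])
    show "restrict c {..<m} \<in> {..<m} \<rightarrow>\<^sub>E (UNIV :: int set) \<and> x = (\<Otimes>i\<in>{..<m}. b i [^] restrict c {..<m} i)"
      using c r by auto
    fix d assume d: "d \<in> {..<m} \<rightarrow>\<^sub>E (UNIV :: int set) \<and> x = (\<Otimes>i\<in>{..<m}. b i [^] d i)"
    then have "lin_comb G b m d = lin_comb G b m c" using c by (simp add: lin_comb_def)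
    then have "\<And>i. i < m \<Longrightarrow> d i = c i" using un by blast
    then show "d = restrict c {..<m}" using d by (auto simp: PiE_iff extensional_def fun_eq_iff)
  qed
qed (use b in auto)

lemma int_basis_coords:
  assumes B: "int_basis G m b" and y: "\<And>j. j < k \<Longrightarrow> y j \<in> carrier G"
  shows "\<exists>A :: nat \<Rightarrow> nat \<Rightarrow> int. \<forall>j<k. y j = lin_comb G b m (\<lambda>i. A i j)"
proof -
  have "\<forall>j<k. \<exists>c. y j = lin_comb G b m c" using int_basis_exists[OF B] y by blast
  then obtain c where "\<And>j. j < k \<Longrightarrow> y j = lin_comb G b m (c j)" by metis
  then show ?thesis by (intro exI[of _ "\<lambda>i j. c j i"]) simp
qed

text \<open>Substituting one expansion into the other expresses \<open>b j\<close> through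
  \<open>b\<close> itself, and uniqueness of coordinates compares the result with a unit
  vector.\<close>

lemma int_basis_change_inverse:
  assumes B: "int_basis G m b" and b': "\<And>j. j < k \<Longrightarrow> b' j \<in> carrier G"
    and S: "\<And>j. j < k \<Longrightarrow> b' j = lin_comb G b m (\<lambda>i. S i j)"
    and T: "\<And>j. j < m \<Longrightarrow> b j = lin_comb G b' k (\<lambda>i. T i j)"
    and ij: "i < m" "j < m"
  shows "(\<Sum>l<k. S i l * T l j) = (if i = j then 1 else 0)"
proof -
  note b = int_basis_closed[OF B]
  have "lin_comb G b m (\<lambda>i. if i = j then 1 else 0) = b j" using b ij by (simp add: lin_comb_unit)
  also have "\<dots> = lin_comb G (\<lambda>l. lin_comb G b m (\<lambda>i. S i l)) k (\<lambda>l. T l j)"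
    using T[OF ij(2)] S b b' lin_comb_cong[of k b' "\<lambda>l. lin_comb G b m (\<lambda>i. S i l)" "\<lambda>l. T l j" "\<lambda>l. T l j"] by simp
  also have "\<dots> = lin_comb G b m (\<lambda>i. \<Sum>l<k. S i l * T l j)"
    using b by (rule lin_comb_lin_comb)
  finally have "lin_comb G b m (\<lambda>i. if i = j then 1 else 0) = lin_comb G b m (\<lambda>i. \<Sum>l<k. S i l * T l j)" .
  from int_basis_unique[OF B this ij(1)] show ?thesis by simp
qed

lemma int_basis_transform:
  assumes B: "int_basis G m b"
    and ST: "\<And>i j. i < m \<Longrightarrow> j < m \<Longrightarrow> (\<Sum>l<m. S i l * T l j) = (if i = j then 1 else 0)"
    and TS: "\<And>i j. i < m \<Longrightarrow> j < m \<Longrightarrow> (\<Sum>l<m. T i l * S l j) = (if i = j then 1 else 0)"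
  shows "int_basis G m (\<lambda>j. lin_comb G b m (\<lambda>i. S i j))"
proof -
  note b = int_basis_closed[OF B]
  let ?b = "\<lambda>j. lin_comb G b m (\<lambda>i. S i j)"
  have eq: "lin_comb G ?b m c = lin_comb G b m (\<lambda>i. \<Sum>j<m. S i j * c j)" for c
    using b by (rule lin_comb_lin_comb)
  show ?thesis
  proof (rule int_basisI)
    show "?b i \<in> carrier G" if "i < m" for i using b by simp
    fix x assume "x \<in> carrier G"
    then obtain c where c: "x = lin_comb G b m c" using int_basis_exists[OF B] by blast
    have "x = lin_comb G ?b m (\<lambda>i. \<Sum>j<m. T i j * c j)"
      unfolding eq c using b mat_inverse_apply[OF _ ST] by (intro lin_comb_cong) auto
    then show "\<exists>c. x = lin_comb G ?b m c" by blast
  next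
    fix c c' i assume "lin_comb G ?b m c = lin_comb G ?b m c'" and i: "i < m"
    then have "(\<Sum>j<m. S l j * c j) = (\<Sum>j<m. S l j * c' j)" if "l < m" for l
      using int_basis_unique[OF B, of "\<lambda>l. \<Sum>j<m. S l j * c j" "\<lambda>l. \<Sum>j<m. S l j * c' j"] that
      unfolding eq by simp
    then have "(\<Sum>l<m. T i l * (\<Sum>j<m. S l j * c j)) = (\<Sum>l<m. T i l * (\<Sum>j<m. S l j * c' j))"
      by simp
    then show "c i = c' i" using mat_inverse_apply[OF i TS] by simp
  qed
qed

lemma int_basis_iso:
  assumes B: "int_basis G m b" and h: "h \<in> iso G H" and H: "comm_group H"
  shows "int_basis H m (\<lambda>i. h (b i))"
proof -
  have hom: "h \<in> hom G H" using h unfolding iso_def by simp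
  have bij: "bij_betw h (carrier G) (carrier H)" using h unfolding iso_def by simp
  have b: "\<And>i. i < m \<Longrightarrow> b i \<in> carrier G" by (rule int_basis_closed[OF B])
  interpret H: comm_group H by fact
  have hl: "h (lin_comb G b m c) = lin_comb H (\<lambda>i. h (b i)) m c" for c
    using b by (intro hom_lin_comb[OF hom H])
  show ?thesis
  proof (rule H.int_basisI)
    show "h (b i) \<in> carrier H" if "i < m" for i using b[OF that] hom by (simp add: hom_in_carrier)
    fix x assume "x \<in> carrier H"
    then obtain y where "y \<in> carrier G" and "x = h y" using bij by (metis bij_betw_iff_bijections)
    moreover obtain c where "y = lin_comb G b m c" using \<open>y \<in> carrier G\<close> int_basis_exists[OF B] by blast
    ultimately show "\<exists>c. x = lin_comb H (\<lambda>i. h (b i)) m c" using hl by blast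
  next
    fix c c' i assume "lin_comb H (\<lambda>i. h (b i)) m c = lin_comb H (\<lambda>i. h (b i)) m c'" and i: "i < m"
    then have "h (lin_comb G b m c) = h (lin_comb G b m c')" using hl by simp
    then have "lin_comb G b m c = lin_comb G b m c'"
      using bij b by (meson bij_betw_def inj_on_def lin_comb_closed)
    then show "c i = c' i" using int_basis_unique[OF B] i by blast
  qed
qed

lemma int_basis_cong:
  assumes B: "int_basis G m b" and eq: "\<And>i. i < m \<Longrightarrow> b i = b' i"
  shows "int_basis G m b'"
proof (rule int_basisI)
  note b = int_basis_closed[OF B]
  have lc: "lin_comb G b' m c = lin_comb G b m c" for c
    using b eq by (intro lin_comb_cong) auto
  show "b' i \<in> carrier G" if "i < m" for i using b[OF that] eq[OF that] by simp
  show "\<exists>c. x = lin_comb G b' m c" if "x \<in> carrier G" for x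
    using int_basis_exists[OF B that] unfolding lc by blast
  show "c i = c' i" if "lin_comb G b' m c = lin_comb G b' m c'" "i < m" for c c' i
    using int_basis_unique[OF B] that unfolding lc by simp
qed

text \<open>Exactly the existence and uniqueness that the definite description in
  \<open>gluing_matrix\<close> calls for.\<close>

lemma int_basis_ex1_mat:
  assumes B: "int_basis G m b" and y: "\<And>j. j < m \<Longrightarrow> y j \<in> carrier G"
  shows "\<exists>!A. A \<in> carrier_mat m m \<and> (\<forall>j<m. y j = (\<Otimes>i\<in>{..<m}. b i [^] (A $$ (i, j) :: int)))"
proof -
  obtain A :: "nat \<Rightarrow> nat \<Rightarrow> int" where A: "\<And>j. j < m \<Longrightarrow> y j = lin_comb G b m (\<lambda>i. A i j)"
    using int_basis_coords[OF B, of m y, OF y] by blast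
  have eq: "(\<Otimes>i\<in>{..<m}. b i [^] (C $$ (i, j) :: int)) = lin_comb G b m (\<lambda>i. C $$ (i, j))" for C j
    by (simp add: lin_comb_def)
  show ?thesis
    unfolding eq
  proof (rule ex1I[of _ "mat m m (\<lambda>(i, j). A i j)"])
    show "mat m m (\<lambda>(i, j). A i j) \<in> carrier_mat m m \<and>
        (\<forall>j<m. y j = lin_comb G b m (\<lambda>i. mat m m (\<lambda>(i, j). A i j) $$ (i, j)))"
      using int_basis_closed[OF B] by (auto simp: A intro!: lin_comb_cong)
    fix C assume C: "C \<in> carrier_mat m m \<and> (\<forall>j<m. y j = lin_comb G b m (\<lambda>i. C $$ (i, j)))"
    have "C $$ (i, j) = A i j" if ij: "i < m" "j < m" for i j
    proof -
      have "y j = lin_comb G b m (\<lambda>i. C $$ (i, j))" using C ij(2) by blast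
      then have "lin_comb G b m (\<lambda>i. C $$ (i, j)) = lin_comb G b m (\<lambda>i. A i j)"
        using A[OF ij(2)] by (rule trans[OF sym])
      from int_basis_unique[OF B this ij(1)] show ?thesis .
    qed
    then show "C = mat m m (\<lambda>(i, j). A i j)" using C by (intro eq_matI) auto
  qed
qed

text \<open>Both sides are coordinates of \<open>d' j\<close> in the basis \<open>c\<close>,
  computed once by way of \<open>c'\<close> and once by way of \<open>d\<close>. Later
  \<open>c\<close> and \<open>c'\<close> are the transported tuples of a gluing torus for two
  Waldhausen bases, \<open>d\<close> and \<open>d'\<close> the tuples on the opposite torus, and the
  relation reads A \<Psi>' = \<Psi> A'.\<close>

lemma change_of_basis_relation:
  fixes A \<Psi> A' \<Psi>' :: "nat \<Rightarrow> nat \<Rightarrow> int"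
  assumes B: "int_basis G m c"
    and c': "\<And>j. j < m \<Longrightarrow> c' j = lin_comb G c m (\<lambda>i. A i j)"
    and d: "\<And>j. j < m \<Longrightarrow> d j = lin_comb G c m (\<lambda>i. \<Psi> i j)"
    and d': "\<And>j. j < m \<Longrightarrow> d' j = lin_comb G d m (\<lambda>i. A' i j)"
      "\<And>j. j < m \<Longrightarrow> d' j = lin_comb G c' m (\<lambda>i. \<Psi>' i j)"
    and ij: "i < m" "j < m"
  shows "(\<Sum>l<m. A i l * \<Psi>' l j) = (\<Sum>l<m. \<Psi> i l * A' l j)"
proof -
  have c: "c i \<in> carrier G" if "i < m" for i using int_basis_closed[OF B that] .
  have "lin_comb G c m (\<lambda>i. \<Sum>l<m. A i l * \<Psi>' l j) = lin_comb G (\<lambda>j. lin_comb G c m (\<lambda>i. A i j)) m (\<lambda>i. \<Psi>' i j)"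
    using c by (rule lin_comb_lin_comb[symmetric])
  also have "\<dots> = d' j" unfolding d'(2)[OF ij(2)] using c by (intro lin_comb_cong) (auto simp: c')
  also have "\<dots> = lin_comb G (\<lambda>j. lin_comb G c m (\<lambda>i. \<Psi> i j)) m (\<lambda>i. A' i j)"
    unfolding d'(1)[OF ij(2)] using c by (intro lin_comb_cong) (auto simp: d)
  also have "\<dots> = lin_comb G c m (\<lambda>i. \<Sum>l<m. \<Psi> i l * A' l j)"
    using c by (rule lin_comb_lin_comb)
  finally show ?thesis using ij(1) by (rule int_basis_unique[OF B])
qed

end

section \<open>Circle-valued maps\<close>

definition circle :: "(nat \<Rightarrow> real) topology" where
  "circle = nsphere 1"

text \<open>The points of \<open>nsphere 1\<close> are real sequences vanishing from index 2 on.
  Complex numbers provide what these lack: products, integer powers and logarithms of circle-valued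
  maps.\<close>

definition circ_pt :: "complex \<Rightarrow> nat \<Rightarrow> real" where
  "circ_pt z = (\<lambda>i. if i = 0 then Re z else if i = 1 then Im z else 0)"

definition circ_val :: "(nat \<Rightarrow> real) \<Rightarrow> complex" where
  "circ_val x = Complex (x 0) (x 1)"

lemma continuous_map_compose_on:
  assumes "continuous_map X euclidean u" "continuous_on UNIV f"
  shows "continuous_map X euclidean (\<lambda>x. f (u x))"
  using continuous_map_compose[OF assms(1), of euclidean f] assms(2) by (simp add: o_def)

lemma continuous_map_compose_on2:
  assumes "continuous_map X euclidean u" "continuous_map X euclidean v"
    and f: "continuous_on UNIV (\<lambda>p. f (fst p) (snd p))"
  shows "continuous_map X euclidean (\<lambda>x. f (u x) (v x))"
proof -
  have "continuous_map X euclidean (\<lambda>x. (u x, v x))"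
    using continuous_map_pairedI[OF assms(1,2)] by simp
  from continuous_map_compose_on[OF this f] show ?thesis by simp
qed

lemma in_topspace_circle:
  "x \<in> topspace circle \<longleftrightarrow> norm (circ_val x) = 1 \<and> (\<forall>i\<ge>2. x i = 0)"
  by (auto simp: circle_def nsphere circ_val_def cmod_def Suc_le_eq numeral_2_eq_2)

lemma circ_val_circ_pt [simp]: "circ_val (circ_pt z) = z"
  by (simp add: circ_val_def circ_pt_def)

lemma circ_pt_circ_val: "x \<in> topspace circle \<Longrightarrow> circ_pt (circ_val x) = x"
  by (rule ext) (auto simp: in_topspace_circle circ_val_def circ_pt_def)

lemma circ_pt_in_circle [simp]: "circ_pt z \<in> topspace circle \<longleftrightarrow> norm z = 1"
  by (simp add: in_topspace_circle) (simp add: circ_pt_def)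

lemma continuous_map_circ_val: "continuous_map circle euclidean circ_val"
proof -
  have "continuous_map circle euclidean (\<lambda>x. of_real (x 0) + \<i> * of_real (x 1))"
    unfolding circle_def
    by (intro continuous_map_compose_on2[of _ _ _ "\<lambda>a b. of_real a + \<i> * of_real b"]
        continuous_map_nsphere_projection continuous_intros)
  then show ?thesis by (simp add: circ_val_def[abs_def] Complex_eq)
qed

lemma continuous_map_circ_pt:
  assumes "continuous_map X euclidean u" "\<And>x. x \<in> topspace X \<Longrightarrow> norm (u x) = 1"
  shows "continuous_map X circle (\<lambda>x. circ_pt (u x))"
proof -
  have "continuous_map X euclideanreal (\<lambda>x. Re (u x))" "continuous_map X euclideanreal (\<lambda>x. Im (u x))"
    by (intro continuous_map_compose_on[OF assms(1)] continuous_intros)+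
  then have "continuous_map X (powertop_real UNIV) (\<lambda>x. circ_pt (u x))"
    by (auto simp: continuous_map_componentwise_UNIV circ_pt_def)
  moreover have "circ_pt (u x) \<in> topspace circle" if "x \<in> topspace X" for x
    using assms(2)[OF that] by simp
  ultimately show ?thesis
    by (auto simp: circle_def nsphere continuous_map_in_subtopology)
qed

definition circle_map :: "'a topology \<Rightarrow> ('a \<Rightarrow> complex) \<Rightarrow> bool" where
  "circle_map X u \<longleftrightarrow> continuous_map X euclidean u \<and> (\<forall>x\<in>topspace X. norm (u x) = 1)"

lemma circle_map_circ_pt: "circle_map X u \<Longrightarrow> continuous_map X circle (\<lambda>x. circ_pt (u x))"
  by (simp add: circle_map_def continuous_map_circ_pt)

lemma circle_map_circ_val:
  assumes "continuous_map X circle g"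
  shows "circle_map X (\<lambda>x. circ_val (g x))"
  using continuous_map_compose[OF assms continuous_map_circ_val] continuous_map_image_subset_topspace[OF assms]
  by (auto simp: circle_map_def o_def in_topspace_circle)

lemma circle_map_mult: "circle_map X u \<Longrightarrow> circle_map X v \<Longrightarrow> circle_map X (\<lambda>x. u x * v x)"
  unfolding circle_map_def norm_mult
  by (auto intro!: continuous_map_compose_on2[of X u v "(*)"] continuous_intros)

lemma circle_map_const: "norm c = 1 \<Longrightarrow> circle_map X (\<lambda>x. c)"
  by (simp add: circle_map_def)

lemma circle_map_compose:
  "circle_map Y u \<Longrightarrow> continuous_map X Y g \<Longrightarrow> circle_map X (\<lambda>x. u (g x))"
  using continuous_map_compose[of X Y g euclidean u] continuous_map_image_subset_topspace[of X Y g]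
  by (auto simp: circle_map_def o_def)

text \<open>On the unit circle inversion is conjugation, which is continuous on the whole plane, as
  composition by \<open>continuous_map_compose_on\<close> demands; inversion itself fails at
  0.\<close>

lemma circle_map_inverse: 
  assumes "circle_map X u" 
  shows "circle_map X (\<lambda>x. inverse (u x))"
proof -
  have "continuous_map X euclidean (\<lambda>x. cnj (u x))"
    using assms by (intro continuous_map_compose_on[of X u cnj] continuous_intros) (simp add: circle_map_def)
  moreover have "inverse (u x) = cnj (u x)" if "x \<in> topspace X" for x
    using assms that complex_norm_square[of "u x"] by (intro inverse_unique) (simp add: circle_map_def)
  ultimately show ?thesis
    using assms continuous_map_eq[of X euclidean "\<lambda>x. cnj (u x)" "\<lambda>x. inverse (u x)"]
    by (auto simp: circle_map_def norm_inverse)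
qed

lemma circle_map_powi: 
  assumes "circle_map X u" 
  shows "circle_map X (\<lambda>x. u x powi m)"
proof -
  have pow: "circle_map X v \<Longrightarrow> circle_map X (\<lambda>x. v x ^ n)" for v n
    by (induction n) (auto intro: circle_map_mult circle_map_const)
  show ?thesis
    using pow[OF assms] pow[OF circle_map_inverse[OF assms]] by (cases "0 \<le> m") (auto simp: power_int_def)
qed

lemma circle_map_prod: 
  "finite I \<Longrightarrow> (\<And>i. i \<in> I \<Longrightarrow> circle_map X (u i)) \<Longrightarrow> circle_map X (\<lambda>x. \<Prod>i\<in>I. u i x)"
  by (induction I rule: finite_induct) (auto intro: circle_map_mult circle_map_const)

lemma circle_map_cis: "continuous_map X euclideanreal h \<Longrightarrow> circle_map X (\<lambda>x. cis (h x))"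
  unfolding circle_map_def by (auto intro!: continuous_map_compose_on[of X h] continuous_intros)

lemma torus_circle: "torus k = product_topology (\<lambda>_. circle) {..<k}"
  by (simp add: torus_def circle_def)

lemma topspace_torus: "topspace (torus k) = {..<k} \<rightarrow>\<^sub>E topspace circle"
  by (simp add: torus_circle)

lemma circle_map_coord: "i < k \<Longrightarrow> circle_map (torus k) (\<lambda>t. circ_val (t i))"
  unfolding torus_circle by (intro circle_map_circ_val continuous_map_product_projection) auto

definition torus_map :: "nat \<Rightarrow> (nat \<Rightarrow> 'a \<Rightarrow> complex) \<Rightarrow> 'a \<Rightarrow> nat \<Rightarrow> nat \<Rightarrow> real" where
  "torus_map k u x = (\<lambda>i\<in>{..<k}. circ_pt (u i x))"

lemma continuous_map_torus_map:
  "(\<And>i. i < k \<Longrightarrow> circle_map X (u i)) \<Longrightarrow> continuous_map X (torus k) (torus_map k u)"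
  unfolding torus_circle torus_map_def
  by (auto simp: continuous_map_componentwise circle_map_circ_pt)

section \<open>Periods of circle-valued maps\<close>

abbreviation H1 :: "'a topology \<Rightarrow> 'a chain set monoid" where
  "H1 X \<equiv> homology_group 1 X"

abbreviation H1_map :: "'a topology \<Rightarrow> 'b topology \<Rightarrow> ('a \<Rightarrow> 'b) \<Rightarrow> 'a chain set \<Rightarrow> 'b chain set" where
  "H1_map X Y g \<equiv> hom_induced 1 X {} Y {} g"

text \<open>This amounts to an orientation of the circle, whose sign is left to choice. The sign is
  harmless, as \<open>circle_gen\<close> is normalized by the same isomorphism.\<close>

definition circle_class :: "(nat \<Rightarrow> real) chain set \<Rightarrow> int" where
  "circle_class = (SOME \<phi>. \<phi> \<in> iso (H1 circle) integer_group)"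

lemma circle_class_iso: "circle_class \<in> iso (H1 circle) integer_group"
proof -
  have "H1 circle \<cong> integer_group"
    using reduced_homology_group_nsphere(1)[of 1] un_reduced_homology_group[of 1 "circle"] by (simp add: circle_def)
  then show ?thesis unfolding circle_class_def is_iso_def by (metis ex_in_conv someI)
qed

text \<open>The winding number of \<open>u\<close> along \<open>x\<close>, in other words the value
  on \<open>x\<close> of the class that \<open>u\<close> represents in the first integral cohomology
  of \<open>X\<close>.\<close>

definition period :: "'a topology \<Rightarrow> ('a \<Rightarrow> complex) \<Rightarrow> 'a chain set \<Rightarrow> int" where
  "period X u x = circle_class (H1_map X circle (\<lambda>x. circ_pt (u x)) x)"

lemma H1_map_closed [simp]: "H1_map X Y g x \<in> carrier (H1 Y)"
  by (simp add: hom_induced_carrier)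

lemma period_mult:
  "x \<in> carrier (H1 X) \<Longrightarrow> y \<in> carrier (H1 X) \<Longrightarrow>
    period X u (x \<otimes>\<^bsub>H1 X\<^esub> y) = period X u x + period X u y"
  unfolding period_def
  using circle_class_iso hom_induced_empty_hom[of 1 X "circle" "\<lambda>x. circ_pt (u x)"]
  by (auto simp: iso_def hom_def Pi_iff)

lemma period_compose:
  assumes "circle_map Y u" "continuous_map X Y g"
  shows "period X (\<lambda>x. u (g x)) x = period Y u (H1_map X Y g x)"
  unfolding period_def
  using hom_induced_compose_empty[OF assms(2) circle_map_circ_pt[OF assms(1)], of 1] by (simp add: o_def)

lemma period_cong: "(\<And>x. x \<in> topspace X \<Longrightarrow> u x = v x) \<Longrightarrow> period X u = period X v"
  unfolding period_def by (subst hom_induced_eq[where g = "\<lambda>x. circ_pt (v x)"]) auto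

lemma period_homotopic:
  "homotopic_with (\<lambda>_. True) X circle (\<lambda>x. circ_pt (u x)) (\<lambda>x. circ_pt (v x)) \<Longrightarrow> period X u = period X v"
  unfolding period_def by (drule homology_homotopy_empty[of _ _ _ _ 1]) simp

text \<open>The real exponent is scaled down to 0 by the homotopy parameter. It is the existence of
  a real-valued exponent, not merely a circle-valued factor, that makes this possible.\<close>

lemma homotopic_circle_map_cis:
  assumes u: "circle_map X u" and h: "continuous_map X euclideanreal h"
  shows "homotopic_with (\<lambda>_. True) X circle (\<lambda>x. circ_pt (u x)) (\<lambda>x. circ_pt (u x * cis (h x)))"
proof -
  let ?Y = "prod_topology (top_of_set {0..1::real}) X"
  have "circle_map ?Y (\<lambda>y. u (snd y) * cis (fst y * h (snd y)))"
    by (intro circle_map_mult circle_map_compose[OF u] circle_map_cis continuous_map_real_mult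
        continuous_map_snd continuous_map_compose[OF continuous_map_snd h, unfolded o_def]
        continuous_map_into_fulltopology[OF continuous_map_fst])
  then have "continuous_map ?Y circle (\<lambda>y. circ_pt (u (snd y) * cis (fst y * h (snd y))))"
    by (rule circle_map_circ_pt)
  then show ?thesis
    unfolding homotopic_with_def by (intro exI conjI) auto
qed

lemma period_mult_cis:
  "circle_map X u \<Longrightarrow> continuous_map X euclideanreal h \<Longrightarrow> period X (\<lambda>x. u x * cis (h x)) = period X u"
  by (rule sym, rule period_homotopic, rule homotopic_circle_map_cis)

text \<open>A constant map factors through a point, whose first homology is trivial. Outside the
  carrier \<open>hom_induced\<close> returns the neutral element by default, so the value is 0 there
  too.\<close>

lemma period_const:
  assumes "norm c = 1"
  shows "period X (\<lambda>x. c) x = 0"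
proof (cases "x \<in> carrier (H1 X)")
  case True
  let ?D = "discrete_topology {()}"
  have "trivial_group (H1 ?D)" by (rule homology_dimension_axiom[of _ "()"]) auto
  then have "H1_map X ?D (\<lambda>x. ()) x = \<one>\<^bsub>H1 ?D\<^esub>"
    using H1_map_closed[of X ?D "\<lambda>x. ()" x] unfolding trivial_group_def by blast
  moreover have "period X (\<lambda>x. c) x = period ?D (\<lambda>_. c) (H1_map X ?D (\<lambda>x. ()) x)"
    using assms by (intro period_compose) (auto simp: circle_map_const)
  moreover have "period ?D (\<lambda>_. c) \<one>\<^bsub>H1 ?D\<^esub> = 0"
    using period_mult[of "\<one>\<^bsub>H1 ?D\<^esub>" ?D "\<one>\<^bsub>H1 ?D\<^esub>" "\<lambda>_. c"]
    by (simp add: group.is_monoid)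
  ultimately show ?thesis by simp
next
  case False
  then have "H1_map X circle (\<lambda>x. circ_pt c) x = \<one>\<^bsub>H1 circle\<^esub>"
    by (intro hom_induced_default) auto
  then show ?thesis
    using circle_class_iso hom_one[of circle_class "H1 circle" integer_group]
    by (simp add: period_def iso_def)
qed

section \<open>Lifting circle-valued maps on a torus to its covering space\<close>

lemma eval_unit_sum:
  fixes a :: "nat \<Rightarrow> real"
  defines "e \<equiv> \<lambda>i. Bcontfun (\<lambda>j :: nat. if j = i then 1 else 0 :: real)"
  shows "apply_bcontfun (\<Sum>i<k. a i *\<^sub>R e i) j = (if j < k then a j else 0)"
proof -
  have e: "apply_bcontfun (e i) j = (if j = i then 1 else 0)" for i
    unfolding e_def
    by (subst Bcontfun_inverse) (auto intro!: bcontfun_normI[where b = 1] continuous_on_discrete)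
  have "apply_bcontfun (\<Sum>i<k. a i *\<^sub>R e i) j = (\<Sum>i<k. a i * (if j = i then 1 else 0))" for k
    by (induction k) (auto simp: e)
  then show ?thesis by (simp add: if_distrib[of "\<lambda>x. _ * x"] cong: if_cong)
qed

lemma continuous_on_eval_bcontfun: "continuous_on UNIV (\<lambda>v :: nat \<Rightarrow>\<^sub>C real. apply_bcontfun v j)"
  unfolding continuous_on_iff
proof (intro ballI allI impI)
  fix v :: "nat \<Rightarrow>\<^sub>C real" and \<epsilon> :: real assume "0 < \<epsilon>"
  then show "\<exists>d>0. \<forall>w\<in>UNIV. dist w v < d \<longrightarrow> dist (apply_bcontfun w j) (apply_bcontfun v j) < \<epsilon>"
    by (intro exI[of _ \<epsilon>] conjI ballI impI) (auto intro: le_less_trans[OF dist_bounded])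
qed

lemma cis_sum: 
  fixes k :: nat
  shows "cis (\<Sum>i<k. a i) = (\<Prod>i<k. cis (a i))"
  by (induction k) (simp_all flip: cis_mult)

text \<open>The covering space $R^k$ is placed inside the normed space of bounded sequences, because the
  logarithm theorem of the library is about normed spaces and \<open>k\<close> is a variable.\<close>

lemma circle_map_torus_lift:
  assumes u: "circle_map (torus k) u"
  obtains m :: "nat \<Rightarrow> int" and h where "continuous_map (torus k) euclideanreal h"
    "\<And>t. t \<in> topspace (torus k) \<Longrightarrow> u t = (\<Prod>i<k. circ_val (t i) powi m i) * cis (h t)"
proof -
  define e where "e = (\<lambda>i. Bcontfun (\<lambda>j :: nat. if j = i then 1 else 0 :: real))"
  define J where "J = (\<lambda>a :: nat \<Rightarrow> real. \<Sum>i<k. a i *\<^sub>R e i)"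
  have J: "apply_bcontfun (J a) j = (if j < k then a j else 0)" for a j
    unfolding J_def e_def by (rule eval_unit_sum)
  \<comment> \<open>The covering map of the torus, preceded by forgetting all coordinates from
    \<open>k\<close> on; it has period 1 in each of the remaining ones.\<close>
  define E where "E = torus_map k (\<lambda>i v. cis (2 * pi * apply_bcontfun v i))"
  have E: "continuous_map euclidean (torus k) E"
    unfolding E_def
    by (intro continuous_map_torus_map circle_map_cis)
      (auto intro!: continuous_intros continuous_on_eval_bcontfun)
  have "circle_map euclidean (\<lambda>v. u (E v))" by (rule circle_map_compose[OF u E])
  then have "continuous_on UNIV (\<lambda>v. u (E v))" and norm_uE: "\<And>v. norm (u (E v)) = 1"
    by (auto simp: circle_map_def)
  then obtain g where g: "continuous_on UNIV g" "\<And>v. u (E v) = exp (g v)"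
    using continuous_logarithm_on_contractible[of UNIV "\<lambda>v. u (E v)"]
    by (metis UNIV_I contractible_UNIV norm_zero zero_neq_one)
  define \<gamma> where "\<gamma> = (\<lambda>v. Im (g v))"
  have \<gamma>: "continuous_on UNIV \<gamma>" unfolding \<gamma>_def by (intro continuous_intros g)
  have uE: "u (E v) = cis (\<gamma> v)" for v
  proof -
    have "Re (g v) = 0" using norm_uE[of v] g(2)[of v] by simp
    then show ?thesis using g(2)[of v] by (simp add: \<gamma>_def exp_eq_polar)
  qed
  have apply_shift: "apply_bcontfun (v + e i) j = apply_bcontfun v j + (if j = i then 1 else 0)"
    if "i < k" for v i j
  proof -
    have "J (\<lambda>j. if j = i then 1 else 0) = (\<Sum>j<k. if j = i then e j else 0)"
      unfolding J_def by (intro sum.cong) auto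
    then have "J (\<lambda>j. if j = i then 1 else 0) = e i" using that by simp
    then show ?thesis using J[of "\<lambda>j. if j = i then 1 else 0" j] that by auto
  qed
  have E_shift: "E (v + e i) = E v" if "i < k" for v i
  proof -
    have "cis (2 * pi * apply_bcontfun (v + e i) j) = cis (2 * pi * apply_bcontfun v j)" for j
      unfolding apply_shift[OF that] by (cases "j = i") (simp_all add: distrib_left flip: cis_mult)
    then show ?thesis by (simp add: E_def torus_map_def)
  qed
  \<comment> \<open>Under a deck translation the lift \<open>\<gamma>\<close> changes by a multiple
    of 2 pi. The change is continuous with discrete values on a connected space, hence the same
    multiple at every point; these multiples become the exponents of the monomial.\<close>
  have "\<forall>i<k. \<exists>m :: int. \<forall>v. \<gamma> (v + e i) = \<gamma> v + 2 * pi * m"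
  proof (intro allI impI)
    fix i assume i: "i < k"
    have ex: "\<exists>m :: int. \<gamma> (v + e i) = \<gamma> v + 2 * pi * m" for v
      using uE[of "v + e i"] uE[of v] E_shift[OF i, of v] sin_cos_eq_iff[of "\<gamma> (v + e i)" "\<gamma> v"]
      by (simp add: complex_eq_iff)
    have "(\<lambda>v. \<gamma> (v + e i) - \<gamma> v) constant_on UNIV"
    proof (rule continuous_discrete_range_constant)
      show "continuous_on UNIV (\<lambda>v. \<gamma> (v + e i) - \<gamma> v)"
        by (intro continuous_intros continuous_on_compose2[OF \<gamma>]) auto
      fix v
      have "2 * pi \<le> norm ((\<gamma> (w + e i) - \<gamma> w) - (\<gamma> (v + e i) - \<gamma> v))"
        if ne: "\<gamma> (w + e i) - \<gamma> w \<noteq> \<gamma> (v + e i) - \<gamma> v" for w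
      proof -
        obtain m n :: int where mn: "\<gamma> (v + e i) = \<gamma> v + 2 * pi * m" "\<gamma> (w + e i) = \<gamma> w + 2 * pi * n"
          using ex by metis
        then have "m \<noteq> n" using ne by auto
        then have "1 \<le> \<bar>real_of_int (n - m)\<bar>" by linarith
        then have "2 * pi * 1 \<le> 2 * pi * \<bar>real_of_int (n - m)\<bar>" by (intro mult_left_mono) auto
        also have "\<dots> = \<bar>2 * pi * real_of_int (n - m)\<bar>" by (simp add: abs_mult)
        finally show ?thesis using mn by (simp add: algebra_simps)
      qed
      then show "\<exists>d>0. \<forall>w. w \<in> UNIV \<and> \<gamma> (w + e i) - \<gamma> w \<noteq> \<gamma> (v + e i) - \<gamma> v \<longrightarrow>
          d \<le> norm ((\<gamma> (w + e i) - \<gamma> w) - (\<gamma> (v + e i) - \<gamma> v))"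
        by (intro exI[of _ "2 * pi"]) auto
    qed auto
    then obtain c where c: "\<And>v. \<gamma> (v + e i) - \<gamma> v = c" by (auto simp: constant_on_def)
    obtain m :: int where "\<gamma> (0 + e i) = \<gamma> 0 + 2 * pi * m" using ex by blast
    then have "c = 2 * pi * m" using c[of 0] by simp
    then show "\<exists>m :: int. \<forall>v. \<gamma> (v + e i) = \<gamma> v + 2 * pi * m" using c by (metis add.commute diff_eq_eq)
  qed
  then obtain m :: "nat \<Rightarrow> int" where m: "\<And>i v. i < k \<Longrightarrow> \<gamma> (v + e i) = \<gamma> v + 2 * pi * m i"
    by metis
  \<comment> \<open>The subtracted linear function has the same increments as
    \<open>\<gamma>\<close> under deck translations, so the difference is invariant and descends to
    the torus.\<close>
  define h0 where "h0 = (\<lambda>v. \<gamma> v - (\<Sum>i<k. 2 * pi * m i * apply_bcontfun v i))"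
  have h0: "continuous_on UNIV h0"
    unfolding h0_def by (intro continuous_intros \<gamma> continuous_on_eval_bcontfun)
  have shift: "h0 (v + e i) = h0 v" if i: "i < k" for v i
  proof -
    have "(\<Sum>j<k. 2 * pi * m j * apply_bcontfun (v + e i) j) =
        (\<Sum>j<k. 2 * pi * m j * apply_bcontfun v j + (if j = i then 2 * pi * m j else 0))"
      unfolding apply_shift[OF i] by (intro sum.cong) (auto simp: algebra_simps)
    also have "\<dots> = (\<Sum>j<k. 2 * pi * m j * apply_bcontfun v j) + 2 * pi * m i"
      using i by (simp add: sum.distrib)
    finally show ?thesis using m[OF i] by (simp add: h0_def)
  qed
  have shift_nat: "h0 (v + real n *\<^sub>R e i) = h0 v" if "i < k" for v i and n :: nat
    by (induction n) (use shift[OF that] in \<open>simp_all add: scaleR_add_left add.assoc[symmetric] add.commute[of 1]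
      add.left_commute\<close>)
  have shift_int: "h0 (v + of_int n *\<^sub>R e i) = h0 v" if "i < k" for v i and n :: int
  proof (cases "0 \<le> n")
    case True
    then show ?thesis using shift_nat[OF that, of v "nat n"] by simp
  next
    case False
    then show ?thesis using shift_nat[OF that, of "v + of_int n *\<^sub>R e i" "nat (- n)"] by simp
  qed
  have shift_all: "h0 (v + (\<Sum>i<l. of_int (n i) *\<^sub>R e i)) = h0 v" if "l \<le> k" for v l and n :: "nat \<Rightarrow> int"
    using that
  proof (induction l)
    case (Suc l)
    then show ?case
      using shift_int[of l "v + (\<Sum>i<l. of_int (n i) *\<^sub>R e i)" "n l"] by (simp add: add.assoc)
  qed simp
  have h0_J: "h0 (J a) = h0 (J b)" if "\<And>i. i < k \<Longrightarrow> cis (2 * pi * a i) = cis (2 * pi * b i)" for a b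
  proof -
    have "\<forall>i<k. \<exists>n :: int. a i = b i + n"
    proof (intro allI impI)
      fix i assume "i < k"
      then have "\<exists>n :: int. 2 * pi * a i = 2 * pi * b i + 2 * pi * n"
        using that[of i] sin_cos_eq_iff[of "2 * pi * a i" "2 * pi * b i"] by (simp add: complex_eq_iff)
      then obtain n :: int where "2 * pi * a i = 2 * pi * (b i + n)" by (auto simp: algebra_simps)
      then show "\<exists>n :: int. a i = b i + n" by auto
    qed
    then obtain n :: "nat \<Rightarrow> int" where n: "\<And>i. i < k \<Longrightarrow> a i = b i + n i" by metis
    have "J a = J b + (\<Sum>i<k. of_int (n i) *\<^sub>R e i)"
      unfolding J_def sum.distrib[symmetric] by (intro sum.cong) (auto simp: n scaleR_add_left)
    then show ?thesis using shift_all[of k "J b" n] by simp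
  qed
  \<comment> \<open>The section built from \<open>Arg2pi\<close> is discontinuous. By
    \<open>h0_J\<close> the value does not depend on the chosen preimage, and continuity is checked
    after pulling back to the cube [0,1]^k, from which the torus is a quotient.\<close>
  define h where "h = (\<lambda>t. h0 (J (\<lambda>i. Arg2pi (circ_val (t i)) / (2 * pi))))"
  have cis_Arg: "cis (2 * pi * (Arg2pi z / (2 * pi))) = z" if "norm z = 1" for z
    using Arg2pi_eq[of z] that by (simp add: cis_conv_exp)
  have E_J: "E (J a) = torus_map k (\<lambda>i a. cis (2 * pi * a i)) a" for a
    by (auto simp: E_def torus_map_def J)
  have t_eq: "E (J (\<lambda>i. Arg2pi (circ_val (t i)) / (2 * pi))) = t" if "t \<in> topspace (torus k)" for t
  proof
    fix j
    show "E (J (\<lambda>i. Arg2pi (circ_val (t i)) / (2 * pi))) j = t j"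
    proof (cases "j < k")
      case True
      then have tj: "t j \<in> topspace circle" using that by (auto simp: topspace_torus)
      then have "norm (circ_val (t j)) = 1" by (simp add: in_topspace_circle)
      then show ?thesis
        using True tj by (simp only: E_J torus_map_def restrict_apply lessThan_iff if_True cis_Arg circ_pt_circ_val)
    next
      case False
      then show ?thesis using that by (auto simp: E_J torus_map_def topspace_torus PiE_iff extensional_def)
    qed
  qed
  let ?C = "product_topology (\<lambda>_. top_of_set {0..1::real}) {..<k}"
  let ?q = "torus_map k (\<lambda>i a. cis (2 * pi * a i))"
  have coord: "continuous_map ?C euclideanreal (\<lambda>a. a i)" if "i < k" for i
    using continuous_map_product_projection[of i "{..<k}" "\<lambda>_. top_of_set {0..1::real}"] that
    by (auto intro: continuous_map_into_fulltopology)
  have "quotient_map ?C (torus k) ?q"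
  proof (rule T1_Spaces.continuous_imp_quotient_map)
    show cq: "continuous_map ?C (torus k) ?q"
      by (intro continuous_map_torus_map circle_map_cis continuous_map_real_mult coord) auto
    show "compact_space ?C" by (auto simp: compact_space_product_topology compact_space_subtopology)
    show "Hausdorff_space (torus k)"
      using Hausdorff_Euclidean_space
      by (simp add: torus_circle circle_def Hausdorff_space_product_topology nsphere_def Hausdorff_space_subtopology)
    show "?q ` topspace ?C = topspace (torus k)"
    proof
      show "?q ` topspace ?C \<subseteq> topspace (torus k)" using continuous_map_image_subset_topspace[OF cq] .
      show "topspace (torus k) \<subseteq> ?q ` topspace ?C"
      proof
        fix t assume t: "t \<in> topspace (torus k)"
        let ?a = "\<lambda>i\<in>{..<k}. Arg2pi (circ_val (t i)) / (2 * pi)"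
        have "?a \<in> topspace ?C"
          using Arg2pi_ge_0 Arg2pi_lt_2pi by (auto simp: less_imp_le)
        moreover have "t = ?q ?a"
          using t_eq[OF t] unfolding E_J by (simp add: torus_map_def cong: restrict_cong)
        ultimately show "t \<in> ?q ` topspace ?C" by blast
      qed
    qed
  qed
  moreover have "continuous_map ?C euclideanreal (h \<circ> ?q)"
  proof (rule continuous_map_eq)
    have "continuous_map ?C euclidean J"
      unfolding J_def
      by (intro continuous_map_sum continuous_map_compose_on[of _ _ "\<lambda>r. r *\<^sub>R _"] coord)
        (auto intro: continuous_intros)
    from continuous_map_compose_on[OF this h0] show "continuous_map ?C euclideanreal (\<lambda>a. h0 (J a))" .
    fix a
    show "h0 (J a) = (h \<circ> ?q) a"
      unfolding h_def o_def by (rule h0_J) (simp only: torus_map_def restrict_apply lessThan_iff if_True circ_val_circ_pt cis_Arg norm_cis)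
  qed
  ultimately have "continuous_map (torus k) euclideanreal h"
    using continuous_compose_quotient_map_eq by blast
  moreover have "u t = (\<Prod>i<k. circ_val (t i) powi m i) * cis (h t)" if t: "t \<in> topspace (torus k)" for t
  proof -
    let ?a = "\<lambda>i. Arg2pi (circ_val (t i)) / (2 * pi)"
    have "u t = cis (\<gamma> (J ?a))" using uE[of "J ?a"] t_eq[OF t] by simp
    also have "\<gamma> (J ?a) = (\<Sum>i<k. of_int (m i) * (2 * pi * ?a i)) + h t"
      unfolding h_def h0_def by (simp add: J mult.commute mult.left_commute)
    also have "cis \<dots> = (\<Prod>i<k. cis (2 * pi * ?a i) powi m i) * cis (h t)"
      by (simp only: cis_mult[symmetric] cis_sum cis_power_int)
    also have "(\<Prod>i<k. cis (2 * pi * ?a i) powi m i) = (\<Prod>i<k. circ_val (t i) powi m i)"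
    proof (rule prod.cong)
      fix i assume "i \<in> {..<k}"
      then have "norm (circ_val (t i)) = 1"
        using t by (auto simp: topspace_torus in_topspace_circle[symmetric] PiE_iff) (auto simp: in_topspace_circle)
      then show "cis (2 * pi * ?a i) powi m i = circ_val (t i) powi m i" by (simp only: cis_Arg)
    qed simp
    finally show ?thesis .
  qed
  ultimately show ?thesis using that by blast
qed

section \<open>Coordinate loops and additivity of periods\<close>

definition circle_gen :: "(nat \<Rightarrow> real) chain set" where
  "circle_gen = (SOME \<gamma>. \<gamma> \<in> carrier (H1 circle) \<and> circle_class \<gamma> = 1)"

lemma circle_gen: "circle_gen \<in> carrier (H1 circle)" "circle_class circle_gen = 1"
proof -
  have "\<exists>\<gamma>. \<gamma> \<in> carrier (H1 circle) \<and> circle_class \<gamma> = 1"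
  proof -
    have "circle_class ` carrier (H1 circle) = UNIV"
      using circle_class_iso by (simp add: iso_def bij_betw_def)
    then have "1 \<in> circle_class ` carrier (H1 circle)" by simp
    then show ?thesis by force
  qed
  from someI_ex[OF this] show "circle_gen \<in> carrier (H1 circle)" "circle_class circle_gen = 1"
    unfolding circle_gen_def by auto
qed

lemma circle_map_circ_val_id: "circle_map circle circ_val"
  using circle_map_circ_val[of circle id] by simp

lemma period_circ_val: "period circle circ_val circle_gen = 1"
  unfolding period_def
  using circle_gen by (subst hom_induced_id_gen) (auto simp: circ_pt_circ_val circle_map_circ_pt circle_map_circ_val_id)

text \<open>The coordinate circle in direction \<open>j\<close> through the point whose coordinates
  are all 1; for \<open>j\<close> not below \<open>k\<close> it is the constant loop at this
  point.\<close>

definition axis_loop :: "nat \<Rightarrow> nat \<Rightarrow> (nat \<Rightarrow> real) \<Rightarrow> nat \<Rightarrow> nat \<Rightarrow> real" where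
  "axis_loop k j = torus_map k (\<lambda>i x. if i = j then circ_val x else 1)"

definition torus_loop :: "nat \<Rightarrow> nat \<Rightarrow> (nat \<Rightarrow> nat \<Rightarrow> real) chain set" where
  "torus_loop k j = H1_map circle (torus k) (axis_loop k j) circle_gen"

abbreviation coord :: "nat \<Rightarrow> (nat \<Rightarrow> nat \<Rightarrow> real) \<Rightarrow> complex" where
  "coord i \<equiv> \<lambda>t. circ_val (t i)"

lemma torus_loop_closed [simp]: "torus_loop k j \<in> carrier (H1 (torus k))"
  by (simp add: torus_loop_def)

lemma coord_torus_map: "i < k \<Longrightarrow> circ_val (torus_map k u x i) = u i x"
  by (simp add: torus_map_def)

lemma continuous_map_axis_loop: "continuous_map circle (torus k) (axis_loop k j)"
  unfolding axis_loop_def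
proof (rule continuous_map_torus_map)
  show "circle_map circle (\<lambda>x. if i = j then circ_val x else 1)" for i
    using circle_map_circ_val_id circle_map_const[of 1 circle] by (cases "i = j") simp_all
qed

lemma period_torus_loop:
  assumes "circle_map (torus k) u"
  shows "period (torus k) u (torus_loop k j) = period circle (\<lambda>x. u (axis_loop k j x)) circle_gen"
  unfolding torus_loop_def by (rule period_compose[OF assms continuous_map_axis_loop, symmetric])

lemma period_coord_loop:
  assumes "i < k"
  shows "period (torus k) (coord i) (torus_loop k j) = (if i = j then 1 else 0)"
  unfolding period_torus_loop[OF circle_map_coord[OF assms]] axis_loop_def coord_torus_map[OF assms]
  by (auto simp: period_circ_val period_const)

text \<open>Coordinate functions are dual to the axis loops. Hence the integral matrix of their
  periods on \<open>f\<close> inverts the matrix that expresses the loops through \<open>f\<close>,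
  and the loops are obtained from a basis by an element of GL_k(Z).\<close>

lemma int_basis_torus_loop:
  assumes B: "int_basis (H1 (torus k)) k f"
  shows "int_basis (H1 (torus k)) k (torus_loop k)"
proof -
  interpret comm_group "H1 (torus k)" by simp
  note f = int_basis_closed[OF B]
  obtain M where M: "\<And>j. j < k \<Longrightarrow> torus_loop k j = lin_comb (H1 (torus k)) f k (\<lambda>i. M i j)"
    using int_basis_coords[OF B, of k "torus_loop k"] by auto
  define N where "N i l = period (torus k) (coord i) (f l)" for i l
  have NM: "(\<Sum>l<k. N i l * M l j) = (if i = j then 1 else 0)" if "i < k" "j < k" for i j
  proof -
    have "period (torus k) (coord i) (torus_loop k j) = (\<Sum>l<k. N i l * M l j)"
      unfolding N_def M[OF that(2)] using f by (intro int_valued_lin_comb period_mult)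
    then show ?thesis using period_coord_loop[OF that(1)] by simp
  qed
  have "int_basis (H1 (torus k)) k (\<lambda>j. lin_comb (H1 (torus k)) f k (\<lambda>i. M i j))"
    using B int_mat_inverse_commute[OF NM] NM by (rule int_basis_transform)
  then show ?thesis by (rule int_basis_cong) (simp add: M)
qed

text \<open>That $H_1(T^k)$ has a basis with \<open>k\<close> elements is part of the hypotheses of the theorem.
  Together with the coordinate projections it makes the axis loops a basis, so that the Kuenneth
  formula is not needed.\<close>

locale torus_basis =
  fixes k :: nat and f :: "nat \<Rightarrow> (nat \<Rightarrow> nat \<Rightarrow> real) chain set"
  assumes two_le: "2 \<le> k" and basis: "int_basis (H1 (torus k)) k f"
begin

sublocale comm_group "H1 (torus k)" by simp

text \<open>Pairing with the coordinate functions, which are dual to the loops, reads off the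
  coefficients.\<close>

lemma torus_class_expand:
  assumes x: "x \<in> carrier (H1 (torus k))"
  shows "x = lin_comb (H1 (torus k)) (torus_loop k) k (\<lambda>j. period (torus k) (coord j) x)"
proof -
  obtain c where c: "x = lin_comb (H1 (torus k)) (torus_loop k) k c"
    by (rule int_basis_exists[OF int_basis_torus_loop[OF basis] x])
  have "period (torus k) (coord i) x = c i" if "i < k" for i
  proof -
    have "period (torus k) (coord i) x = (\<Sum>j<k. period (torus k) (coord i) (torus_loop k j) * c j)"
      unfolding c by (intro int_valued_lin_comb period_mult) auto
    also have "\<dots> = (\<Sum>j<k. if i = j then c j else 0)"
      using that by (intro sum.cong) (auto simp: period_coord_loop)
    finally show ?thesis using that by simp
  qed
  then show ?thesis by (intro trans[OF c] lin_comb_cong) auto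
qed

lemma torus_class_eqI:
  assumes "x \<in> carrier (H1 (torus k))" "y \<in> carrier (H1 (torus k))"
    and "\<And>i. i < k \<Longrightarrow> period (torus k) (coord i) x = period (torus k) (coord i) y"
  shows "x = y"
  by (rule trans[OF torus_class_expand[OF assms(1)] trans[OF _ torus_class_expand[OF assms(2), symmetric]]],
      rule lin_comb_cong) (simp_all add: assms(3))

lemma period_expand:
  assumes "x \<in> carrier (H1 (torus k))"
  shows "period (torus k) u x = (\<Sum>j<k. period (torus k) u (torus_loop k j) * period (torus k) (coord j) x)"
  by (subst torus_class_expand[OF assms], intro int_valued_lin_comb period_mult) auto

text \<open>Multiplication of circle-valued maps factors through the product of two coordinates of the
  torus, where additivity is checked on the axes.\<close>

lemma period_times:
  assumes u: "circle_map X u" and v: "circle_map X v" and x: "x \<in> carrier (H1 X)"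
  shows "period X (\<lambda>x. u x * v x) x = period X u x + period X v x"
proof -
  define g where "g = torus_map k (\<lambda>i. if i = 0 then u else if i = 1 then v else (\<lambda>_. 1))"
  have g: "continuous_map X (torus k) g"
    unfolding g_def using u v by (intro continuous_map_torus_map) (auto intro: circle_map_const)
  have g0: "coord 0 (g x) = u x" and g1: "coord 1 (g x) = v x" for x
    using two_le by (auto simp: g_def coord_torus_map)
  define \<mu> where "\<mu> = (\<lambda>t :: nat \<Rightarrow> nat \<Rightarrow> real. coord 0 t * coord 1 t)"
  have \<mu>: "circle_map (torus k) \<mu>"
    unfolding \<mu>_def using two_le by (intro circle_map_mult circle_map_coord) auto
  \<comment> \<open>Along an axis at most one of the two factors moves while the other is 1, so the
    product restricts to the identity of the circle or to a constant.\<close>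
  have loop: "period (torus k) \<mu> (torus_loop k j) = (if j = 0 \<or> j = 1 then 1 else 0)" for j
  proof -
    have "(\<lambda>x. \<mu> (axis_loop k j x)) = (if j = 0 \<or> j = 1 then circ_val else (\<lambda>_. 1))"
      using two_le by (auto simp: \<mu>_def axis_loop_def coord_torus_map)
    then show ?thesis
      unfolding period_torus_loop[OF \<mu>] by (simp add: period_circ_val period_const)
  qed
  have "period X (\<lambda>x. u x * v x) x = period (torus k) \<mu> (H1_map X (torus k) g x)"
    using period_compose[OF \<mu> g, of x] unfolding \<mu>_def g0 g1 .
  also have "\<dots> = (\<Sum>j<k. (if j = 0 \<or> j = 1 then 1 else 0) * period (torus k) (coord j) (H1_map X (torus k) g x))"
    by (subst period_expand) (simp_all add: loop)
  also have "\<dots> = (\<Sum>j\<in>{0, 1}. period (torus k) (coord j) (H1_map X (torus k) g x))"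
    using two_le by (intro sum.mono_neutral_cong_right) auto
  also have "\<dots> = period X (\<lambda>x. coord 0 (g x)) x + period X (\<lambda>x. coord 1 (g x)) x"
    using two_le period_compose[OF circle_map_coord g, of 0 x] period_compose[OF circle_map_coord g, of 1 x]
    by simp
  finally show ?thesis by (simp only: g0 g1)
qed

lemma period_inverse:
  assumes u: "circle_map X u" and x: "x \<in> carrier (H1 X)"
  shows "period X (\<lambda>x. inverse (u x)) x = - period X u x"
proof -
  have "period X (\<lambda>x. u x * inverse (u x)) = period X (\<lambda>x. 1)"
    using u by (intro period_cong) (auto simp: circle_map_def intro!: right_inverse)
  then show ?thesis
    using period_times[OF u circle_map_inverse[OF u] x] period_const[of 1 X x] by simp
qed

lemma period_powi:
  assumes u: "circle_map X u" and x: "x \<in> carrier (H1 X)"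
  shows "period X (\<lambda>x. u x powi m) x = m * period X u x"
proof -
  have pow: "circle_map X v \<Longrightarrow> circle_map X (\<lambda>x. v x ^ n) \<and> period X (\<lambda>x. v x ^ n) x = n * period X v x" for v n
    using x by (induction n) (auto simp: period_const period_times circle_map_const circle_map_mult algebra_simps)
  show ?thesis
    using pow[OF u] pow[OF circle_map_inverse[OF u]] period_inverse[OF u x]
    by (cases "0 \<le> m") (auto simp: power_int_def)
qed

lemma period_prod:
  fixes n :: nat
  assumes u: "\<And>i. i < n \<Longrightarrow> circle_map X (u i)" and x: "x \<in> carrier (H1 X)"
  shows "period X (\<lambda>x. \<Prod>i<n. u i x) x = (\<Sum>i<n. period X (u i) x)"
  using u
proof (induction n)
  case 0
  then show ?case by (simp add: period_const)
next
  case (Suc n)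
  then have "circle_map X (\<lambda>x. \<Prod>i<n. u i x)" by (intro circle_map_prod) auto
  then show ?case using Suc x by (simp add: period_times)
qed

lemma period_monomial:
  assumes "x \<in> carrier (H1 (torus k))"
  shows "period (torus k) (\<lambda>t. \<Prod>j<k. coord j t powi m j) x = (\<Sum>j<k. m j * period (torus k) (coord j) x)"
  by (subst period_prod) (auto simp: assms period_powi circle_map_coord intro: circle_map_powi)

text \<open>The lifting result is applied to the quotient v / u. The exponents of its monomial are
  its periods along the axis loops, which vanish by additivity, so \<open>v\<close> is
  \<open>u\<close> times the exponential of a real function and this function can be scaled
  away.\<close>

lemma homotopic_circle_mapI:
  assumes u: "circle_map (torus k) u" and v: "circle_map (torus k) v"
    and eq: "\<And>j. j < k \<Longrightarrow> period (torus k) u (torus_loop k j) = period (torus k) v (torus_loop k j)"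
  shows "homotopic_with (\<lambda>_. True) (torus k) circle (\<lambda>t. circ_pt (u t)) (\<lambda>t. circ_pt (v t))"
proof -
  let ?w = "\<lambda>t. v t * inverse (u t)"
  have w: "circle_map (torus k) ?w" using u v by (intro circle_map_mult circle_map_inverse)
  obtain m h where h: "continuous_map (torus k) euclideanreal h"
    and wh: "\<And>t. t \<in> topspace (torus k) \<Longrightarrow> ?w t = (\<Prod>i<k. coord i t powi m i) * cis (h t)"
    using circle_map_torus_lift[OF w] by blast
  have m0: "m j = 0" if j: "j < k" for j
  proof -
    have "0 = period (torus k) ?w (torus_loop k j)"
      using eq[OF j] by (simp add: period_times[OF v circle_map_inverse[OF u]] period_inverse[OF u])
    also have "\<dots> = period (torus k) (\<lambda>t. (\<Prod>i<k. coord i t powi m i) * cis (h t)) (torus_loop k j)"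
      by (rule fun_cong[OF period_cong]) (rule wh)
    also have "\<dots> = period (torus k) (\<lambda>t. \<Prod>i<k. coord i t powi m i) (torus_loop k j)"
      by (subst period_mult_cis[OF _ h]) (auto intro!: circle_map_prod circle_map_powi circle_map_coord)
    also have "\<dots> = (\<Sum>i<k. if i = j then m i else 0)"
      unfolding period_monomial[OF torus_loop_closed] by (intro sum.cong) (auto simp: period_coord_loop)
    finally show ?thesis using j by simp
  qed
  have veq: "u t * cis (h t) = v t" if t: "t \<in> topspace (torus k)" for t
  proof -
    have "u t \<noteq> 0" using u t by (auto simp: circle_map_def)
    moreover have "v t * inverse (u t) = cis (h t)" using wh[OF t] m0 by simp
    ultimately show ?thesis by (simp add: field_simps)
  qed
  show ?thesis
    by (rule homotopic_with_eq[OF homotopic_circle_map_cis[OF u h]]) (auto simp: veq)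
qed

end

section \<open>Maps between tori and their action on homology\<close>

lemma prod_power_int_distrib:
  fixes g :: "nat \<Rightarrow> 'a :: field"
  shows "(\<Prod>i<k. g i) powi n = (\<Prod>i<k. g i powi n)"
  by (induction k) (simp_all add: power_int_mult_distrib)

lemma power_int_sum:
  fixes x :: "'a :: field" and c :: "nat \<Rightarrow> int"
  assumes "x \<noteq> 0"
  shows "x powi (\<Sum>i<k. c i) = (\<Prod>i<k. x powi c i)"
  by (induction k) (simp_all add: power_int_add assms)

text \<open>A property of the target space that passes to products and along homeomorphisms, so that
  for a boundary torus it comes down to the circle. The homotopies are free, as in condition
  (3).\<close>

definition H1_detects :: "nat \<Rightarrow> 'a topology \<Rightarrow> bool" where
  "H1_detects k Y \<longleftrightarrow> (\<forall>F G. continuous_map (torus k) Y F \<longrightarrow> continuous_map (torus k) Y G \<longrightarrow>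
     (\<forall>x\<in>carrier (H1 (torus k)). H1_map (torus k) Y F x = H1_map (torus k) Y G x) \<longrightarrow>
     homotopic_with (\<lambda>_. True) (torus k) Y F G)"

lemma H1_detectsD:
  assumes Y: "H1_detects k Y" and F: "continuous_map (torus k) Z F" and G: "continuous_map (torus k) Z G"
    and p: "continuous_map Z Y p"
    and eq: "\<And>x. x \<in> carrier (H1 (torus k)) \<Longrightarrow> H1_map (torus k) Z F x = H1_map (torus k) Z G x"
  shows "homotopic_with (\<lambda>_. True) (torus k) Y (p \<circ> F) (p \<circ> G)"
proof -
  have "H1_map (torus k) Y (p \<circ> F) x = H1_map (torus k) Y (p \<circ> G) x" if "x \<in> carrier (H1 (torus k))" for x
    using eq[OF that] hom_induced_compose_empty[OF F p, of 1] hom_induced_compose_empty[OF G p, of 1] by simp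
  then show ?thesis
    using Y continuous_map_compose[OF F p] continuous_map_compose[OF G p] unfolding H1_detects_def by blast
qed

text \<open>The definition of \<open>homotopic_with\<close> fixes the two ends at all points of the
  type. Agreement on the space is the usable condition for products, where the assembled homotopy
  has extensional values and the given maps need not have them off the space.\<close>

lemma homotopic_with_TrueI:
  assumes "continuous_map (prod_topology (top_of_set {0..1::real}) X) Y h"
    "\<And>x. x \<in> topspace X \<Longrightarrow> h (0, x) = F x" "\<And>x. x \<in> topspace X \<Longrightarrow> h (1, x) = G x"
  shows "homotopic_with (\<lambda>_. True) X Y F G"
  using assms by (subst homotopic_with) auto

lemma H1_detects_product:
  assumes "\<And>i. i \<in> I \<Longrightarrow> H1_detects k (Y i)"
  shows "H1_detects k (product_topology Y I)"
  unfolding H1_detects_def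
proof (intro allI impI)
  fix F G
  assume F: "continuous_map (torus k) (product_topology Y I) F"
    and G: "continuous_map (torus k) (product_topology Y I) G"
    and eq: "\<forall>x\<in>carrier (H1 (torus k)).
      H1_map (torus k) (product_topology Y I) F x = H1_map (torus k) (product_topology Y I) G x"
  have "\<exists>h. continuous_map (prod_topology (top_of_set {0..1::real}) (torus k)) (Y i) h \<and>
      (\<forall>x. h (0, x) = F x i) \<and> (\<forall>x. h (1, x) = G x i)" if i: "i \<in> I" for i
  proof -
    have "homotopic_with (\<lambda>_. True) (torus k) (Y i) ((\<lambda>y. y i) \<circ> F) ((\<lambda>y. y i) \<circ> G)"
      using assms[OF i] F G continuous_map_product_projection[OF i] by (rule H1_detectsD) (use eq in blast)
    then show ?thesis unfolding homotopic_with_def by auto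
  qed
  then obtain h where h: "\<And>i. i \<in> I \<Longrightarrow> continuous_map (prod_topology (top_of_set {0..1::real}) (torus k)) (Y i) (h i)"
    and h01: "\<And>i x. i \<in> I \<Longrightarrow> h i (0, x) = F x i" "\<And>i x. i \<in> I \<Longrightarrow> h i (1, x) = G x i"
    by metis
  have ext: "F x \<in> extensional I" "G x \<in> extensional I" if "x \<in> topspace (torus k)" for x
    using continuous_map_image_subset_topspace[OF F] continuous_map_image_subset_topspace[OF G] that
    by (auto simp: PiE_def)
  show "homotopic_with (\<lambda>_. True) (torus k) (product_topology Y I) F G"
  proof (rule homotopic_with_TrueI)
    show "continuous_map (prod_topology (top_of_set {0..1::real}) (torus k)) (product_topology Y I) (\<lambda>z. \<lambda>i\<in>I. h i z)"
      using h by (auto simp: continuous_map_componentwise)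
    show "(\<lambda>i\<in>I. h i (0, x)) = F x" if "x \<in> topspace (torus k)" for x
      using ext[OF that] by (auto simp: h01 extensional_def fun_eq_iff)
    show "(\<lambda>i\<in>I. h i (1, x)) = G x" if "x \<in> topspace (torus k)" for x
      using ext[OF that] by (auto simp: h01 extensional_def fun_eq_iff)
  qed
qed

lemma H1_detects_prod:
  assumes Y: "H1_detects k Y" and Z: "H1_detects k Z"
  shows "H1_detects k (prod_topology Y Z)"
  unfolding H1_detects_def
proof (intro allI impI)
  fix F G
  assume F: "continuous_map (torus k) (prod_topology Y Z) F"
    and G: "continuous_map (torus k) (prod_topology Y Z) G"
    and eq: "\<forall>x\<in>carrier (H1 (torus k)).
      H1_map (torus k) (prod_topology Y Z) F x = H1_map (torus k) (prod_topology Y Z) G x"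
  have "homotopic_with (\<lambda>_. True) (torus k) Y (fst \<circ> F) (fst \<circ> G)"
    using Y F G continuous_map_fst by (rule H1_detectsD) (use eq in blast)
  then obtain h where h: "continuous_map (prod_topology (top_of_set {0..1::real}) (torus k)) Y h"
    "\<And>x. h (0, x) = (fst \<circ> F) x" "\<And>x. h (1, x) = (fst \<circ> G) x" unfolding homotopic_with_def by blast
  have "homotopic_with (\<lambda>_. True) (torus k) Z (snd \<circ> F) (snd \<circ> G)"
    using Z F G continuous_map_snd by (rule H1_detectsD) (use eq in blast)
  then obtain h' where h': "continuous_map (prod_topology (top_of_set {0..1::real}) (torus k)) Z h'"
    "\<And>x. h' (0, x) = (snd \<circ> F) x" "\<And>x. h' (1, x) = (snd \<circ> G) x" unfolding homotopic_with_def by blast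
  show "homotopic_with (\<lambda>_. True) (torus k) (prod_topology Y Z) F G"
    by (rule homotopic_with_TrueI[OF continuous_map_pairedI[OF h(1) h'(1)]]) (simp_all add: h h')
qed

lemma H1_detects_homeomorphic:
  assumes "Y homeomorphic_space Z" and Z: "H1_detects k Z"
  shows "H1_detects k Y"
  unfolding H1_detects_def
proof (intro allI impI)
  fix F G
  assume F: "continuous_map (torus k) Y F" and G: "continuous_map (torus k) Y G"
    and eq: "\<forall>x\<in>carrier (H1 (torus k)). H1_map (torus k) Y F x = H1_map (torus k) Y G x"
  obtain p q where pq: "homeomorphic_maps Y Z p q" using assms(1) unfolding homeomorphic_space_def by blast
  have p: "continuous_map Y Z p" and q: "continuous_map Z Y q" and qp: "\<And>y. y \<in> topspace Y \<Longrightarrow> q (p y) = y"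
    using pq by (auto simp: homeomorphic_maps_def)
  have "homotopic_with (\<lambda>_. True) (torus k) Z (p \<circ> F) (p \<circ> G)"
    using Z F G p by (rule H1_detectsD) (use eq in blast)
  then have "homotopic_with (\<lambda>_. True) (torus k) Y (q \<circ> (p \<circ> F)) (q \<circ> (p \<circ> G))"
    by (rule homotopic_with_compose_continuous_map_left) (use q in auto)
  then show "homotopic_with (\<lambda>_. True) (torus k) Y F G"
  proof (rule homotopic_with_eq)
    fix x assume "x \<in> topspace (torus k)"
    then show "F x = (q \<circ> (p \<circ> F)) x" "G x = (q \<circ> (p \<circ> G)) x"
      using continuous_map_image_subset_topspace[OF F] continuous_map_image_subset_topspace[OF G] by (auto simp: qp)
  qed auto
qed

section \<open>Homotopy classes of maps of tori and homeomorphisms realizing a change of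
  basis\<close>

context torus_basis
begin

lemma H1_detects_circle: "H1_detects k circle"
  unfolding H1_detects_def
proof (intro allI impI)
  fix F G
  assume F: "continuous_map (torus k) circle F" and G: "continuous_map (torus k) circle G"
    and eq: "\<forall>x\<in>carrier (H1 (torus k)). H1_map (torus k) circle F x = H1_map (torus k) circle G x"
  have val: "circ_pt (circ_val (g t)) = g t"
    if "continuous_map (torus k) circle g" "t \<in> topspace (torus k)" for g t
    using continuous_map_image_subset_topspace[OF that(1)] that(2) by (auto intro: circ_pt_circ_val)
  have period: "period (torus k) (\<lambda>t. circ_val (g t)) x = circle_class (H1_map (torus k) circle g x)"
    if "continuous_map (torus k) circle g" for g x
    unfolding period_def by (subst hom_induced_eq[OF val[OF that]]) auto
  have "homotopic_with (\<lambda>_. True) (torus k) circle (\<lambda>t. circ_pt (circ_val (F t))) (\<lambda>t. circ_pt (circ_val (G t)))"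
    using eq by (intro homotopic_circle_mapI circle_map_circ_val F G) (simp add: period F G)
  then show "homotopic_with (\<lambda>_. True) (torus k) circle F G"
    by (rule homotopic_with_eq) (simp_all add: val F G)
qed

lemma H1_detects_torus: "H1_detects k (torus m)"
  unfolding torus_circle by (intro H1_detects_product H1_detects_circle)

text \<open>GL_k(Z) acts on the torus by monomial maps. The exponent matrix \<open>D\<close> has the
  coordinates of \<open>y l\<close> in the axis loops as its column \<open>l\<close>; it is
  invertible over the integers since \<open>y\<close> is a basis, and the periods of the coordinates
  of the monomial map along the loops are its entries.\<close>

lemma homeomorphism_onto_basis:
  assumes y: "int_basis (H1 (torus k)) k y"
  obtains h where "homeomorphic_map (torus k) (torus k) h"
    "\<And>l. l < k \<Longrightarrow> H1_map (torus k) (torus k) h (torus_loop k l) = y l"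
proof -
  define D where "D i l = period (torus k) (coord i) (y l)" for i l
  note y_closed = int_basis_closed[OF y]
  have yD: "y l = lin_comb (H1 (torus k)) (torus_loop k) k (\<lambda>i. D i l)" if "l < k" for l
    unfolding D_def using y_closed[OF that] by (rule torus_class_expand)
  obtain D' where D': "\<And>j. j < k \<Longrightarrow> torus_loop k j = lin_comb (H1 (torus k)) y k (\<lambda>i. D' i j)"
    using int_basis_coords[OF y, of k "torus_loop k"] by auto
  have DD': "(\<Sum>l<k. D i l * D' l j) = (if i = j then 1 else 0)" if "i < k" "j < k" for i j
    using int_basis_torus_loop[OF basis] y_closed yD D' that by (rule int_basis_change_inverse)
  note D'D = int_mat_inverse_commute[OF DD']
  define mono where "mono A = torus_map k (\<lambda>i t. \<Prod>j<k. coord j t powi A i j)" for A :: "nat \<Rightarrow> nat \<Rightarrow> int"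
  have mono: "continuous_map (torus k) (torus k) (mono A)" for A
    unfolding mono_def by (intro continuous_map_torus_map circle_map_prod circle_map_powi circle_map_coord) auto
  \<comment> \<open>Composing monomial maps multiplies their exponent matrices. The coordinates are
    nonzero, so the exponent laws hold for negative exponents too.\<close>
  have inv: "mono A (mono B t) = t" if AB: "\<And>i j. i < k \<Longrightarrow> j < k \<Longrightarrow> (\<Sum>l<k. A i l * B l j) = (if i = j then 1 else 0)"
    and t: "t \<in> topspace (torus k)" for A B t
  proof
    fix i
    show "mono A (mono B t) i = t i"
    proof (cases "i < k")
      case True
      have ti: "t j \<in> topspace circle" if "j < k" for j using t that by (auto simp: topspace_torus)
      then have nz: "coord j t \<noteq> 0" if "j < k" for j using that by (fastforce simp: in_topspace_circle)
      have "(\<Prod>l<k. coord l (mono B t) powi A i l) = (\<Prod>l<k. \<Prod>j<k. coord j t powi (A i l * B l j))"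
        by (intro prod.cong refl)
          (simp add: mono_def coord_torus_map prod_power_int_distrib power_int_mult[symmetric] mult.commute)
      also have "\<dots> = (\<Prod>j<k. \<Prod>l<k. coord j t powi (A i l * B l j))" by (rule prod.swap)
      also have "\<dots> = (\<Prod>j<k. coord j t powi (\<Sum>l<k. A i l * B l j))"
        by (intro prod.cong refl) (simp add: power_int_sum nz)
      also have "\<dots> = (\<Prod>j<k. if i = j then coord j t else 1)"
        using AB True by (intro prod.cong) auto
      also have "\<dots> = coord i t" using True by simp
      finally have "circ_pt (\<Prod>l<k. coord l (mono B t) powi A i l) = t i"
        using ti[OF True] by (simp add: circ_pt_circ_val)
      then show ?thesis using True by (simp add: mono_def[of A] torus_map_def)
    next
      case False
      then show ?thesis using t by (auto simp: mono_def torus_map_def topspace_torus PiE_iff extensional_def)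
    qed
  qed
  have hom: "homeomorphic_map (torus k) (torus k) (mono D)"
    unfolding homeomorphic_map_maps homeomorphic_maps_def
    using mono inv[OF DD'] inv[OF D'D] by blast
  have "H1_map (torus k) (torus k) (mono D) (torus_loop k l) = y l" if l: "l < k" for l
  proof (rule torus_class_eqI)
    fix i assume i: "i < k"
    have "period (torus k) (coord i) (H1_map (torus k) (torus k) (mono D) (torus_loop k l)) =
        period (torus k) (\<lambda>t. coord i (mono D t)) (torus_loop k l)"
      by (rule period_compose[OF circle_map_coord[OF i] mono, symmetric])
    also have "\<dots> = (\<Sum>j<k. D i j * period (torus k) (coord j) (torus_loop k l))"
      unfolding mono_def coord_torus_map[OF i] by (rule period_monomial) simp
    also have "\<dots> = (\<Sum>j<k. if j = l then D i j else 0)"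
      by (intro sum.cong) (auto simp: period_coord_loop)
    also have "\<dots> = period (torus k) (coord i) (y l)" using l by (simp add: D_def)
    finally show "period (torus k) (coord i) (H1_map (torus k) (torus k) (mono D) (torus_loop k l)) =
        period (torus k) (coord i) (y l)" .
  qed (use l y_closed in auto)
  with hom show ?thesis using that by blast
qed

text \<open>Both bases are reached from the axis loops, so the inverse of one homeomorphism followed
  by the other does it.\<close>

lemma homeomorphism_between_bases:
  assumes y: "int_basis (H1 (torus k)) k y"
  obtains h where "homeomorphic_map (torus k) (torus k) h"
    "\<And>l. l < k \<Longrightarrow> H1_map (torus k) (torus k) h (f l) = y l"
proof -
  obtain p where p: "homeomorphic_map (torus k) (torus k) p"
    "\<And>l. l < k \<Longrightarrow> H1_map (torus k) (torus k) p (torus_loop k l) = f l"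
    using homeomorphism_onto_basis[OF basis] by blast
  obtain q where q: "homeomorphic_map (torus k) (torus k) q"
    "\<And>l. l < k \<Longrightarrow> H1_map (torus k) (torus k) q (torus_loop k l) = y l"
    using homeomorphism_onto_basis[OF y] by blast
  obtain p' where pp': "homeomorphic_maps (torus k) (torus k) p p'"
    using p(1) unfolding homeomorphic_map_maps by blast
  then have p': "homeomorphic_map (torus k) (torus k) p'"
    using homeomorphic_map_maps homeomorphic_maps_sym by blast
  have cont: "continuous_map (torus k) (torus k) p" "continuous_map (torus k) (torus k) p'"
      "continuous_map (torus k) (torus k) q"
    using p(1) p' q(1) by (auto dest: homeomorphic_imp_continuous_map)
  have "H1_map (torus k) (torus k) p' (f l) = torus_loop k l" if "l < k" for l
  proof -
    have "H1_map (torus k) (torus k) p' (f l) = H1_map (torus k) (torus k) (p' \<circ> p) (torus_loop k l)"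
      using hom_induced_compose_empty[OF cont(1,2), of 1] p(2)[OF that] by (metis o_apply)
    also have "\<dots> = torus_loop k l"
      using pp' by (intro hom_induced_id_gen continuous_map_compose[OF cont(1,2)])
        (auto simp: homeomorphic_maps_def)
    finally show ?thesis .
  qed
  then have "H1_map (torus k) (torus k) (q \<circ> p') (f l) = y l" if "l < k" for l
    using hom_induced_compose_empty[OF cont(2,3), of 1] q(2)[OF that] that by simp
  moreover have "homeomorphic_map (torus k) (torus k) (q \<circ> p')"
    using p' q(1) by (rule homeomorphic_map_compose)
  ultimately show ?thesis using that by blast
qed

end

section \<open>Gluing matrices\<close>

locale graph_manifold =
  fixes n :: nat and M :: "('v, 'w, 's, 'x, 'm) graph_mfd"
  assumes n: "n > 3" and ggm: "generalized_graph_manifold n M"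
begin

abbreviation m :: nat where "m \<equiv> n - 2"

lemma n_minus_1: "n - 1 = Suc m" using n by simp

lemma finite_sets: "finite (verts M)" "finite (tori M)"
  using ggm by (auto simp: generalized_graph_manifold_def)

lemma glue_set_tori: "w \<in> glue_set n M \<Longrightarrow> w \<in> tori M"
  by (simp add: glue_set_def)

lemma finite_glue_set: "finite (glue_set n M)"
  using finite_sets(2) glue_set_tori by (meson finite_subset subsetI)

lemma block_of_verts: "w \<in> tori M \<Longrightarrow> block_of M w \<in> verts M"
  using ggm by (auto simp: generalized_graph_manifold_def)

lemma glue_setD:
  assumes "w \<in> glue_set n M"
  shows "neg M w \<in> glue_set n M"
    and "homeomorphic_map (bd_top n M w) (bd_top n M (neg M w)) (glue M w)"
    and "\<And>h. homeomorphic_map (torus m) (torus m) h \<Longrightarrow>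
      \<not> homotopic_with (\<lambda>_. True) (torus m) (bd_top n M (neg M w))
        (glue M w \<circ> fiber_incl M w) (fiber_incl M (neg M w) \<circ> h)"
  using ggm assms by (auto simp: generalized_graph_manifold_def diffeo_between_def bd_top_def)

lemma glue_set_blocks:
  assumes "w \<in> glue_set n M"
  shows "block_of M w \<in> verts M" "block_of M (neg M w) \<in> verts M"
  using block_of_verts[OF glue_set_tori[OF assms]] block_of_verts[OF glue_set_tori[OF glue_setD(1)[OF assms]]] .

lemma vertsD:
  assumes "v \<in> verts M"
  shows "bij_betw (circ M) (bd M v) (connected_components_of
      (subtopology (surf M v) (manifold_boundary 2 (surf M v))))"
    and "\<And>w. w \<in> bd M v \<Longrightarrow> subtopology (surf M v) (circ M w) homeomorphic_space nsphere 1"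
    and "homeomorphic_map (prod_topology (torus m) (surf M v)) (block M v) (triv M v)"
  using ggm assms by (auto simp: generalized_graph_manifold_def)

lemma circ_facts:
  assumes "w \<in> tori M"
  shows "circ M w \<subseteq> topspace (surf M (block_of M w))" "circ M w \<noteq> {}"
proof -
  let ?v = "block_of M w"
  have v: "?v \<in> verts M" using assms by (rule block_of_verts)
  have "w \<in> bd M ?v" using assms by (simp add: bd_def)
  then have "circ M w \<in> connected_components_of
      (subtopology (surf M ?v) (manifold_boundary 2 (surf M ?v)))"
    using vertsD(1)[OF v] by (auto simp: bij_betw_def)
  then show "circ M w \<subseteq> topspace (surf M (block_of M w))" "circ M w \<noteq> {}"
    using connected_components_of_subset nonempty_connected_components_of by fastforce+
qed

lemma bd_top_homeomorphic:
  assumes "w \<in> tori M"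
  shows "homeomorphic_map
    (prod_topology (torus m) (subtopology (surf M (block_of M w)) (circ M w))) (bd_top n M w)
    (triv M (block_of M w))"
proof -
  let ?v = "block_of M w"
  let ?X = "prod_topology (torus m) (surf M ?v)"
  let ?S = "topspace (torus m) \<times> circ M w"
  have hom: "homeomorphic_map ?X (block M ?v) (triv M ?v)"
    using vertsD(3)[OF block_of_verts[OF assms]] .
  have S: "?S \<subseteq> topspace ?X" using circ_facts(1)[OF assms] by auto
  have "triv M ?v ` ?S \<subseteq> topspace (block M ?v)"
    using S homeomorphic_imp_surjective_map[OF hom] by blast
  then have "homeomorphic_map (subtopology ?X ?S) (subtopology (block M ?v) (triv M ?v ` ?S)) (triv M ?v)"
    using S by (intro homeomorphic_map_subtopologies[OF hom]) (simp add: Int_absorb1)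
  moreover have "subtopology ?X ?S = prod_topology (torus m) (subtopology (surf M ?v) (circ M w))"
    by (simp add: subtopology_Times)
  ultimately show ?thesis by (simp add: bd_top_def bd_torus_def)
qed

text \<open>A boundary torus is the product of the fiber torus with a boundary circle of the
  surface, hence up to homeomorphism a product of circles.\<close>

lemma bd_top_detected:
  assumes "w \<in> tori M" and b: "torus_basis m f"
  shows "H1_detects m (bd_top n M w)"
proof -
  interpret torus_basis m f by fact
  let ?v = "block_of M w"
  have "subtopology (surf M ?v) (circ M w) homeomorphic_space circle"
    using vertsD(2)[OF block_of_verts[OF assms(1)]] assms(1) by (simp add: bd_def circle_def)
  then have "H1_detects m (prod_topology (torus m) (subtopology (surf M ?v) (circ M w)))"
    by (intro H1_detects_prod H1_detects_torus H1_detects_homeomorphic[OF _ H1_detects_circle])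
  moreover have "bd_top n M w homeomorphic_space prod_topology (torus m) (subtopology (surf M ?v) (circ M w))"
    using homeomorphic_map_imp_homeomorphic_space[OF bd_top_homeomorphic[OF assms(1)]] homeomorphic_space_sym by blast
  ultimately show ?thesis using H1_detects_homeomorphic by blast
qed

lemma continuous_fiber_incl:
  assumes "w \<in> tori M"
  shows "continuous_map (torus m) (bd_top n M w) (fiber_incl M w)"
proof -
  let ?p = "SOME p. p \<in> circ M w"
  have "?p \<in> circ M w" using circ_facts(2)[OF assms] by (simp add: some_in_eq)
  then have "continuous_map (torus m) (prod_topology (torus m) (subtopology (surf M (block_of M w)) (circ M w)))
      (\<lambda>t. (t, ?p))"
    using circ_facts(1)[OF assms] by (auto simp: continuous_map_paired)
  from continuous_map_compose[OF this homeomorphic_imp_continuous_map[OF bd_top_homeomorphic[OF assms]]]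
  show ?thesis by (simp add: fiber_incl_def[abs_def] o_def)
qed

lemma glue_hom_iso:
  "w \<in> glue_set n M \<Longrightarrow> glue_hom n M w \<in> iso (bd_hom n M w) (bd_hom n M (neg M w))"
  unfolding glue_hom_def bd_hom_def using glue_setD(2) by (rule homeomorphic_map_homology_iso)

lemma comm_group_homs: "comm_group (bd_hom n M w)" "comm_group (fiber_hom n)"
  by (simp_all add: bd_hom_def fiber_hom_def)

end

section \<open>Gluing matrices of a Waldhausen basis\<close>

locale waldhausen = graph_manifold n M
  for n and M :: "('v, 'w, 's, 'x, 'm) graph_mfd" +
  fixes z :: "'w \<Rightarrow> 'x chain set" and f :: "'v \<Rightarrow> nat \<Rightarrow> (nat \<Rightarrow> nat \<Rightarrow> real) chain set"
  assumes wb: "waldhausen_basis n M z f"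
begin

lemma fiber_basis: "v \<in> verts M \<Longrightarrow> int_basis (fiber_hom n) m (f v)"
  using wb by (simp add: waldhausen_basis_def)

lemma bd_basis: "w \<in> tori M \<Longrightarrow> int_basis (bd_hom n M w) (Suc m) (bd_tuple n M z f w)"
  using wb block_of_verts n_minus_1 by (auto simp: waldhausen_basis_def bd_def)

lemma bd_tuple_closed: "w \<in> tori M \<Longrightarrow> i < Suc m \<Longrightarrow> bd_tuple n M z f w i \<in> carrier (bd_hom n M w)"
  using comm_group.int_basis_closed[OF comm_group_homs(1) bd_basis] .

lemma fiber_to_bd_lin_comb:
  assumes "\<And>i. i < k \<Longrightarrow> b i \<in> carrier (fiber_hom n)"
  shows "fiber_to_bd n M w (lin_comb (fiber_hom n) b k c) = lin_comb (bd_hom n M w) (\<lambda>i. fiber_to_bd n M w (b i)) k c"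
  using assms
  by (intro comm_group.hom_lin_comb comm_group_homs)
    (simp_all add: fiber_to_bd_def bd_hom_def fiber_hom_def hom_induced_empty_hom)

text \<open>The identification of L_w with L_{-w} is carried out by moving everything into L_{-w};
  this is the basis in which the columns of the gluing matrix are coordinates.\<close>

lemma glued_basis:
  "w \<in> glue_set n M \<Longrightarrow> int_basis (bd_hom n M (neg M w)) (Suc m) (\<lambda>i. glue_hom n M w (bd_tuple n M z f w i))"
  using comm_group.int_basis_iso[OF comm_group_homs(1) bd_basis glue_hom_iso comm_group_homs(1)]
  by (simp add: glue_set_tori)

lemma gluing_matrix:
  assumes w: "w \<in> glue_set n M"
  shows "gluing_matrix n M z f w \<in> carrier_mat (Suc m) (Suc m)"
    and "j < Suc m \<Longrightarrow> bd_tuple n M z f (neg M w) j = lin_comb (bd_hom n M (neg M w))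
      (\<lambda>i. glue_hom n M w (bd_tuple n M z f w i)) (Suc m) (\<lambda>i. gluing_matrix n M z f w $$ (i, j))"
proof -
  have "neg M w \<in> tori M" using glue_setD(1)[OF w] glue_set_tori by blast
  from comm_group.int_basis_ex1_mat[OF comm_group_homs(1) glued_basis[OF w] bd_tuple_closed[OF this]]
  have "\<exists>!A. A \<in> carrier_mat (n - 1) (n - 1) \<and> (\<forall>j<n - 1. bd_tuple n M z f (neg M w) j =
      (\<Otimes>\<^bsub>bd_hom n M (neg M w)\<^esub>i\<in>{..<n - 1}.
        glue_hom n M w (bd_tuple n M z f w i) [^]\<^bsub>bd_hom n M (neg M w)\<^esub> (A $$ (i, j) :: int)))"
    unfolding n_minus_1 by simp
  from theI'[OF this, folded gluing_matrix_def]
  show "gluing_matrix n M z f w \<in> carrier_mat (Suc m) (Suc m)"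
    "j < Suc m \<Longrightarrow> bd_tuple n M z f (neg M w) j = lin_comb (bd_hom n M (neg M w))
      (\<lambda>i. glue_hom n M w (bd_tuple n M z f w i)) (Suc m) (\<lambda>i. gluing_matrix n M z f w $$ (i, j))"
    unfolding n_minus_1 lin_comb_def by auto
qed

text \<open>If the first row of the gluing matrix vanished off the diagonal, the gluing would carry the
  fiber classes onto the fiber classes by a matrix in $GL_{n-2}(Z)$. Such a matrix is induced by a
  homeomorphism of the torus, and equality in homology gives a homotopy, against condition (3).\<close>

lemma b_row_nonzero:
  assumes w: "w \<in> glue_set n M"
  shows "b_row n M z f w \<noteq> 0\<^sub>m 1 m"
proof
  assume b0: "b_row n M z f w = 0\<^sub>m 1 m"
  define \<Psi> where "\<Psi> i j = gluing_matrix n M z f w $$ (i, j)" for i j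
  have \<Psi>0: "\<Psi> 0 (Suc j) = 0" if "j < m" for j
  proof -
    have "b_row n M z f w $$ (0, j) = 0" using that by (simp add: b0)
    then show ?thesis using that by (simp add: b_row_def \<Psi>_def)
  qed
  let ?v = "block_of M w" and ?w = "neg M w" and ?v' = "block_of M (neg M w)"
  let ?H = "bd_hom n M ?w"
  let ?b = "\<lambda>i. glue_hom n M w (bd_tuple n M z f w i)" and ?b' = "bd_tuple n M z f ?w"
  interpret H: comm_group ?H by (rule comm_group_homs)
  interpret F: comm_group "fiber_hom n" by (rule comm_group_homs)
  have wt: "w \<in> tori M" "?w \<in> tori M" using w glue_setD(1) glue_set_tori by blast+
  have v: "?v \<in> verts M" "?v' \<in> verts M" using wt block_of_verts by blast+
  note B = glued_basis[OF w] and B' = bd_basis[OF wt(2)]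
  have bc: "?b i \<in> carrier ?H" if "i < Suc m" for i using H.int_basis_closed[OF B that] .
  have b'c: "?b' i \<in> carrier ?H" if "i < Suc m" for i using H.int_basis_closed[OF B' that] .
  have \<Psi>: "?b' j = lin_comb ?H ?b (Suc m) (\<lambda>i. \<Psi> i j)" if "j < Suc m" for j
    using gluing_matrix(2)[OF w that] by (simp add: \<Psi>_def)
  obtain \<Phi> where \<Phi>: "\<And>j. j < Suc m \<Longrightarrow> ?b j = lin_comb ?H ?b' (Suc m) (\<lambda>i. \<Phi> i j)"
    using H.int_basis_coords[OF B', of "Suc m" ?b, OF bc] by blast
  have \<Psi>\<Phi>: "(\<Sum>l<Suc m. \<Psi> i l * \<Phi> l j) = (if i = j then 1 else 0)" if "i < Suc m" "j < Suc m" for i j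
    using B b'c \<Psi> \<Phi> that by (rule H.int_basis_change_inverse)
  \<comment> \<open>As the first row of \<Psi> is zero off the diagonal, so is that row of its
    inverse \<Phi>: the corner of \<Psi> is nonzero by the case \<open>j = 0\<close>. The lower
    right blocks are then inverse to each other.\<close>
  have row0: "\<Psi> 0 0 * \<Phi> 0 j = (if j = 0 then 1 else 0)" if "j < Suc m" for j
    using \<Psi>\<Phi>[of 0 j] that \<Psi>0 unfolding sum.lessThan_Suc_shift by (simp split: if_splits)
  have \<Phi>0: "\<Phi> 0 (Suc j) = 0" if "j < m" for j
    using row0[of 0] row0[of "Suc j"] that by auto
  define d where "d i j = \<Psi> (Suc i) (Suc j)" for i j
  have d1: "(\<Sum>l<m. d i l * \<Phi> (Suc l) (Suc j)) = (if i = j then 1 else 0)" if "i < m" "j < m" for i j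
    using \<Psi>\<Phi>[of "Suc i" "Suc j"] that \<Phi>0 unfolding sum.lessThan_Suc_shift by (simp add: d_def)
  note fb = fiber_basis[OF v(1)]
  have fc: "f ?v i \<in> carrier (fiber_hom n)" if "i < m" for i using F.int_basis_closed[OF fb that] .
  \<comment> \<open>These are the classes of the fiber torus of M_v that the gluing carries to the
    chosen fiber basis on the other side. They form a basis since the block \<open>d\<close> is
    invertible, and \<open>h\<close> is then taken to realize the passage from them to that
    basis.\<close>
  define g where "g j = lin_comb (fiber_hom n) (f ?v) m (\<lambda>i. d i j)" for j
  have g: "int_basis (fiber_hom n) m g"
    unfolding g_def
    by (rule F.int_basis_transform[OF fb d1 int_mat_inverse_commute[OF d1]])
  interpret torus_basis m g
    using n g by unfold_locales (simp_all add: fiber_hom_def)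
  obtain h where h: "homeomorphic_map (torus m) (torus m) h"
    and hg: "\<And>l. l < m \<Longrightarrow> H1_map (torus m) (torus m) h (g l) = f ?v' l"
    using homeomorphism_between_bases[of "f ?v'"] fiber_basis[OF v(2)] unfolding fiber_hom_def by blast
  let ?F = "glue M w \<circ> fiber_incl M w" and ?G = "fiber_incl M ?w \<circ> h"
  have cw: "continuous_map (torus m) (bd_top n M w) (fiber_incl M w)" using continuous_fiber_incl[OF wt(1)] .
  have cw': "continuous_map (torus m) (bd_top n M ?w) (fiber_incl M ?w)" using continuous_fiber_incl[OF wt(2)] .
  have cg: "continuous_map (bd_top n M w) (bd_top n M ?w) (glue M w)"
    using homeomorphic_imp_continuous_map[OF glue_setD(2)[OF w]] .
  have ch: "continuous_map (torus m) (torus m) h" using homeomorphic_imp_continuous_map[OF h] .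
  have cF: "continuous_map (torus m) (bd_top n M ?w) ?F" using continuous_map_compose[OF cw cg] .
  have cG: "continuous_map (torus m) (bd_top n M ?w) ?G" using continuous_map_compose[OF ch cw'] .
  have F_hom: "H1_map (torus m) (bd_top n M ?w) u (lin_comb (fiber_hom n) b m c) =
      lin_comb ?H (\<lambda>i. H1_map (torus m) (bd_top n M ?w) u (b i)) m c"
    if "\<And>i. i < m \<Longrightarrow> b i \<in> carrier (fiber_hom n)" for u b c
    using that by (intro F.hom_lin_comb H.comm_group_axioms)
      (simp_all add: bd_hom_def fiber_hom_def hom_induced_empty_hom)
  have Fx: "H1_map (torus m) (bd_top n M ?w) ?F x = glue_hom n M w (fiber_to_bd n M w x)" for x
    using hom_induced_compose_empty[OF cw cg, of 1] by (simp add: glue_hom_def fiber_to_bd_def)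
  have Gx: "H1_map (torus m) (bd_top n M ?w) ?G x = fiber_to_bd n M ?w (H1_map (torus m) (torus m) h x)" for x
    using hom_induced_compose_empty[OF ch cw', of 1] by (simp add: fiber_to_bd_def)
  have FG: "H1_map (torus m) (bd_top n M ?w) ?F (g j) = H1_map (torus m) (bd_top n M ?w) ?G (g j)"
    if j: "j < m" for j
  proof -
    have "H1_map (torus m) (bd_top n M ?w) ?G (g j) = ?b' (Suc j)"
      by (simp add: Gx hg[OF j] bd_tuple_def)
    also have "\<dots> = lin_comb ?H ?b (Suc m) (\<lambda>i. \<Psi> i (Suc j))" using \<Psi> j by simp
    also have "\<dots> = lin_comb ?H ?b (Suc m) (case_nat 0 (\<lambda>i. d i j))"
      using bc j by (intro H.lin_comb_cong) (auto simp: \<Psi>0 d_def split: nat.split)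
    also have "\<dots> = lin_comb ?H (\<lambda>i. ?b (Suc i)) m (\<lambda>i. d i j)"
      using bc by (rule H.lin_comb_reduce)
    also have "\<dots> = H1_map (torus m) (bd_top n M ?w) ?F (g j)"
      unfolding g_def by (subst F_hom) (simp_all add: fc Fx bd_tuple_def)
    finally show ?thesis ..
  qed
  have "H1_map (torus m) (bd_top n M ?w) ?F x = H1_map (torus m) (bd_top n M ?w) ?G x"
    if x: "x \<in> carrier (H1 (torus m))" for x
  proof -
    have gc: "g i \<in> carrier (fiber_hom n)" if "i < m" for i using F.int_basis_closed[OF g that] .
    obtain c where c: "x = lin_comb (fiber_hom n) g m c"
      by (rule F.int_basis_exists[OF g x[folded fiber_hom_def]])
    have "H1_map (torus m) (bd_top n M ?w) ?F x = lin_comb ?H (\<lambda>i. H1_map (torus m) (bd_top n M ?w) ?F (g i)) m c"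
      unfolding c using gc by (rule F_hom)
    also have "\<dots> = lin_comb ?H (\<lambda>i. H1_map (torus m) (bd_top n M ?w) ?G (g i)) m c"
      using FG by (intro H.lin_comb_cong) (simp_all add: bd_hom_def)
    also have "\<dots> = H1_map (torus m) (bd_top n M ?w) ?G x"
      unfolding c using gc by (rule F_hom[symmetric])
    finally show ?thesis .
  qed
  then have "homotopic_with (\<lambda>_. True) (torus m) (bd_top n M ?w) ?F ?G"
    using bd_top_detected[OF wt(2) torus_basis_axioms] cF cG unfolding H1_detects_def by blast
  with glue_setD(3)[OF w h] show False by blast
qed

end

section \<open>Comparison of the linear systems\<close>

text \<open>A symmetric matrix has one variable for each unordered pair of indices;
  \<open>min\<close> and \<open>max\<close> give the representative that belongs to
  \<open>LS2_vars\<close>.\<close>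

lemma unit_family_index:
  assumes "i < n - 2" "j < n - 2" and x: "x \<in> LS2_vars n M"
  shows "unit_family n x v $$ (i, j) = (if x = (v, min i j, max i j) then 1 else 0)"
proof -
  obtain u k l where x_eq: "x = (u, k, l)" by (cases x)
  have kl: "k \<le> l" using x by (simp add: x_eq LS2_vars_def)
  have "unit_family n x v $$ (i, j) = (if v = u \<and> ((i, j) = (k, l) \<or> (i, j) = (l, k)) then 1 else 0)"
    using assms(1,2) by (simp add: x_eq unit_family_def)
  also have "(v = u \<and> ((i, j) = (k, l) \<or> (i, j) = (l, k))) = (x = (v, min i j, max i j))"
    using kl by (cases "i \<le> j") (auto simp: x_eq)
  finally show ?thesis .
qed

lemma finite_LS2_vars: "finite (verts M) \<Longrightarrow> finite (LS2_vars n M)"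
  by (rule finite_subset[of _ "verts M \<times> {..<n} \<times> {..<n}"]) (auto simp: LS2_vars_def)

lemma symmetric_family_expand:
  assumes fin: "finite (verts M)" and v: "v \<in> verts M" and ij: "i < n - 2" "j < n - 2"
    and sym: "\<And>i j. i < n - 2 \<Longrightarrow> j < n - 2 \<Longrightarrow> G v $$ (i, j) = (G v $$ (j, i) :: real)"
  shows "G v $$ (i, j) = (\<Sum>x\<in>LS2_vars n M. (case x of (u, k, l) \<Rightarrow> G u $$ (k, l)) * unit_family n x v $$ (i, j))"
proof -
  let ?x = "(v, min i j, max i j)"
  have x: "?x \<in> LS2_vars n M" using v ij by (auto simp: LS2_vars_def)
  have "(\<Sum>x\<in>LS2_vars n M. (case x of (u, k, l) \<Rightarrow> G u $$ (k, l)) * unit_family n x v $$ (i, j)) =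
      (\<Sum>x\<in>LS2_vars n M. if x = ?x then G v $$ (min i j, max i j) else 0)"
    by (intro sum.cong) (auto simp: unit_family_index[OF ij])
  also have "\<dots> = G v $$ (min i j, max i j)" using x finite_LS2_vars[OF fin] by simp
  also have "\<dots> = G v $$ (i, j)" using sym[OF ij] by (auto simp: min_def max_def)
  finally show ?thesis ..
qed

context waldhausen
begin

lemma d_mat_carrier: "d_mat n M z f w \<in> carrier_mat m m"
  by (simp add: d_mat_def)

text \<open>The coefficients of the system are values on unit families, but the substitution in the
  variables turns a unit family into a general symmetric one. Linearity recovers the left-hand side
  on such a family from the coefficients.\<close>

lemma LS2_lhs_expand:
  assumes w: "w \<in> glue_set n M" and P: "P w \<in> carrier_mat m p" and ab: "a < p" "b < p"
    and G: "\<And>v. v \<in> verts M \<Longrightarrow> G v \<in> carrier_mat m m"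
    and sym: "\<And>v i j. v \<in> verts M \<Longrightarrow> i < m \<Longrightarrow> j < m \<Longrightarrow> G v $$ (i, j) = G v $$ (j, i)"
  shows "LS2_lhs n M z f P G w $$ (a, b) = (\<Sum>x\<in>LS2_vars n M.
    (case x of (u, k, l) \<Rightarrow> G u $$ (k, l)) * LS2_lhs n M z f P (unit_family n x) w $$ (a, b))"
proof -
  let ?v = "block_of M w" and ?v' = "block_of M (neg M w)" and ?d = "d_mat n M z f w"
  let ?c = "\<lambda>x. case x of (u, k, l) \<Rightarrow> G u $$ (k, l)"
  have v: "?v \<in> verts M" "?v' \<in> verts M"
    using glue_set_blocks[OF w] .
  have dP: "?d * P w \<in> carrier_mat m p" using d_mat_carrier P by (rule mult_carrier_mat)
  have lhs: "LS2_lhs n M z f P G w $$ (a, b) =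
      (\<Sum>i<m. \<Sum>j<m. P w $$ (i, a) * G ?v' $$ (i, j) * P w $$ (j, b)) -
      (\<Sum>i<m. \<Sum>j<m. (?d * P w) $$ (i, a) * G ?v $$ (i, j) * (?d * P w) $$ (j, b))"
    if "G ?v \<in> carrier_mat m m" "G ?v' \<in> carrier_mat m m" for G
  proof -
    have "LS2_lhs n M z f P G w = transpose_mat (P w) * G ?v' * P w - transpose_mat (?d * P w) * G ?v * (?d * P w)"
      unfolding LS2_lhs_def by (rule congruence_diff[OF that(2,1) d_mat_carrier P])
    moreover have "transpose_mat (?d * P w) * G ?v * (?d * P w) \<in> carrier_mat p p"
      using dP that(1) by (meson mult_carrier_mat transpose_carrier_mat)
    ultimately have "LS2_lhs n M z f P G w $$ (a, b) = (transpose_mat (P w) * G ?v' * P w) $$ (a, b) -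
        (transpose_mat (?d * P w) * G ?v * (?d * P w)) $$ (a, b)"
      using ab by (metis carrier_matD index_minus_mat(1))
    then show ?thesis
      by (simp only: congruence_index[OF that(2) P ab] congruence_index[OF that(1) dP ab])
  qed
  have unit: "unit_family n x u \<in> carrier_mat m m" for x u
    by (cases x) (simp add: unit_family_def)
  have swap: "(\<Sum>i<m. \<Sum>j<m. X i * (\<Sum>x\<in>LS2_vars n M. ?c x * unit_family n x u $$ (i, j)) * Y j) =
      (\<Sum>x\<in>LS2_vars n M. ?c x * (\<Sum>i<m. \<Sum>j<m. X i * unit_family n x u $$ (i, j) * Y j))"
    for X Y :: "nat \<Rightarrow> real" and u
  proof -
    have "(\<Sum>i<m. \<Sum>j<m. X i * (\<Sum>x\<in>LS2_vars n M. ?c x * unit_family n x u $$ (i, j)) * Y j) =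
        (\<Sum>i<m. \<Sum>j<m. \<Sum>x\<in>LS2_vars n M. ?c x * (X i * unit_family n x u $$ (i, j) * Y j))"
      by (simp only: mult_sum_mult)
    also have "\<dots> = (\<Sum>i<m. \<Sum>x\<in>LS2_vars n M. \<Sum>j<m. ?c x * (X i * unit_family n x u $$ (i, j) * Y j))"
      by (intro sum.cong refl sum.swap)
    also have "\<dots> = (\<Sum>x\<in>LS2_vars n M. \<Sum>i<m. \<Sum>j<m. ?c x * (X i * unit_family n x u $$ (i, j) * Y j))"
      by (rule sum.swap)
    finally show ?thesis by (simp only: sum_distrib_left)
  qed
  have ex: "G u $$ (i, j) = (\<Sum>x\<in>LS2_vars n M. ?c x * unit_family n x u $$ (i, j))"
    if "u \<in> verts M" "i < m" "j < m" for u i j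
    using finite_sets(1) that sym[OF that(1)] by (rule symmetric_family_expand)
  have expand: "(\<Sum>i<m. \<Sum>j<m. X i * G u $$ (i, j) * Y j) =
      (\<Sum>i<m. \<Sum>j<m. X i * (\<Sum>x\<in>LS2_vars n M. ?c x * unit_family n x u $$ (i, j)) * Y j)"
    if u: "u \<in> verts M" for X Y :: "nat \<Rightarrow> real" and u
  proof (rule sum.cong[OF refl], rule sum.cong[OF refl])
    fix i j assume "i \<in> {..<m}" "j \<in> {..<m}"
    then have ij: "i < m" "j < m" by auto
    show "X i * G u $$ (i, j) * Y j =
        X i * (\<Sum>x\<in>LS2_vars n M. ?c x * unit_family n x u $$ (i, j)) * Y j"
      by (subst ex[OF u ij]) (rule refl)
  qed
  have "LS2_lhs n M z f P G w $$ (a, b) =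
      (\<Sum>x\<in>LS2_vars n M. ?c x * (\<Sum>i<m. \<Sum>j<m. P w $$ (i, a) * unit_family n x ?v' $$ (i, j) * P w $$ (j, b))) -
      (\<Sum>x\<in>LS2_vars n M. ?c x * (\<Sum>i<m. \<Sum>j<m. (?d * P w) $$ (i, a) * unit_family n x ?v $$ (i, j) * (?d * P w) $$ (j, b)))"
    unfolding lhs[of G, OF G[OF v(1)] G[OF v(2)]] expand[OF v(1)] expand[OF v(2)] swap ..
  also have "\<dots> = (\<Sum>x\<in>LS2_vars n M. ?c x * LS2_lhs n M z f P (unit_family n x) w $$ (a, b))"
    by (simp only: lhs[OF unit unit] right_diff_distrib sum_subtractf)
  finally show ?thesis .
qed

end

section \<open>Effect of a change of Waldhausen basis\<close>

context graph_manifold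
begin

text \<open>In the tuple bases a change at a gluing torus has the block form with rows (\<epsilon>,
  0) and (r, S), because new fiber classes are combinations of old fiber classes alone. In A \<Psi>'
  = \<Psi> A' only the columns other than the first are read off; there A' contributes just S of the
  opposite block, so its own lower left entries drop out.\<close>

lemma basis_change:
  assumes "waldhausen_basis n M z f" "waldhausen_basis n M z' f'"
  shows "\<exists>S T :: 'v \<Rightarrow> nat \<Rightarrow> nat \<Rightarrow> int.
    (\<forall>v\<in>verts M. \<forall>i<m. \<forall>j<m. (\<Sum>l<m. T v i l * S v l j) = (if i = j then 1 else 0)) \<and>
    (\<forall>w\<in>glue_set n M. \<exists>\<epsilon> r.
      (\<forall>j<m. \<epsilon> * gluing_matrix n M z' f' w $$ (0, Suc j) =
        (\<Sum>l<m. gluing_matrix n M z f w $$ (0, Suc l) * S (block_of M (neg M w)) l j)) \<and>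
      (\<forall>i<m. \<forall>j<m. r i * gluing_matrix n M z' f' w $$ (0, Suc j) +
        (\<Sum>l<m. S (block_of M w) i l * gluing_matrix n M z' f' w $$ (Suc l, Suc j)) =
        (\<Sum>l<m. gluing_matrix n M z f w $$ (Suc i, Suc l) * S (block_of M (neg M w)) l j)))"
proof -
  interpret A: waldhausen n M z f using assms(1) by unfold_locales
  interpret B: waldhausen n M z' f' using assms(2) by unfold_locales
  interpret F: comm_group "fiber_hom n" by (rule comm_group_homs)
  have fc: "f v i \<in> carrier (fiber_hom n)" "f' v i \<in> carrier (fiber_hom n)" if "v \<in> verts M" "i < m" for v i
    using F.int_basis_closed[OF A.fiber_basis[OF that(1)] that(2)]
      F.int_basis_closed[OF B.fiber_basis[OF that(1)] that(2)] .
  have "\<forall>v\<in>verts M. \<exists>S :: nat \<Rightarrow> nat \<Rightarrow> int. \<forall>j<m. f' v j = lin_comb (fiber_hom n) (f v) m (\<lambda>i. S i j)"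
    by (intro ballI F.int_basis_coords[OF A.fiber_basis]) (auto intro: fc)
  then obtain S :: "'v \<Rightarrow> nat \<Rightarrow> nat \<Rightarrow> int" where
    S: "\<And>v j. v \<in> verts M \<Longrightarrow> j < m \<Longrightarrow> f' v j = lin_comb (fiber_hom n) (f v) m (\<lambda>i. S v i j)"
    by metis
  have "\<forall>v\<in>verts M. \<exists>T :: nat \<Rightarrow> nat \<Rightarrow> int. \<forall>j<m. f v j = lin_comb (fiber_hom n) (f' v) m (\<lambda>i. T i j)"
    by (intro ballI F.int_basis_coords[OF B.fiber_basis]) (auto intro: fc)
  then obtain T :: "'v \<Rightarrow> nat \<Rightarrow> nat \<Rightarrow> int" where
    T: "\<And>v j. v \<in> verts M \<Longrightarrow> j < m \<Longrightarrow> f v j = lin_comb (fiber_hom n) (f' v) m (\<lambda>i. T v i j)"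
    by metis
  \<comment> \<open>The block matrix of the change: column 0 lists the coordinates of the new z_w,
    and each other column is a column of \<open>S v\<close> with a 0 on top.\<close>
  define ch where "ch r v i j = (case j of 0 \<Rightarrow> r i | Suc j' \<Rightarrow> case_nat 0 (\<lambda>i. S v i j') i)"
    for r :: "nat \<Rightarrow> int" and v i j
  have tuple: "\<exists>r. \<forall>j<Suc m. bd_tuple n M z' f' w j =
      lin_comb (bd_hom n M w) (bd_tuple n M z f w) (Suc m) (\<lambda>i. ch r (block_of M w) i j)"
    if w: "w \<in> tori M" for w
  proof -
    interpret H: comm_group "bd_hom n M w" by (rule comm_group_homs)
    have v: "block_of M w \<in> verts M" using w by (rule block_of_verts)
    obtain r where r: "bd_tuple n M z' f' w 0 = lin_comb (bd_hom n M w) (bd_tuple n M z f w) (Suc m) r"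
      by (rule H.int_basis_exists[OF A.bd_basis[OF w] B.bd_tuple_closed[OF w]]) auto
    have "bd_tuple n M z' f' w j =
      lin_comb (bd_hom n M w) (bd_tuple n M z f w) (Suc m) (\<lambda>i. ch r (block_of M w) i j)" if j: "j < Suc m" for j
    proof (cases j)
      case 0
      then show ?thesis using r by (simp add: ch_def)
    next
      case (Suc j')
      then have j': "j' < m" using j by simp
      have "bd_tuple n M z' f' w j = fiber_to_bd n M w (lin_comb (fiber_hom n) (f (block_of M w)) m (\<lambda>i. S (block_of M w) i j'))"
        using Suc S[OF v j'] by (simp add: bd_tuple_def)
      also have "\<dots> = lin_comb (bd_hom n M w) (\<lambda>i. bd_tuple n M z f w (Suc i)) m (\<lambda>i. S (block_of M w) i j')"
        using fc(1)[OF v] by (subst A.fiber_to_bd_lin_comb) (simp_all add: bd_tuple_def)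
      also have "\<dots> = lin_comb (bd_hom n M w) (bd_tuple n M z f w) (Suc m) (case_nat 0 (\<lambda>i. S (block_of M w) i j'))"
        using A.bd_tuple_closed[OF w] by (rule H.lin_comb_reduce[symmetric])
      finally show ?thesis using Suc by (simp add: ch_def)
    qed
    then show ?thesis by blast
  qed
  show ?thesis
  proof (rule exI[of _ S], rule exI[of _ T], intro conjI ballI allI impI)
    fix v i j assume v: "v \<in> verts M" and ij: "i < m" "j < m"
    show "(\<Sum>l<m. T v i l * S v l j) = (if i = j then 1 else 0)"
      using B.fiber_basis[OF v] fc(1)[OF v] T[OF v] S[OF v] ij by (rule F.int_basis_change_inverse)
  next
    fix w assume w: "w \<in> glue_set n M"
    let ?w = "neg M w"
    let ?H = "bd_hom n M ?w" and ?g = "glue_hom n M w"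
    interpret H: comm_group ?H by (rule comm_group_homs)
    interpret Hw: comm_group "bd_hom n M w" by (rule comm_group_homs)
    have wt: "w \<in> tori M" "?w \<in> tori M" using w glue_setD(1) glue_set_tori by blast+
    define \<Psi> where "\<Psi> i j = gluing_matrix n M z f w $$ (i, j)" for i j
    define \<Psi>' where "\<Psi>' i j = gluing_matrix n M z' f' w $$ (i, j)" for i j
    obtain r where r: "\<forall>j<Suc m. bd_tuple n M z' f' w j =
        lin_comb (bd_hom n M w) (bd_tuple n M z f w) (Suc m) (\<lambda>i. ch r (block_of M w) i j)"
      using tuple[OF wt(1)] by blast
    obtain r' where r': "\<forall>j<Suc m. bd_tuple n M z' f' ?w j =
        lin_comb ?H (bd_tuple n M z f ?w) (Suc m) (\<lambda>i. ch r' (block_of M ?w) i j)"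
      using tuple[OF wt(2)] by blast
    have g: "?g \<in> hom (bd_hom n M w) ?H" using glue_hom_iso[OF w] by (simp add: iso_def)
    have "?g (bd_tuple n M z' f' w j) = lin_comb ?H (\<lambda>i. ?g (bd_tuple n M z f w i)) (Suc m) (\<lambda>i. ch r (block_of M w) i j)"
      if "j < Suc m" for j
      unfolding r[rule_format, OF that]
      by (rule Hw.hom_lin_comb[OF g comm_group_homs(1) A.bd_tuple_closed[OF wt(1)]])
    note g_tuple = this
    have rel: "(\<Sum>l<Suc m. ch r (block_of M w) i l * \<Psi>' l j) = (\<Sum>l<Suc m. \<Psi> i l * ch r' (block_of M ?w) l j)"
      if "i < Suc m" "j < Suc m" for i j
    proof (rule H.change_of_basis_relation[where A = "ch r (block_of M w)" and \<Psi> = \<Psi> and \<Psi>' = \<Psi>' and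
          A' = "ch r' (block_of M ?w)" and c = "\<lambda>i. ?g (bd_tuple n M z f w i)" and
          c' = "\<lambda>j. ?g (bd_tuple n M z' f' w j)" and d = "bd_tuple n M z f ?w" and d' = "bd_tuple n M z' f' ?w"])
      show "int_basis ?H (Suc m) (\<lambda>i. ?g (bd_tuple n M z f w i))" by (rule A.glued_basis[OF w])
      fix j assume j: "j < Suc m"
      show "?g (bd_tuple n M z' f' w j) =
          lin_comb ?H (\<lambda>i. ?g (bd_tuple n M z f w i)) (Suc m) (\<lambda>i. ch r (block_of M w) i j)"
        using j by (rule g_tuple)
      show "bd_tuple n M z f ?w j = lin_comb ?H (\<lambda>i. ?g (bd_tuple n M z f w i)) (Suc m) (\<lambda>i. \<Psi> i j)"
        unfolding \<Psi>_def by (rule A.gluing_matrix(2)[OF w j])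
      show "bd_tuple n M z' f' ?w j = lin_comb ?H (bd_tuple n M z f ?w) (Suc m) (\<lambda>i. ch r' (block_of M ?w) i j)"
        using r' j by blast
      show "bd_tuple n M z' f' ?w j = lin_comb ?H (\<lambda>j. ?g (bd_tuple n M z' f' w j)) (Suc m) (\<lambda>i. \<Psi>' i j)"
        unfolding \<Psi>'_def by (rule B.gluing_matrix(2)[OF w j])
    qed fact+
    have e1: "r 0 * \<Psi>' 0 (Suc j) = (\<Sum>l<m. \<Psi> 0 (Suc l) * S (block_of M ?w) l j)" if "j < m" for j
      using rel[of 0 "Suc j"] that unfolding sum.lessThan_Suc_shift by (simp add: ch_def)
    have e2: "r (Suc i) * \<Psi>' 0 (Suc j) + (\<Sum>l<m. S (block_of M w) i l * \<Psi>' (Suc l) (Suc j)) =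
        (\<Sum>l<m. \<Psi> (Suc i) (Suc l) * S (block_of M ?w) l j)" if "i < m" "j < m" for i j
      using rel[of "Suc i" "Suc j"] that unfolding sum.lessThan_Suc_shift by (simp add: ch_def)
    show "\<exists>\<epsilon> r.
      (\<forall>j<m. \<epsilon> * gluing_matrix n M z' f' w $$ (0, Suc j) =
        (\<Sum>l<m. gluing_matrix n M z f w $$ (0, Suc l) * S (block_of M (neg M w)) l j)) \<and>
      (\<forall>i<m. \<forall>j<m. r i * gluing_matrix n M z' f' w $$ (0, Suc j) +
        (\<Sum>l<m. S (block_of M w) i l * gluing_matrix n M z' f' w $$ (Suc l, Suc j)) =
        (\<Sum>l<m. gluing_matrix n M z f w $$ (Suc i, Suc l) * S (block_of M (neg M w)) l j))"
      by (rule exI[of _ "r 0"], rule exI[of _ "\<lambda>i. r (Suc i)"], intro conjI allI impI)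
        (erule e1[unfolded \<Psi>_def \<Psi>'_def], erule (1) e2[unfolded \<Psi>_def \<Psi>'_def])
  qed
qed

text \<open>With \<open>T\<close> the inverse of \<open>S\<close>, both P'_w and d'_w P'_w are the
  products P_w Q_w and d_w P_w Q_w multiplied from the left by \<open>T\<close>, at the opposite and
  at the own block respectively. Two congruences with the same Q_w result, and
  \<open>congruence_diff\<close> puts them together again.\<close>

lemma LS2_lhs_change:
  assumes wb: "waldhausen_basis n M z f" "waldhausen_basis n M z' f'"
    and P: "admissible_P n M z f P" and P': "admissible_P n M z' f' P'"
  shows "\<exists>(T :: 'v \<Rightarrow> real mat) (Q :: 'w \<Rightarrow> real mat).
    (\<forall>v\<in>verts M. T v \<in> carrier_mat m m) \<and> (\<forall>w\<in>glue_set n M. Q w \<in> carrier_mat (n - 3) (n - 3)) \<and>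
    (\<forall>w\<in>glue_set n M. \<forall>G. (\<forall>v\<in>verts M. G v \<in> carrier_mat m m) \<longrightarrow>
      LS2_lhs n M z' f' P' G w =
        transpose_mat (Q w) * LS2_lhs n M z f P (\<lambda>v. transpose_mat (T v) * G v * T v) w * Q w)"
proof -
  interpret A: waldhausen n M z f using wb(1) by unfold_locales
  interpret B: waldhausen n M z' f' using wb(2) by unfold_locales
  have m: "m = Suc (n - 3)" using n by simp
  obtain S0 T0 :: "'v \<Rightarrow> nat \<Rightarrow> nat \<Rightarrow> int" where
    TS0: "\<forall>v\<in>verts M. \<forall>i<m. \<forall>j<m. (\<Sum>l<m. T0 v i l * S0 v l j) = (if i = j then 1 else 0)"
    and rel: "\<forall>w\<in>glue_set n M. \<exists>\<epsilon> r.
      (\<forall>j<m. \<epsilon> * gluing_matrix n M z' f' w $$ (0, Suc j) =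
        (\<Sum>l<m. gluing_matrix n M z f w $$ (0, Suc l) * S0 (block_of M (neg M w)) l j)) \<and>
      (\<forall>i<m. \<forall>j<m. r i * gluing_matrix n M z' f' w $$ (0, Suc j) +
        (\<Sum>l<m. S0 (block_of M w) i l * gluing_matrix n M z' f' w $$ (Suc l, Suc j)) =
        (\<Sum>l<m. gluing_matrix n M z f w $$ (Suc i, Suc l) * S0 (block_of M (neg M w)) l j))"
    using basis_change[OF wb] by (elim exE conjE)
  define S where "S v = mat m m (\<lambda>(i, j). real_of_int (S0 v i j))" for v
  define T where "T v = mat m m (\<lambda>(i, j). real_of_int (T0 v i j))" for v
  have Sc: "S v \<in> carrier_mat m m" and Tc: "T v \<in> carrier_mat m m" for v by (simp_all add: S_def T_def)
  have TS: "T v * S v = 1\<^sub>m m" if "v \<in> verts M" for v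
  proof (rule eq_matI)
    fix i j assume "i < dim_row (1\<^sub>m m :: real mat)" "j < dim_col (1\<^sub>m m :: real mat)"
    then have ij: "i < m" "j < m" by auto
    have "(T v * S v) $$ (i, j) = of_int (\<Sum>l<m. T0 v i l * S0 v l j)"
      using ij by (simp add: S_def T_def scalar_prod_def atLeast0LessThan)
    then show "(T v * S v) $$ (i, j) = 1\<^sub>m m $$ (i, j)" using ij TS0 that by simp
  qed (simp_all add: S_def T_def)
  have ex: "\<exists>Q \<in> carrier_mat (n - 3) (n - 3). P' w = T (block_of M (neg M w)) * (P w * Q) \<and>
      d_mat n M z' f' w * P' w = T (block_of M w) * (d_mat n M z f w * (P w * Q))"
    if w: "w \<in> glue_set n M" for w
  proof -
    let ?v = "block_of M w" and ?v' = "block_of M (neg M w)"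
    let ?b = "b_row n M z f w" and ?b' = "b_row n M z' f' w"
    let ?d = "d_mat n M z f w" and ?d' = "d_mat n M z' f' w"
    have v: "?v \<in> verts M" "?v' \<in> verts M"
      using glue_set_blocks[OF w] .
    have Pw: "P w \<in> carrier_mat m (n - 3)" "vec_space.rank m (P w) = n - 3" "?b * P w = 0\<^sub>m 1 (n - 3)"
      using P w by (auto simp: admissible_P_def)
    have P'w: "P' w \<in> carrier_mat m (n - 3)" "?b' * P' w = 0\<^sub>m 1 (n - 3)"
      using P' w by (auto simp: admissible_P_def)
    have bc: "?b \<in> carrier_mat 1 m" "?b' \<in> carrier_mat 1 m" by (simp_all add: b_row_def)
    have dc: "?d \<in> carrier_mat m m" "?d' \<in> carrier_mat m m" by (simp_all add: d_mat_def)
    obtain \<epsilon> r where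
      r1': "\<forall>j<m. \<epsilon> * gluing_matrix n M z' f' w $$ (0, Suc j) =
        (\<Sum>l<m. gluing_matrix n M z f w $$ (0, Suc l) * S0 ?v' l j)"
      and r2': "\<forall>i<m. \<forall>j<m. r i * gluing_matrix n M z' f' w $$ (0, Suc j) +
        (\<Sum>l<m. S0 ?v i l * gluing_matrix n M z' f' w $$ (Suc l, Suc j)) =
        (\<Sum>l<m. gluing_matrix n M z f w $$ (Suc i, Suc l) * S0 ?v' l j)"
      using bspec[OF rel w] by (elim exE conjE)
    note r1 = r1'[rule_format] and r2 = r2'[rule_format]
    define R where "R = mat m 1 (\<lambda>(i, j). real_of_int (r i))"
    have Rc: "R \<in> carrier_mat m 1" by (simp add: R_def)
    have bS: "?b * S ?v' = real_of_int \<epsilon> \<cdot>\<^sub>m ?b'"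
    proof (rule eq_matI)
      fix i j assume "i < dim_row (real_of_int \<epsilon> \<cdot>\<^sub>m ?b')" "j < dim_col (real_of_int \<epsilon> \<cdot>\<^sub>m ?b')"
      then have ij: "i = 0" "j < m" using bc by auto
      have "(?b * S ?v') $$ (i, j) = of_int (\<Sum>l<m. gluing_matrix n M z f w $$ (0, Suc l) * S0 ?v' l j)"
        using ij by (simp add: b_row_def S_def scalar_prod_def atLeast0LessThan)
      also have "\<dots> = (real_of_int \<epsilon> \<cdot>\<^sub>m ?b') $$ (i, j)"
        unfolding r1[OF ij(2), symmetric] using ij by (simp add: b_row_def)
      finally show "(?b * S ?v') $$ (i, j) = (real_of_int \<epsilon> \<cdot>\<^sub>m ?b') $$ (i, j)" .
    qed (use bc Sc in auto)
    have dS: "R * ?b' + S ?v * ?d' = ?d * S ?v'"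
    proof (rule eq_matI)
      fix i j assume "i < dim_row (?d * S ?v')" "j < dim_col (?d * S ?v')"
      then have ij: "i < m" "j < m" using dc Sc[of ?v'] by auto
      have "(?d * S ?v') $$ (i, j) = of_int (\<Sum>l<m. gluing_matrix n M z f w $$ (Suc i, Suc l) * S0 ?v' l j)"
        using ij by (simp add: d_mat_def S_def scalar_prod_def atLeast0LessThan)
      also have "\<dots> = (R * ?b' + S ?v * ?d') $$ (i, j)"
        unfolding r2[OF ij, symmetric] using ij
        by (simp add: R_def b_row_def d_mat_def S_def scalar_prod_def atLeast0LessThan)
      finally show "(R * ?b' + S ?v * ?d') $$ (i, j) = (?d * S ?v') $$ (i, j)" ..
    qed (use bc dc Sc[of ?v] Sc[of ?v'] Rc in auto)
    \<comment> \<open>The first relation places the columns of this product in the kernel of b_w,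
      and \<open>hyperplane_factor\<close> divides it by P_w.\<close>
    have SP: "S ?v' * P' w \<in> carrier_mat m (n - 3)" by (rule mult_carrier_mat[OF Sc P'w(1)])
    have "?b * (S ?v' * P' w) = ?b * S ?v' * P' w"
      using assoc_mult_mat[OF bc(1) Sc P'w(1)] by simp
    also have "\<dots> = real_of_int \<epsilon> \<cdot>\<^sub>m (?b' * P' w)"
      unfolding bS using bc(2) P'w(1) by (rule mult_smult_assoc_mat)
    also have "\<dots> = 0\<^sub>m 1 (n - 3)" unfolding P'w(2) by (intro eq_matI) auto
    finally have "?b * (S ?v' * P' w) = 0\<^sub>m 1 (n - 3)" .
    then obtain Q where Q: "Q \<in> carrier_mat (n - 3) (n - 3)" "S ?v' * P' w = P w * Q"
      using hyperplane_factor[of ?b "n - 3" "P w" "S ?v' * P' w" "n - 3"]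
        bc(1) A.b_row_nonzero[OF w] Pw SP unfolding m by blast
    have "P' w = T ?v' * S ?v' * P' w" using TS[OF v(2)] P'w(1) by simp
    also have "\<dots> = T ?v' * (P w * Q)" using assoc_mult_mat[OF Tc Sc P'w(1)] Q(2) by simp
    finally have 1: "P' w = T ?v' * (P w * Q)" .
    have dP: "?d' * P' w \<in> carrier_mat m (n - 3)" using dc P'w by auto
    have "?d * (S ?v' * P' w) = ?d * S ?v' * P' w"
      using assoc_mult_mat[OF dc(1) Sc P'w(1)] by simp
    also have "\<dots> = R * ?b' * P' w + S ?v * ?d' * P' w"
      unfolding dS[symmetric] using Rc bc Sc[of ?v] dc P'w(1) by (intro add_mult_distrib_mat) auto
    \<comment> \<open>The column r, through which the new z_w enters the second relation, disappears
      because b'_w P'_w = 0.\<close>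
    also have "R * ?b' * P' w = 0\<^sub>m m (n - 3)"
      using assoc_mult_mat[OF Rc bc(2) P'w(1)] P'w(2) Rc by simp
    also have "0\<^sub>m m (n - 3) + S ?v * ?d' * P' w = S ?v * (?d' * P' w)"
      using assoc_mult_mat[OF Sc dc(2) P'w(1)] mult_carrier_mat[OF Sc dP] by simp
    finally have "S ?v * (?d' * P' w) = ?d * (P w * Q)" unfolding Q(2) ..
    then have "T ?v * (?d * (P w * Q)) = T ?v * S ?v * (?d' * P' w)"
      using assoc_mult_mat[OF Tc Sc dP] by simp
    also have "\<dots> = ?d' * P' w" unfolding TS[OF v(1)] by (rule left_mult_one_mat[OF dP])
    finally have "?d' * P' w = T ?v * (?d * (P w * Q))" ..
    with 1 Q(1) show ?thesis by blast
  qed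
  then obtain Q where Q: "\<And>w. w \<in> glue_set n M \<Longrightarrow> Q w \<in> carrier_mat (n - 3) (n - 3)"
    and PQ: "\<And>w. w \<in> glue_set n M \<Longrightarrow> P' w = T (block_of M (neg M w)) * (P w * Q w)"
      "\<And>w. w \<in> glue_set n M \<Longrightarrow>
        d_mat n M z' f' w * P' w = T (block_of M w) * (d_mat n M z f w * (P w * Q w))"
    by metis
  show ?thesis
  proof (rule exI[of _ T], rule exI[of _ Q], intro conjI ballI allI impI)
    fix w and G :: "'v \<Rightarrow> real mat"
    assume w: "w \<in> glue_set n M" and G: "\<forall>v\<in>verts M. G v \<in> carrier_mat m m"
    let ?v = "block_of M w" and ?v' = "block_of M (neg M w)"
    let ?d = "d_mat n M z f w" and ?d' = "d_mat n M z' f' w"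
    let ?G = "\<lambda>v. transpose_mat (T v) * G v * T v"
    have v: "?v \<in> verts M" "?v' \<in> verts M"
      using glue_set_blocks[OF w] .
    have Gv: "G ?v \<in> carrier_mat m m" "G ?v' \<in> carrier_mat m m" using G v by auto
    have TG: "?G ?v \<in> carrier_mat m m" "?G ?v' \<in> carrier_mat m m" using Gv Tc[of ?v] Tc[of ?v'] by auto
    have Pw: "P w \<in> carrier_mat m (n - 3)" "P' w \<in> carrier_mat m (n - 3)"
      using P P' w by (auto simp: admissible_P_def)
    have PQw: "P w * Q w \<in> carrier_mat m (n - 3)" using Pw Q[OF w] by auto
    have dPQ: "?d * (P w * Q w) \<in> carrier_mat m (n - 3)" by (rule mult_carrier_mat[OF A.d_mat_carrier PQw])
    have inner: "?G ?v' - transpose_mat ?d * ?G ?v * ?d \<in> carrier_mat m m"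
      using TG A.d_mat_carrier[of w] by auto
    have "LS2_lhs n M z' f' P' G w =
        transpose_mat (P' w) * G ?v' * P' w - transpose_mat (?d' * P' w) * G ?v * (?d' * P' w)"
      unfolding LS2_lhs_def by (rule congruence_diff[OF Gv(2,1) B.d_mat_carrier Pw(2)])
    also have "\<dots> = transpose_mat (P w * Q w) * ?G ?v' * (P w * Q w) -
        transpose_mat (?d * (P w * Q w)) * ?G ?v * (?d * (P w * Q w))"
      unfolding PQ(2)[OF w] unfolding PQ(1)[OF w]
      by (simp only: congruence_mult[OF Gv(2) Tc PQw] congruence_mult[OF Gv(1) Tc dPQ])
    also have "\<dots> = transpose_mat (P w * Q w) * (?G ?v' - transpose_mat ?d * ?G ?v * ?d) * (P w * Q w)"
      by (rule congruence_diff[OF TG(2,1) A.d_mat_carrier PQw, symmetric])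
    also have "\<dots> = transpose_mat (Q w) * (transpose_mat (P w) * (?G ?v' - transpose_mat ?d * ?G ?v * ?d) * P w) * Q w"
      by (rule congruence_mult[OF inner Pw(1) Q[OF w]])
    finally show "LS2_lhs n M z' f' P' G w = transpose_mat (Q w) * LS2_lhs n M z f P ?G w * Q w"
      unfolding LS2_lhs_def .
  qed (use Tc Q in auto)
qed

text \<open>The coefficient matrices satisfy L' = B L D: the factor D comes from the substitution in
  the variables and B from the recombination of the equations at each gluing torus by Q_w.\<close>

lemma LS2_rank_le:
  assumes wb: "waldhausen_basis n M z f" "waldhausen_basis n M z' f'"
    and P: "admissible_P n M z f P" and P': "admissible_P n M z' f' P'"
  shows "vec_space.rank (card (LS2_eqs n M)) (LS2_matrix n M z' f' P') \<le>
    vec_space.rank (card (LS2_eqs n M)) (LS2_matrix n M z f P)"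
proof -
  interpret A: waldhausen n M z f using wb(1) by unfold_locales
  obtain T :: "'v \<Rightarrow> real mat" and Q :: "'w \<Rightarrow> real mat"
    where T': "\<forall>v\<in>verts M. T v \<in> carrier_mat m m"
    and Q': "\<forall>w\<in>glue_set n M. Q w \<in> carrier_mat (n - 3) (n - 3)"
    and lhs: "\<forall>w\<in>glue_set n M. \<forall>G. (\<forall>v\<in>verts M. G v \<in> carrier_mat m m) \<longrightarrow>
      LS2_lhs n M z' f' P' G w =
        transpose_mat (Q w) * LS2_lhs n M z f P (\<lambda>v. transpose_mat (T v) * G v * T v) w * Q w"
    using LS2_lhs_change[OF wb P P'] by (elim exE conjE)
  note T = bspec[OF T'] and Q = bspec[OF Q']
  let ?R = "LS2_eqs n M" and ?C = "LS2_vars n M"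
  define G where "G x v = transpose_mat (T v) * unit_family n x v * T v" for x v
  \<comment> \<open>Block diagonal over the gluing tori, with the transposed Kronecker square of Q_w
    as the block at \<open>w\<close>; column \<open>x\<close> of \<open>D\<close> below lists the
    variables of the substituted unit family \<open>G x\<close>.\<close>
  define B where "B e e' = (case e of (w, a, b) \<Rightarrow> case e' of (w', a', b') \<Rightarrow>
      if w' = w then Q w $$ (a', a) * Q w $$ (b', b) else 0)" for e e' :: "'w \<times> nat \<times> nat"
  define D where "D y x = (case y of (v, i, j) \<Rightarrow> G x v $$ (i, j))" for x y :: "'v \<times> nat \<times> nat"
  have finR: "finite ?R" using finite_glue_set by (simp add: LS2_eqs_def)
  have finC: "finite ?C" using finite_LS2_vars finite_sets(1) by blast
  have unit: "unit_family n x v \<in> carrier_mat m m" for x v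
    by (cases x) (simp add: unit_family_def)
  have unit_sym: "transpose_mat (unit_family n x v) = unit_family n x v" for x v
    by (cases x) (auto simp: unit_family_def intro!: eq_matI)
  have Gc: "G x v \<in> carrier_mat m m" if "v \<in> verts M" for x v
    unfolding G_def by (intro mult_carrier_mat[of _ m m]) (simp_all add: unit T[OF that])
  \<comment> \<open>Symmetry of the substituted family permits its expansion in the variables, which
    cover only the entries with \<open>i \<le> j\<close>.\<close>
  have G_sym: "G x v $$ (i, j) = G x v $$ (j, i)" if v: "v \<in> verts M" and ij: "i < m" "j < m" for x v i j
  proof -
    have Tt: "transpose_mat (T v) \<in> carrier_mat m m" using T[OF v] by auto
    have TU: "transpose_mat (T v) * unit_family n x v \<in> carrier_mat m m" by (rule mult_carrier_mat[OF Tt unit])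
    have "transpose_mat (G x v) = transpose_mat (T v) * transpose_mat (transpose_mat (T v) * unit_family n x v)"
      unfolding G_def by (rule transpose_mult[OF TU T[OF v]])
    also have "\<dots> = transpose_mat (T v) * (unit_family n x v * T v)"
      using transpose_mult[OF Tt unit, of x v] by (simp add: unit_sym)
    also have "\<dots> = G x v" unfolding G_def by (rule assoc_mult_mat[OF Tt unit T[OF v], symmetric])
    finally show ?thesis using index_transpose_mat(1)[of j "G x v" i] Gc[OF v, of x] ij
      by (metis carrier_matD(1) carrier_matD(2) index_transpose_mat(1))
  qed
  have "LS2_coeff n M z' f' P' e x = (\<Sum>e'\<in>?R. \<Sum>y\<in>?C. B e e' * LS2_coeff n M z f P e' y * D y x)"
    if e: "e \<in> ?R" and x: "x \<in> ?C" for e x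
  proof -
    obtain w a b where e_eq: "e = (w, a, b)" by (cases e)
    have w: "w \<in> glue_set n M" and ab: "a < n - 3" "b < n - 3" using e by (auto simp: e_eq LS2_eqs_def)
    let ?K = "{..<n - 3}"
    have Pw: "P w \<in> carrier_mat m (n - 3)" using P w by (auto simp: admissible_P_def)
    have Lc: "LS2_lhs n M z f P (G x) w \<in> carrier_mat (n - 3) (n - 3)"
    proof -
      have "transpose_mat (P w) * U * P w \<in> carrier_mat (n - 3) (n - 3)" for U
        using Pw by (intro carrier_matI) auto
      then show ?thesis unfolding LS2_lhs_def .
    qed
    have "LS2_lhs n M z' f' P' (unit_family n x) w = transpose_mat (Q w) * LS2_lhs n M z f P (G x) w * Q w"
      unfolding G_def[abs_def] by (rule mp[OF spec[OF bspec[OF lhs w]]]) (simp add: unit)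
    then have "LS2_coeff n M z' f' P' e x = (transpose_mat (Q w) * LS2_lhs n M z f P (G x) w * Q w) $$ (a, b)"
      by (simp add: LS2_coeff_def e_eq)
    also have "\<dots> = (\<Sum>a'\<in>?K. \<Sum>b'\<in>?K. Q w $$ (a', a) * LS2_lhs n M z f P (G x) w $$ (a', b') * Q w $$ (b', b))"
      by (rule congruence_index[OF Lc Q[OF w] ab])
    also have "\<dots> = (\<Sum>a'\<in>?K. \<Sum>b'\<in>?K. \<Sum>y\<in>?C. B e (w, a', b') * LS2_coeff n M z f P (w, a', b') y * D y x)"
    proof (intro sum.cong refl)
      fix a' b' assume "a' \<in> ?K" "b' \<in> ?K"
      then have ab': "a' < n - 3" "b' < n - 3" by auto
      have "LS2_lhs n M z f P (G x) w $$ (a', b') = (\<Sum>y\<in>?C. D y x * LS2_coeff n M z f P (w, a', b') y)"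
        using A.LS2_lhs_expand[where P = P and G = "G x", OF w Pw ab' Gc G_sym] by (simp add: D_def LS2_coeff_def)
      then show "Q w $$ (a', a) * LS2_lhs n M z f P (G x) w $$ (a', b') * Q w $$ (b', b) =
          (\<Sum>y\<in>?C. B e (w, a', b') * LS2_coeff n M z f P (w, a', b') y * D y x)"
        by (simp add: B_def e_eq sum_distrib_left sum_distrib_right mult_ac)
    qed
    also have "\<dots> = (\<Sum>(a', b')\<in>?K \<times> ?K. \<Sum>y\<in>?C. B e (w, a', b') * LS2_coeff n M z f P (w, a', b') y * D y x)"
      by (rule sum.cartesian_product)
    also have "\<dots> = (\<Sum>e'\<in>{w} \<times> ?K \<times> ?K. \<Sum>y\<in>?C. B e e' * LS2_coeff n M z f P e' y * D y x)"
      by (rule sum.reindex_bij_witness[of _ snd "\<lambda>p. (w, p)"]) auto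
    also have "\<dots> = (\<Sum>e'\<in>?R. \<Sum>y\<in>?C. B e e' * LS2_coeff n M z f P e' y * D y x)"
    proof (rule sum.mono_neutral_left[OF finR])
      show "{w} \<times> ?K \<times> ?K \<subseteq> ?R" using w by (auto simp: LS2_eqs_def)
      have "B e e' = 0" if "e' \<in> ?R - {w} \<times> ?K \<times> ?K" for e'
        using that by (auto simp: B_def e_eq LS2_eqs_def split: if_splits)
      then show "\<forall>e' \<in> ?R - {w} \<times> ?K \<times> ?K. (\<Sum>y\<in>?C. B e e' * LS2_coeff n M z f P e' y * D y x) = 0"
        by simp
    qed
    finally show ?thesis .
  qed
  from rank_family_le[where L = "LS2_coeff n M z f P" and L' = "LS2_coeff n M z' f' P'" and B = B and D = D,
      OF finR finC this]
  show ?thesis unfolding LS2_matrix_def by simp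
qed

end

theorem theorem5p1:
  fixes n :: nat
    and M :: "('v, 'w, 's, 'x, 'm) graph_mfd"
    and z z' :: "'w \<Rightarrow> 'x chain set"
    and f f' :: "'v \<Rightarrow> nat \<Rightarrow> (nat \<Rightarrow> nat \<Rightarrow> real) chain set"
    and P P' :: "'w \<Rightarrow> real mat"
  assumes "n > 3"
    and "generalized_graph_manifold n M"
    and "waldhausen_basis n M z f"
    and "waldhausen_basis n M z' f'"
    and "admissible_P n M z f P"
    and "admissible_P n M z' f' P'"
  shows "LS2_corank n M z f P = LS2_corank n M z' f' P'"
proof -
  interpret graph_manifold n M using assms(1,2) by unfold_locales
  show ?thesis
    using LS2_rank_le[OF assms(3,4,5,6)] LS2_rank_le[OF assms(4,3,6,5)] by (simp add: LS2_corank_def)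
qed

end
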